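(* Let $(\mathcal{C},\mathbb{E},\mathfrak{s})$ be a small $R$-linear extriangulated category with enough projective objects and enough injective objects. Then for every $n>0$ the bifunctor $\mathbb{E}^n$ (defined by iterated coends) is isomorphic to the higher extension bifunctor defined by projective or injective resolutions; that is, there are isomorphisms $$\mathbb{E}^n(X,Y)\cong\mathbb{E}(\Omega^{n-1}X,Y)\cong\mathbb{E}(X,\Sigma^{n-1}Y)$$ natural in $X,Y\in\mathcal{C}$.
   Context: $R$ is a commutative ring with $1$; $\mathcal{C}$ is an additive $R$-linear category. Extriangulated categories: let $\mathbb{E}\colon\mathcal{C}^{\mathrm{op}}\times\mathcal{C}\to\mathrm{Mod}\,R$ be an $R$-bilinear functor. An element $\delta\in\mathbb{E}(C,A)$ is called an extension; for $a\colon A\to A'$ and $c\colon C'\to C$ put $a_*\delta=\mathbb{E}(C,a)(\delta)$ and $c^*\delta=\mathbb{E}(c,A)(\delta)$. A morphism of extensions from $\delta\in\mathbb{E}(C,A)$ to $\delta'\in\mathbb{E}(C',A')$ is a pair $(a\colon A\to A',\,c\colon C\to C')$ with $a_*\delta=c^*\delta'$. The extension $\delta\oplus\delta'\in\mathbb{E}(C\oplus C',A\oplus A')$ is the one with diagonal components $\delta,\delta'$ and zero off-diagonal components. Sequences $A\xrightarrow{x}B\xrightarrow{y}C$ and $A\xrightarrow{x'}B'\xrightarrow{y'}C$ are equivalent if there is an isomorphism $b\colon B\to B'$ with $bx=x'$, $y'b=y$; the class is written $[A\xrightarrow{x}B\xrightarrow{y}C]$. An additive realization $\mathfrak{s}$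 assigns to each $\delta\in\mathbb{E}(C,A)$ such a class $\mathfrak{s}(\delta)=[A\xrightarrow{x}B\xrightarrow{y}C]$ so that: for each morphism $(a,c)\colon\delta\to\delta'$ with $\mathfrak{s}(\delta')=[A'\xrightarrow{x'}B'\xrightarrow{y'}C']$ there is $b\colon B\to B'$ with $bx=x'a$, $y'b=cy$; $\mathfrak{s}(0)=[A\to A\oplus C\to C]$ (canonical maps); and $\mathfrak{s}(\delta\oplus\delta')=\mathfrak{s}(\delta)\oplus\mathfrak{s}(\delta')$. The triple $(\mathcal{C},\mathbb{E},\mathfrak{s})$ is an ($R$-linear) extriangulated category if moreover: (ET3) if $\mathfrak{s}(\delta)=[A\xrightarrow{x}B\xrightarrow{y}C]$, $\mathfrak{s}(\delta')=[A'\xrightarrow{x'}B'\xrightarrow{y'}C']$ and $bx=x'a$, then there is $c$ with $cy=y'b$ and $a_*\delta=c^*\delta'$; (ET3)$^{\mathrm{op}}$ the dual; (ET4) if $\delta\in\mathbb{E}(D,A)$ and $\delta'\in\mathbb{E}(F,B)$ are realized by $A\xrightarrow{f}B\xrightarrow{f'}D$ and $B\xrightarrow{g}C\xrightarrow{g'}F$, then there are an object $E$, morphisms $d\colon D\to E$, $e\colon E\to F$, $h=gf$, $h'\colon C\to E$ with $h'g=df'$, $eh'=g'$, and $\delta''\in\mathbb{E}(E,A)$ realized by $A\xrightarrow{h}C\xrightarrow{h'}E$, such that $D\xrightarrow{d}E\xrightarrow{e}F$ realizes $f'_*\delta'$, $d^*\delta''=\delta$ and $f_*\delta''=e^*\delta'$;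 (ET4)$^{\mathrm{op}}$ the dual. If $\mathfrak{s}(\delta)=[A\xrightarrow{x}B\xrightarrow{y}C]$ one writes $A\xrightarrow{x}B\xrightarrow{y}C\overset{\delta}{\dashrightarrow}$ and calls it an $\mathfrak{s}$-triangle; $x$ is an inflation, $y$ a deflation, $A\to B\to C$ a conflation. An object $P$ is projective if $\mathbb{E}(P,-)=0$, and $I$ is injective if $\mathbb{E}(-,I)=0$. There are enough projective (resp. injective) objects if every object $C$ admits a deflation $P\to C$ with $P$ projective (resp. every object $A$ admits an inflation $A\to I$ with $I$ injective). For $\mathcal{C}$ small, $\mathbb{E}^1=\mathbb{E}$ and inductively $\mathbb{E}^n(X,Y)=\int^{M\in\mathcal{C}}\mathbb{E}^{n-1}(M,Y)\otimes_R\mathbb{E}(X,M)$ (coend). Higher extensions via resolutions: for each object $X$ choose $\mathfrak{s}$-triangles $\Omega X\to P_X\to X\dashrightarrow$ and $X\to I_X\to\Sigma X\dashrightarrow$ with $P_X$ projective and $I_X$ injective. These define functors $\Omega\colon\underline{\mathcal{C}}\to\underline{\mathcal{C}}$ and $\Sigma\colon\overline{\mathcal{C}}\to\overline{\mathcal{C}}$ on the quotients of $\mathcal{C}$ by the ideals of morphisms factoring through projective, resp. injective, objects; put $\Omega^0=\mathrm{id}$, $\Sigma^0=\mathrm{id}$. Since $\mathbb{E}$ vanishes on these ideals in the first, resp. second argument, $\mathbb{E}(\Omega^{n-1}X,Y)$ and $\mathbb{E}(X,\Sigma^{n-1}Y)$ are bifunctors on $\mathcal{C}$. *)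

theory Defs
  imports "HOL-Algebra.Module" "HOL-Algebra.AbelCoset"
begin

section \<open>Constructions in the category of modules\<close>

text \<open>The fields \<open>mult\<close> and \<open>one\<close> of a \<open>module\<close> record play no role in a module.\<close>

definition mod_hom :: "('r, 'k) ring_scheme \<Rightarrow> ('r, 'm) module \<Rightarrow> ('r, 'n) module \<Rightarrow> ('m \<Rightarrow> 'n) set"
  where "mod_hom R M N = {h \<in> carrier M \<rightarrow> carrier N.
     (\<forall>x\<in>carrier M. \<forall>y\<in>carrier M. h (x \<oplus>\<^bsub>M\<^esub> y) = h x \<oplus>\<^bsub>N\<^esub> h y) \<and>
     (\<forall>r\<in>carrier R. \<forall>x\<in>carrier M. h (r \<odot>\<^bsub>M\<^esub> x) = r \<odot>\<^bsub>N\<^esub> h x)}"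

definition mod_iso :: "('r, 'k) ring_scheme \<Rightarrow> ('r, 'm) module \<Rightarrow> ('r, 'n) module \<Rightarrow> ('m \<Rightarrow> 'n) set"
  where "mod_iso R M N = {h \<in> mod_hom R M N. bij_betw h (carrier M) (carrier N)}"

definition free_module :: "('r, 'k) ring_scheme \<Rightarrow> 's set \<Rightarrow> ('r, 's \<Rightarrow> 'r) module"
  where "free_module R S =
    \<lparr>carrier = {p. (\<forall>s. p s \<in> carrier R) \<and> (\<forall>s. s \<notin> S \<longrightarrow> p s = \<zero>\<^bsub>R\<^esub>) \<and> finite {s. p s \<noteq> \<zero>\<^bsub>R\<^esub>}},
     mult = undefined, one = undefined,
     zero = (\<lambda>_. \<zero>\<^bsub>R\<^esub>),
     add = (\<lambda>p q s. p s \<oplus>\<^bsub>R\<^esub> q s),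
     smult = (\<lambda>r p s. r \<otimes>\<^bsub>R\<^esub> p s)\<rparr>"

definition free_gen :: "('r, 'k) ring_scheme \<Rightarrow> 's \<Rightarrow> 's \<Rightarrow> 'r"
  where "free_gen R s = (\<lambda>t. if t = s then \<one>\<^bsub>R\<^esub> else \<zero>\<^bsub>R\<^esub>)"

definition free_map :: "('r, 'k) ring_scheme \<Rightarrow> ('s \<Rightarrow> 't) \<Rightarrow> ('s \<Rightarrow> 'r) \<Rightarrow> 't \<Rightarrow> 'r"
  where "free_map R h p = (\<lambda>t. finsum R p {s. p s \<noteq> \<zero>\<^bsub>R\<^esub> \<and> h s = t})"

definition mod_span :: "('r, 'k) ring_scheme \<Rightarrow> ('r, 'm) module \<Rightarrow> 'm set \<Rightarrow> 'm set"
  where "mod_span R M S = \<Inter>{H. submodule H R M \<and> S \<subseteq> H}"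

definition quot_module :: "('r, 'm) module \<Rightarrow> 'm set \<Rightarrow> ('r, 'm set) module"
  where "quot_module M H =
    \<lparr>carrier = a_rcosets\<^bsub>M\<^esub> H,
     mult = undefined, one = undefined,
     zero = H,
     add = (\<lambda>K L. K <+>\<^bsub>M\<^esub> L),
     smult = (\<lambda>r K. \<Union>k\<in>K. H +>\<^bsub>M\<^esub> (r \<odot>\<^bsub>M\<^esub> k))\<rparr>"

text \<open>The map of quotients \<open>M/H \<rightarrow> M'/H'\<close> induced by \<open>h\<close>, where \<open>h ` H \<subseteq> H'\<close>.\<close>

definition quot_map :: "('r, 'n) module \<Rightarrow> 'n set \<Rightarrow> ('m \<Rightarrow> 'n) \<Rightarrow> 'm set \<Rightarrow> 'n set"
  where "quot_map M' H' h K = (\<Union>k\<in>K. H' +>\<^bsub>M'\<^esub> h k)"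

definition tensor_rel ::
    "('r, 'k) ring_scheme \<Rightarrow> ('r, 'm) module \<Rightarrow> ('r, 'n) module \<Rightarrow> ('m \<times> 'n \<Rightarrow> 'r) set"
  where "tensor_rel R M N = (let F = free_module R (carrier M \<times> carrier N); g = free_gen R in
    mod_span R F
     ({g (x \<oplus>\<^bsub>M\<^esub> x', y) \<ominus>\<^bsub>F\<^esub> (g (x, y) \<oplus>\<^bsub>F\<^esub> g (x', y)) | x x' y.
         x \<in> carrier M \<and> x' \<in> carrier M \<and> y \<in> carrier N} \<union>
      {g (x, y \<oplus>\<^bsub>N\<^esub> y') \<ominus>\<^bsub>F\<^esub> (g (x, y) \<oplus>\<^bsub>F\<^esub> g (x, y')) | x y y'.
         x \<in> carrier M \<and> y \<in> carrier N \<and> y' \<in> carrier N} \<union>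
      {g (r \<odot>\<^bsub>M\<^esub> x, y) \<ominus>\<^bsub>F\<^esub> r \<odot>\<^bsub>F\<^esub> g (x, y) | r x y.
         r \<in> carrier R \<and> x \<in> carrier M \<and> y \<in> carrier N} \<union>
      {g (x, r \<odot>\<^bsub>N\<^esub> y) \<ominus>\<^bsub>F\<^esub> r \<odot>\<^bsub>F\<^esub> g (x, y) | r x y.
         r \<in> carrier R \<and> x \<in> carrier M \<and> y \<in> carrier N}))"

definition tensor ::
    "('r, 'k) ring_scheme \<Rightarrow> ('r, 'm) module \<Rightarrow> ('r, 'n) module \<Rightarrow> ('r, ('m \<times> 'n \<Rightarrow> 'r) set) module"
  where "tensor R M N = quot_module (free_module R (carrier M \<times> carrier N)) (tensor_rel R M N)"

definition pure_tensor ::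
    "('r, 'k) ring_scheme \<Rightarrow> ('r, 'm) module \<Rightarrow> ('r, 'n) module \<Rightarrow> 'm \<Rightarrow> 'n \<Rightarrow> ('m \<times> 'n \<Rightarrow> 'r) set"
  where "pure_tensor R M N x y =
    tensor_rel R M N +>\<^bsub>free_module R (carrier M \<times> carrier N)\<^esub> free_gen R (x, y)"

text \<open>\<open>f \<otimes> g\<close> for linear maps \<open>f\<close>, \<open>g\<close>; \<open>M'\<close> and \<open>N'\<close> are their codomains.\<close>

definition tensor_map ::
    "('r, 'k) ring_scheme \<Rightarrow> ('r, 'm2) module \<Rightarrow> ('r, 'n2) module \<Rightarrow>
     ('m1 \<Rightarrow> 'm2) \<Rightarrow> ('n1 \<Rightarrow> 'n2) \<Rightarrow> ('m1 \<times> 'n1 \<Rightarrow> 'r) set \<Rightarrow> ('m2 \<times> 'n2 \<Rightarrow> 'r) set"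
  where "tensor_map R M' N' f g =
    quot_map (free_module R (carrier M' \<times> carrier N')) (tensor_rel R M' N')
      (free_map R (map_prod f g))"

definition direct_sum :: "'i set \<Rightarrow> ('i \<Rightarrow> ('r, 'm) module) \<Rightarrow> ('r, 'i \<Rightarrow> 'm) module"
  where "direct_sum I F =
    \<lparr>carrier = {u \<in> \<Pi>\<^sub>E i\<in>I. carrier (F i). finite {i \<in> I. u i \<noteq> \<zero>\<^bsub>F i\<^esub>}},
     mult = undefined, one = undefined,
     zero = (\<lambda>i\<in>I. \<zero>\<^bsub>F i\<^esub>),
     add = (\<lambda>u v. \<lambda>i\<in>I. u i \<oplus>\<^bsub>F i\<^esub> v i),
     smult = (\<lambda>r u. \<lambda>i\<in>I. r \<odot>\<^bsub>F i\<^esub> u i)\<rparr>"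

definition sum_inj :: "'i set \<Rightarrow> ('i \<Rightarrow> ('r, 'm) module) \<Rightarrow> 'i \<Rightarrow> 'm \<Rightarrow> 'i \<Rightarrow> 'm"
  where "sum_inj I F i x = (\<lambda>j\<in>I. if j = i then x else \<zero>\<^bsub>F j\<^esub>)"

text \<open>The module structure on \<open>h ` carrier M\<close> for which \<open>h\<close>, assumed injective on \<open>carrier M\<close>,
  is an isomorphism.\<close>

definition transport_module :: "('m \<Rightarrow> 'n) \<Rightarrow> ('r, 'm) module \<Rightarrow> ('r, 'n) module"
  where "transport_module h M = (let g = inv_into (carrier M) h in
    \<lparr>carrier = h ` carrier M,
     mult = undefined, one = undefined,
     zero = h \<zero>\<^bsub>M\<^esub>,
     add = (\<lambda>x y. h (g x \<oplus>\<^bsub>M\<^esub> g y)),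
     smult = (\<lambda>r x. h (r \<odot>\<^bsub>M\<^esub> g x))\<rparr>)"


section \<open>Linear and additive categories\<close>

record ('r, 'o, 'a) lin_cat =
  Obj :: "'o set"
  Hom :: "'o \<Rightarrow> 'o \<Rightarrow> ('r, 'a) module"
  src :: "'a \<Rightarrow> 'o"
  tgt :: "'a \<Rightarrow> 'o"
  Id :: "'o \<Rightarrow> 'a"
  cmp :: "'a \<Rightarrow> 'a \<Rightarrow> 'a" (infixl \<open>\<circledcirc>\<index>\<close> 70)

abbreviation arr :: "('r, 'o, 'a, 'z) lin_cat_scheme \<Rightarrow> 'o \<Rightarrow> 'o \<Rightarrow> 'a set"
  where "arr C A B \<equiv> carrier (Hom C A B)"

locale linear_category = cring R for R :: "('r, 'k) ring_scheme" +
  fixes C :: "('r, 'o, 'a, 'z) lin_cat_scheme" (structure)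
  assumes Hom_module: "\<lbrakk>A \<in> Obj C; B \<in> Obj C\<rbrakk> \<Longrightarrow> module R (Hom C A B)"
    and src_tgt: "\<lbrakk>A \<in> Obj C; B \<in> Obj C; f \<in> arr C A B\<rbrakk> \<Longrightarrow> src C f = A \<and> tgt C f = B"
    and Id_closed: "A \<in> Obj C \<Longrightarrow> Id C A \<in> arr C A A"
    and cmp_closed: "\<lbrakk>A \<in> Obj C; B \<in> Obj C; D \<in> Obj C; f \<in> arr C A B; g \<in> arr C B D\<rbrakk>
      \<Longrightarrow> g \<circledcirc> f \<in> arr C A D"
    and cmp_assoc: "\<lbrakk>A \<in> Obj C; B \<in> Obj C; D \<in> Obj C; E \<in> Obj C;
        f \<in> arr C A B; g \<in> arr C B D; h \<in> arr C D E\<rbrakk>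
      \<Longrightarrow> h \<circledcirc> (g \<circledcirc> f) = (h \<circledcirc> g) \<circledcirc> f"
    and Id_left: "\<lbrakk>A \<in> Obj C; B \<in> Obj C; f \<in> arr C A B\<rbrakk> \<Longrightarrow> Id C B \<circledcirc> f = f"
    and Id_right: "\<lbrakk>A \<in> Obj C; B \<in> Obj C; f \<in> arr C A B\<rbrakk> \<Longrightarrow> f \<circledcirc> Id C A = f"
    and cmp_linear_right: "\<lbrakk>A \<in> Obj C; B \<in> Obj C; D \<in> Obj C; g \<in> arr C B D\<rbrakk>
      \<Longrightarrow> (\<lambda>f. g \<circledcirc> f) \<in> mod_hom R (Hom C A B) (Hom C A D)"
    and cmp_linear_left: "\<lbrakk>A \<in> Obj C; B \<in> Obj C; D \<in> Obj C; f \<in> arr C A B\<rbrakk>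
      \<Longrightarrow> (\<lambda>g. g \<circledcirc> f) \<in> mod_hom R (Hom C B D) (Hom C A D)"

definition is_iso :: "('r, 'o, 'a, 'z) lin_cat_scheme \<Rightarrow> 'o \<Rightarrow> 'o \<Rightarrow> 'a \<Rightarrow> bool"
  where "is_iso C A B b \<longleftrightarrow> b \<in> arr C A B \<and>
    (\<exists>b'\<in>arr C B A. b' \<circledcirc>\<^bsub>C\<^esub> b = Id C A \<and> b \<circledcirc>\<^bsub>C\<^esub> b' = Id C B)"

definition zero_object :: "('r, 'o, 'a, 'z) lin_cat_scheme \<Rightarrow> 'o \<Rightarrow> bool"
  where "zero_object C Z \<longleftrightarrow> Z \<in> Obj C \<and>
    (\<forall>A\<in>Obj C. arr C Z A = {\<zero>\<^bsub>Hom C Z A\<^esub>} \<and> arr C A Z = {\<zero>\<^bsub>Hom C A Z\<^esub>})"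

text \<open>\<open>S\<close> is a biproduct of \<open>A\<close> and \<open>B\<close> with injections \<open>i\<close>, \<open>j\<close> and projections \<open>p\<close>, \<open>q\<close>.\<close>

definition biproduct ::
    "('r, 'o, 'a, 'z) lin_cat_scheme \<Rightarrow> 'o \<Rightarrow> 'o \<Rightarrow> 'o \<Rightarrow> 'a \<Rightarrow> 'a \<Rightarrow> 'a \<Rightarrow> 'a \<Rightarrow> bool"
  where "biproduct C A B S i j p q \<longleftrightarrow>
    A \<in> Obj C \<and> B \<in> Obj C \<and> S \<in> Obj C \<and>
    i \<in> arr C A S \<and> j \<in> arr C B S \<and> p \<in> arr C S A \<and> q \<in> arr C S B \<and>
    p \<circledcirc>\<^bsub>C\<^esub> i = Id C A \<and> q \<circledcirc>\<^bsub>C\<^esub> j = Id C B \<and>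
    q \<circledcirc>\<^bsub>C\<^esub> i = \<zero>\<^bsub>Hom C A B\<^esub> \<and> p \<circledcirc>\<^bsub>C\<^esub> j = \<zero>\<^bsub>Hom C B A\<^esub> \<and>
    (i \<circledcirc>\<^bsub>C\<^esub> p) \<oplus>\<^bsub>Hom C S S\<^esub> (j \<circledcirc>\<^bsub>C\<^esub> q) = Id C S"

locale additive_category = linear_category +
  assumes ex_zero_object: "\<exists>Z. zero_object C Z"
    and ex_biproduct: "\<lbrakk>A \<in> Obj C; B \<in> Obj C\<rbrakk> \<Longrightarrow> \<exists>S i j p q. biproduct C A B S i j p q"


section \<open>Bifunctors and coends\<close>

text \<open>A functor \<open>F\<close> on \<open>C\<^sup>o\<^sup>p \<times> C\<close> with values in modules; for \<open>c : X' \<rightarrow> X\<close> and \<open>a : Y \<rightarrow> Y'\<close>,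
  \<open>bmap F c a\<close> is the map \<open>F(c, a) : F(X, Y) \<rightarrow> F(X', Y')\<close>.\<close>

record ('r, 'o, 'a, 'e) bifunctor =
  bval :: "'o \<Rightarrow> 'o \<Rightarrow> ('r, 'e) module"
  bmap :: "'a \<Rightarrow> 'a \<Rightarrow> 'e \<Rightarrow> 'e"

locale bilinear_bifunctor = linear_category R C
  for R :: "('r, 'k) ring_scheme" and C :: "('r, 'o, 'a, 'z) lin_cat_scheme" (structure) +
  fixes F :: "('r, 'o, 'a, 'e) bifunctor"
  assumes bval_module: "\<lbrakk>X \<in> Obj C; Y \<in> Obj C\<rbrakk> \<Longrightarrow> module R (bval F X Y)"
    and bmap_hom: "\<lbrakk>X \<in> Obj C; X' \<in> Obj C; Y \<in> Obj C; Y' \<in> Obj C; c \<in> arr C X' X; a \<in> arr C Y Y'\<rbrakk>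
      \<Longrightarrow> bmap F c a \<in> mod_hom R (bval F X Y) (bval F X' Y')"
    and bmap_Id: "\<lbrakk>X \<in> Obj C; Y \<in> Obj C; \<delta> \<in> carrier (bval F X Y)\<rbrakk>
      \<Longrightarrow> bmap F (Id C X) (Id C Y) \<delta> = \<delta>"
    and bmap_cmp: "\<lbrakk>X \<in> Obj C; X' \<in> Obj C; X'' \<in> Obj C; Y \<in> Obj C; Y' \<in> Obj C; Y'' \<in> Obj C;
        c \<in> arr C X' X; c' \<in> arr C X'' X'; a \<in> arr C Y Y'; a' \<in> arr C Y' Y'';
        \<delta> \<in> carrier (bval F X Y)\<rbrakk>
      \<Longrightarrow> bmap F (c \<circledcirc> c') (a' \<circledcirc> a) \<delta> = bmap F c' a' (bmap F c a \<delta>)"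
    and bmap_linear_left: "\<lbrakk>X \<in> Obj C; X' \<in> Obj C; Y \<in> Obj C; Y' \<in> Obj C; a \<in> arr C Y Y';
        \<delta> \<in> carrier (bval F X Y)\<rbrakk>
      \<Longrightarrow> (\<lambda>c. bmap F c a \<delta>) \<in> mod_hom R (Hom C X' X) (bval F X' Y')"
    and bmap_linear_right: "\<lbrakk>X \<in> Obj C; X' \<in> Obj C; Y \<in> Obj C; Y' \<in> Obj C; c \<in> arr C X' X;
        \<delta> \<in> carrier (bval F X Y)\<rbrakk>
      \<Longrightarrow> (\<lambda>a. bmap F c a \<delta>) \<in> mod_hom R (Hom C Y Y') (bval F X' Y')"

definition bifunctor_iso ::
    "('r, 'k) ring_scheme \<Rightarrow> ('r, 'o, 'a, 'z) lin_cat_scheme \<Rightarrow>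
     ('r, 'o, 'a, 'e) bifunctor \<Rightarrow> ('r, 'o, 'a, 'f) bifunctor \<Rightarrow> bool"
  where "bifunctor_iso R C F G \<longleftrightarrow> (\<exists>\<eta>.
    (\<forall>X\<in>Obj C. \<forall>Y\<in>Obj C. \<eta> X Y \<in> mod_iso R (bval F X Y) (bval G X Y)) \<and>
    (\<forall>X\<in>Obj C. \<forall>X'\<in>Obj C. \<forall>Y\<in>Obj C. \<forall>Y'\<in>Obj C. \<forall>c\<in>arr C X' X. \<forall>a\<in>arr C Y Y'.
       \<forall>\<xi>\<in>carrier (bval F X Y). \<eta> X' Y' (bmap F c a \<xi>) = bmap G c a (\<eta> X Y \<xi>)))"

definition transport_bifunctor ::
    "('r, 'o, 'a, 'z) lin_cat_scheme \<Rightarrow> ('o \<Rightarrow> 'o \<Rightarrow> 'e \<Rightarrow> 'f) \<Rightarrow>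
     ('r, 'o, 'a, 'e) bifunctor \<Rightarrow> ('r, 'o, 'a, 'f) bifunctor"
  where "transport_bifunctor C h F =
    \<lparr>bval = (\<lambda>X Y. transport_module (h X Y) (bval F X Y)),
     bmap = (\<lambda>c a \<xi>. h (src C c) (tgt C a) (bmap F c a
       (inv_into (carrier (bval F (tgt C c) (src C a))) (h (tgt C c) (src C a)) \<xi>)))\<rparr>"

text \<open>The coend of \<open>T\<close> is the cokernel of the difference of the two maps
  \<open>\<Oplus>\<^bsub>f : M \<rightarrow> N\<^esub> T(N, M) \<rightarrow> \<Oplus>\<^bsub>M\<^esub> T(M, M)\<close> given by \<open>T(f, M)\<close> and \<open>T(N, f)\<close>.\<close>

definition coend_sum ::
    "('r, 'o, 'a, 'z) lin_cat_scheme \<Rightarrow> ('r, 'o, 'a, 't) bifunctor \<Rightarrow> ('r, 'o \<Rightarrow> 't) module"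
  where "coend_sum C T = direct_sum (Obj C) (\<lambda>M. bval T M M)"

definition coend_rel ::
    "('r, 'k) ring_scheme \<Rightarrow> ('r, 'o, 'a, 'z) lin_cat_scheme \<Rightarrow>
     ('r, 'o, 'a, 't) bifunctor \<Rightarrow> ('o \<Rightarrow> 't) set"
  where "coend_rel R C T =
    (let D = coend_sum C T; incl = sum_inj (Obj C) (\<lambda>M. bval T M M) in
     mod_span R D {incl M (bmap T f (Id C M) t) \<ominus>\<^bsub>D\<^esub> incl N (bmap T (Id C N) f t) | M N f t.
       M \<in> Obj C \<and> N \<in> Obj C \<and> f \<in> arr C M N \<and> t \<in> carrier (bval T N M)})"

definition coend ::
    "('r, 'k) ring_scheme \<Rightarrow> ('r, 'o, 'a, 'z) lin_cat_scheme \<Rightarrow>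
     ('r, 'o, 'a, 't) bifunctor \<Rightarrow> ('r, ('o \<Rightarrow> 't) set) module"
  where "coend R C T = quot_module (coend_sum C T) (coend_rel R C T)"

definition coend_in ::
    "('r, 'k) ring_scheme \<Rightarrow> ('r, 'o, 'a, 'z) lin_cat_scheme \<Rightarrow>
     ('r, 'o, 'a, 't) bifunctor \<Rightarrow> 'o \<Rightarrow> 't \<Rightarrow> ('o \<Rightarrow> 't) set"
  where "coend_in R C T M t =
    coend_rel R C T +>\<^bsub>coend_sum C T\<^esub> sum_inj (Obj C) (\<lambda>M. bval T M M) M t"

text \<open>The map of coends induced by a natural transformation with diagonal components \<open>\<tau> M\<close>;
  \<open>T'\<close> is its target.\<close>

definition coend_map ::
    "('r, 'k) ring_scheme \<Rightarrow> ('r, 'o, 'a, 'z) lin_cat_scheme \<Rightarrow>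
     ('r, 'o, 'a, 'u) bifunctor \<Rightarrow> ('o \<Rightarrow> 't \<Rightarrow> 'u) \<Rightarrow> ('o \<Rightarrow> 't) set \<Rightarrow> ('o \<Rightarrow> 'u) set"
  where "coend_map R C T' \<tau> =
    quot_map (coend_sum C T') (coend_rel R C T') (\<lambda>u. \<lambda>M\<in>Obj C. \<tau> M (u M))"

text \<open>The bifunctor \<open>(M, N) \<mapsto> F(M, Y) \<otimes> G(X, N)\<close>.\<close>

definition tensor_bifunctor ::
    "('r, 'k) ring_scheme \<Rightarrow> ('r, 'o, 'a, 'z) lin_cat_scheme \<Rightarrow>
     ('r, 'o, 'a, 'f) bifunctor \<Rightarrow> ('r, 'o, 'a, 'g) bifunctor \<Rightarrow> 'o \<Rightarrow> 'o \<Rightarrow>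
     ('r, 'o, 'a, ('f \<times> 'g \<Rightarrow> 'r) set) bifunctor"
  where "tensor_bifunctor R C F G X Y =
    \<lparr>bval = (\<lambda>M N. tensor R (bval F M Y) (bval G X N)),
     bmap = (\<lambda>f g. tensor_map R (bval F (src C f) Y) (bval G X (tgt C g))
                     (bmap F f (Id C Y)) (bmap G (Id C X) g))\<rparr>"

text \<open>The bifunctor sending \<open>(X, Y)\<close> to the coend over \<open>M\<close> of \<open>F(M, Y) \<otimes> G(X, M)\<close>.\<close>

definition coend_comp ::
    "('r, 'k) ring_scheme \<Rightarrow> ('r, 'o, 'a, 'z) lin_cat_scheme \<Rightarrow>
     ('r, 'o, 'a, 'f) bifunctor \<Rightarrow> ('r, 'o, 'a, 'g) bifunctor \<Rightarrow>
     ('r, 'o, 'a, ('o \<Rightarrow> ('f \<times> 'g \<Rightarrow> 'r) set) set) bifunctor"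
  where "coend_comp R C F G =
    \<lparr>bval = (\<lambda>X Y. coend R C (tensor_bifunctor R C F G X Y)),
     bmap = (\<lambda>c a. coend_map R C (tensor_bifunctor R C F G (src C c) (tgt C a))
       (\<lambda>M. tensor_map R (bval F M (tgt C a)) (bval G (src C c) M)
              (bmap F (Id C M) a) (bmap G c (Id C M))))\<rparr>"


section \<open>Extriangulated categories\<close>

text \<open>\<open>realn C X A \<delta>\<close> is the equivalence class, written \<open>\<s>(\<delta>)\<close> in the literature, of sequences
  \<open>A \<rightarrow> B \<rightarrow> X\<close> assigned to \<open>\<delta> \<in> \<E>(X, A)\<close>.\<close>

record ('r, 'o, 'a, 'e) ext_cat = "('r, 'o, 'a) lin_cat" +
  EE :: "('r, 'o, 'a, 'e) bifunctor"
  realn :: "'o \<Rightarrow> 'o \<Rightarrow> 'e \<Rightarrow> ('a \<times> 'a) set"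

abbreviation Ext :: "('r, 'o, 'a, 'e, 'z) ext_cat_scheme \<Rightarrow> 'o \<Rightarrow> 'o \<Rightarrow> ('r, 'e) module"
  where "Ext C X A \<equiv> bval (EE C) X A"

text \<open>\<open>push C X a \<delta> = a\<^sub>* \<delta>\<close> for \<open>\<delta> \<in> \<E>(X, A)\<close>, and \<open>pull C A c \<delta> = c\<^sup>* \<delta>\<close> for \<open>\<delta> \<in> \<E>(X, A)\<close>.\<close>

definition push :: "('r, 'o, 'a, 'e, 'z) ext_cat_scheme \<Rightarrow> 'o \<Rightarrow> 'a \<Rightarrow> 'e \<Rightarrow> 'e"
  where "push C X a \<delta> = bmap (EE C) (Id C X) a \<delta>"

definition pull :: "('r, 'o, 'a, 'e, 'z) ext_cat_scheme \<Rightarrow> 'o \<Rightarrow> 'a \<Rightarrow> 'e \<Rightarrow> 'e"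
  where "pull C A c \<delta> = bmap (EE C) c (Id C A) \<delta>"

definition seqs :: "('r, 'o, 'a, 'z) lin_cat_scheme \<Rightarrow> 'o \<Rightarrow> 'o \<Rightarrow> ('a \<times> 'a) set"
  where "seqs C A X = {(x, y). \<exists>B\<in>Obj C. x \<in> arr C A B \<and> y \<in> arr C B X}"

definition seq_equiv :: "('r, 'o, 'a, 'z) lin_cat_scheme \<Rightarrow> 'o \<Rightarrow> 'o \<Rightarrow> ('a \<times> 'a) rel"
  where "seq_equiv C A X = {((x, y), (x', y')). (x, y) \<in> seqs C A X \<and> (x', y') \<in> seqs C A X \<and>
    (\<exists>b. is_iso C (tgt C x) (tgt C x') b \<and> b \<circledcirc>\<^bsub>C\<^esub> x = x' \<and> y' \<circledcirc>\<^bsub>C\<^esub> b = y)}"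

text \<open>\<open>A \<rightarrow> B \<rightarrow> X\<close>, with arrows \<open>x\<close>, \<open>y\<close> and \<open>B = tgt C x\<close>, together with \<open>\<delta> \<in> \<E>(X, A)\<close> is an
  \<open>\<s>\<close>-triangle.\<close>

definition triangle :: "('r, 'o, 'a, 'e, 'z) ext_cat_scheme \<Rightarrow> 'o \<Rightarrow> 'o \<Rightarrow> 'e \<Rightarrow> 'a \<Rightarrow> 'a \<Rightarrow> bool"
  where "triangle C X A \<delta> x y \<longleftrightarrow> X \<in> Obj C \<and> A \<in> Obj C \<and> \<delta> \<in> carrier (Ext C X A) \<and>
    (x, y) \<in> seqs C A X \<and> realn C X A \<delta> = seq_equiv C A X `` {(x, y)}"

text \<open>\<open>\<epsilon> \<in> \<E>(T, S)\<close> is \<open>\<delta> \<oplus> \<delta>'\<close>, where \<open>S = A \<oplus> A'\<close> has projections \<open>p\<close>, \<open>p'\<close> and \<open>T = X \<oplus> X'\<close>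
  has injections \<open>i\<close>, \<open>i'\<close>.\<close>

definition is_ext_sum ::
    "('r, 'o, 'a, 'e, 'z) ext_cat_scheme \<Rightarrow> 'o \<Rightarrow> 'o \<Rightarrow> 'e \<Rightarrow> 'o \<Rightarrow> 'o \<Rightarrow> 'e \<Rightarrow>
     'o \<Rightarrow> 'o \<Rightarrow> 'a \<Rightarrow> 'a \<Rightarrow> 'a \<Rightarrow> 'a \<Rightarrow> 'e \<Rightarrow> bool"
  where "is_ext_sum C X A \<delta> X' A' \<delta>' T S i i' p p' \<epsilon> \<longleftrightarrow> \<epsilon> \<in> carrier (Ext C T S) \<and>
    bmap (EE C) i p \<epsilon> = \<delta> \<and> bmap (EE C) i' p' \<epsilon> = \<delta>' \<and>
    bmap (EE C) i p' \<epsilon> = \<zero>\<^bsub>Ext C X A'\<^esub> \<and> bmap (EE C) i' p \<epsilon> = \<zero>\<^bsub>Ext C X' A\<^esub>"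

locale additive_realization =
  additive_category R C + bilinear_bifunctor R C "EE C"
  for R :: "('r, 'k) ring_scheme" and C :: "('r, 'o, 'a, 'e, 'z) ext_cat_scheme" (structure) +
  assumes realn_class: "\<lbrakk>X \<in> Obj C; A \<in> Obj C; \<delta> \<in> carrier (Ext C X A)\<rbrakk>
      \<Longrightarrow> realn C X A \<delta> \<in> seqs C A X // seq_equiv C A X"
    and realn_morphism: "\<lbrakk>triangle C X A \<delta> x y; triangle C X' A' \<delta>' x' y';
        a \<in> arr C A A'; c \<in> arr C X X'; push C X a \<delta> = pull C A' c \<delta>'\<rbrakk>
      \<Longrightarrow> \<exists>b\<in>arr C (tgt C x) (tgt C x'). b \<circledcirc> x = x' \<circledcirc> a \<and> y' \<circledcirc> b = c \<circledcirc> y"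
    and realn_zero: "biproduct C A X S i j p q \<Longrightarrow> triangle C X A \<zero>\<^bsub>Ext C X A\<^esub> i q"
    and realn_sum: "\<lbrakk>triangle C X A \<delta> x y; triangle C X' A' \<delta>' x' y';
        biproduct C A A' S i\<^sub>A j\<^sub>A p\<^sub>A q\<^sub>A;
        biproduct C (tgt C x) (tgt C x') U i\<^sub>B j\<^sub>B p\<^sub>B q\<^sub>B;
        biproduct C X X' T i\<^sub>X j\<^sub>X p\<^sub>X q\<^sub>X;
        is_ext_sum C X A \<delta> X' A' \<delta>' T S i\<^sub>X j\<^sub>X p\<^sub>A q\<^sub>A \<epsilon>\<rbrakk>
      \<Longrightarrow> triangle C T S \<epsilon>
            ((i\<^sub>B \<circledcirc> x \<circledcirc> p\<^sub>A) \<oplus>\<^bsub>Hom C S U\<^esub> (j\<^sub>B \<circledcirc> x' \<circledcirc> q\<^sub>A))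
            ((i\<^sub>X \<circledcirc> y \<circledcirc> p\<^sub>B) \<oplus>\<^bsub>Hom C U T\<^esub> (j\<^sub>X \<circledcirc> y' \<circledcirc> q\<^sub>B))"

locale extriangulated_category = additive_realization +
  assumes ET3: "\<lbrakk>triangle C X A \<delta> x y; triangle C X' A' \<delta>' x' y';
        a \<in> arr C A A'; b \<in> arr C (tgt C x) (tgt C x'); b \<circledcirc> x = x' \<circledcirc> a\<rbrakk>
      \<Longrightarrow> \<exists>c\<in>arr C X X'. c \<circledcirc> y = y' \<circledcirc> b \<and> push C X a \<delta> = pull C A' c \<delta>'"
    and ET3_op: "\<lbrakk>triangle C X A \<delta> x y; triangle C X' A' \<delta>' x' y';
        c \<in> arr C X X'; b \<in> arr C (tgt C x) (tgt C x'); c \<circledcirc> y = y' \<circledcirc> b\<rbrakk>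
      \<Longrightarrow> \<exists>a\<in>arr C A A'. b \<circledcirc> x = x' \<circledcirc> a \<and> push C X a \<delta> = pull C A' c \<delta>'"
    and ET4: "\<lbrakk>triangle C D A \<delta> f f'; f \<in> arr C A B; triangle C F B \<delta>' g g'\<rbrakk>
      \<Longrightarrow> \<exists>E\<in>Obj C. \<exists>d\<in>arr C D E. \<exists>e\<in>arr C E F. \<exists>h'\<in>arr C (tgt C g) E.
            \<exists>\<delta>''\<in>carrier (Ext C E A).
            h' \<circledcirc> g = d \<circledcirc> f' \<and> e \<circledcirc> h' = g' \<and>
            triangle C E A \<delta>'' (g \<circledcirc> f) h' \<and>
            triangle C F D (push C F f' \<delta>') d e \<and>
            pull C A d \<delta>'' = \<delta> \<and> push C E f \<delta>'' = pull C B e \<delta>'"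
    and ET4_op: "\<lbrakk>triangle C A D \<delta> f' f; f \<in> arr C B A; triangle C B F \<delta>' g' g\<rbrakk>
      \<Longrightarrow> \<exists>E\<in>Obj C. \<exists>d\<in>arr C E D. \<exists>e\<in>arr C F E. \<exists>h'\<in>arr C E (tgt C g').
            \<exists>\<delta>''\<in>carrier (Ext C A E).
            g \<circledcirc> h' = f' \<circledcirc> d \<and> h' \<circledcirc> e = g' \<and>
            triangle C A E \<delta>'' h' (f \<circledcirc> g) \<and>
            triangle C D F (pull C F f' \<delta>') e d \<and>
            push C A d \<delta>'' = \<delta> \<and> pull C E f \<delta>'' = push C B e \<delta>'"

definition inflation :: "('r, 'o, 'a, 'e, 'z) ext_cat_scheme \<Rightarrow> 'a \<Rightarrow> bool"
  where "inflation C x \<longleftrightarrow> (\<exists>X A \<delta> y. triangle C X A \<delta> x y)"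

definition deflation :: "('r, 'o, 'a, 'e, 'z) ext_cat_scheme \<Rightarrow> 'a \<Rightarrow> bool"
  where "deflation C y \<longleftrightarrow> (\<exists>X A \<delta> x. triangle C X A \<delta> x y)"

definition projective :: "('r, 'o, 'a, 'e, 'z) ext_cat_scheme \<Rightarrow> 'o \<Rightarrow> bool"
  where "projective C P \<longleftrightarrow> P \<in> Obj C \<and> (\<forall>A\<in>Obj C. carrier (Ext C P A) = {\<zero>\<^bsub>Ext C P A\<^esub>})"

definition injective :: "('r, 'o, 'a, 'e, 'z) ext_cat_scheme \<Rightarrow> 'o \<Rightarrow> bool"
  where "injective C I \<longleftrightarrow> I \<in> Obj C \<and> (\<forall>X\<in>Obj C. carrier (Ext C X I) = {\<zero>\<^bsub>Ext C X I\<^esub>})"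

definition enough_projectives :: "('r, 'o, 'a, 'e, 'z) ext_cat_scheme \<Rightarrow> bool"
  where "enough_projectives C \<longleftrightarrow>
    (\<forall>X\<in>Obj C. \<exists>P. projective C P \<and> (\<exists>y\<in>arr C P X. deflation C y))"

definition enough_injectives :: "('r, 'o, 'a, 'e, 'z) ext_cat_scheme \<Rightarrow> bool"
  where "enough_injectives C \<longleftrightarrow>
    (\<forall>A\<in>Obj C. \<exists>I. injective C I \<and> (\<exists>x\<in>arr C A I. inflation C x))"


section \<open>Higher extensions by iterated coends\<close>

text \<open>The type of elements of \<open>coend_comp R C F (EE C)\<close> grows with that of \<open>F\<close>, so the iteration is
  carried out up to a relabelling in one fixed type: an element of the coend is represented by
  a chosen finite list of triples \<open>(M, \<xi>, \<delta>)\<close> such that it is the sum of the images of the \<open>\<xi> \<otimes> \<delta>\<close>.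
  Every element is such a sum and is determined by the list, so the relabelling is injective.\<close>

datatype ('o, 'e) hext = Base 'e | Cls "('o \<times> ('o, 'e) hext \<times> 'e) list"

definition coend_sum_list ::
    "('r, 'k) ring_scheme \<Rightarrow> ('r, 'o, 'a, 'z) lin_cat_scheme \<Rightarrow>
     ('r, 'o, 'a, 'f) bifunctor \<Rightarrow> ('r, 'o, 'a, 'g) bifunctor \<Rightarrow> 'o \<Rightarrow> 'o \<Rightarrow>
     ('o \<times> 'f \<times> 'g) list \<Rightarrow> ('o \<Rightarrow> ('f \<times> 'g \<Rightarrow> 'r) set) set"
  where "coend_sum_list R C F G X Y l =
    (let T = tensor_bifunctor R C F G X Y in
     foldr (\<lambda>(M, \<xi>, \<delta>) K.
         coend_in R C T M (pure_tensor R (bval F M Y) (bval G X M) \<xi> \<delta>) \<oplus>\<^bsub>coend R C T\<^esub> K)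
       l \<zero>\<^bsub>coend R C T\<^esub>)"

definition hext_code ::
    "('r, 'k) ring_scheme \<Rightarrow> ('r, 'o, 'a, 'e, 'z) ext_cat_scheme \<Rightarrow>
     ('r, 'o, 'a, ('o, 'e) hext) bifunctor \<Rightarrow> 'o \<Rightarrow> 'o \<Rightarrow>
     ('o \<Rightarrow> (('o, 'e) hext \<times> 'e \<Rightarrow> 'r) set) set \<Rightarrow> ('o, 'e) hext"
  where "hext_code R C F X Y K = Cls (SOME l.
    (\<forall>(M, \<xi>, \<delta>)\<in>set l. M \<in> Obj C \<and> \<xi> \<in> carrier (bval F M Y) \<and> \<delta> \<in> carrier (Ext C X M)) \<and>
    coend_sum_list R C F (EE C) X Y l = K)"

text \<open>\<open>higher_ext_Suc R C k\<close> is \<open>\<E>\<^sup>k\<^sup>+\<^sup>1\<close>.\<close>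

primrec higher_ext_Suc ::
    "('r, 'k) ring_scheme \<Rightarrow> ('r, 'o, 'a, 'e, 'z) ext_cat_scheme \<Rightarrow> nat \<Rightarrow>
     ('r, 'o, 'a, ('o, 'e) hext) bifunctor"
  where
    "higher_ext_Suc R C 0 = transport_bifunctor C (\<lambda>_ _. Base) (EE C)"
  | "higher_ext_Suc R C (Suc k) =
       (let F = higher_ext_Suc R C k in
        transport_bifunctor C (hext_code R C F) (coend_comp R C F (EE C)))"

definition higher_ext ::
    "('r, 'k) ring_scheme \<Rightarrow> ('r, 'o, 'a, 'e, 'z) ext_cat_scheme \<Rightarrow> nat \<Rightarrow>
     ('r, 'o, 'a, ('o, 'e) hext) bifunctor"
  where "higher_ext R C n = higher_ext_Suc R C (n - 1)"


section \<open>Higher extensions by resolutions\<close>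

text \<open>A choice of \<open>\<s>\<close>-triangles \<open>\<Omega>X \<rightarrow> P\<^sub>X \<rightarrow> X\<close> with extension \<open>\<omega> X\<close>, and of \<open>\<s>\<close>-triangles
  \<open>X \<rightarrow> I\<^sub>X \<rightarrow> \<Sigma>X\<close> with extension \<open>\<sigma> X\<close>.\<close>

definition syzygy_choice ::
    "('r, 'o, 'a, 'e, 'z) ext_cat_scheme \<Rightarrow> ('o \<Rightarrow> 'o) \<Rightarrow> ('o \<Rightarrow> 'o) \<Rightarrow> ('o \<Rightarrow> 'a) \<Rightarrow> ('o \<Rightarrow> 'a) \<Rightarrow>
     ('o \<Rightarrow> 'e) \<Rightarrow> bool"
  where "syzygy_choice C \<Omega> P u p \<omega> \<longleftrightarrow> (\<forall>X\<in>Obj C.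
    projective C (P X) \<and> u X \<in> arr C (\<Omega> X) (P X) \<and> p X \<in> arr C (P X) X \<and>
    triangle C X (\<Omega> X) (\<omega> X) (u X) (p X))"

definition cosyzygy_choice ::
    "('r, 'o, 'a, 'e, 'z) ext_cat_scheme \<Rightarrow> ('o \<Rightarrow> 'o) \<Rightarrow> ('o \<Rightarrow> 'o) \<Rightarrow> ('o \<Rightarrow> 'a) \<Rightarrow> ('o \<Rightarrow> 'a) \<Rightarrow>
     ('o \<Rightarrow> 'e) \<Rightarrow> bool"
  where "cosyzygy_choice C \<Sigma> I v q \<sigma> \<longleftrightarrow> (\<forall>X\<in>Obj C.
    injective C (I X) \<and> v X \<in> arr C X (I X) \<and> q X \<in> arr C (I X) (\<Sigma> X) \<and>
    triangle C (\<Sigma> X) X (\<sigma> X) (v X) (q X))"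

definition proj_ideal :: "('r, 'o, 'a, 'e, 'z) ext_cat_scheme \<Rightarrow> 'o \<Rightarrow> 'o \<Rightarrow> 'a set"
  where "proj_ideal C A B =
    {h \<circledcirc>\<^bsub>C\<^esub> g | P g h. projective C P \<and> g \<in> arr C A P \<and> h \<in> arr C P B}"

definition inj_ideal :: "('r, 'o, 'a, 'e, 'z) ext_cat_scheme \<Rightarrow> 'o \<Rightarrow> 'o \<Rightarrow> 'a set"
  where "inj_ideal C A B =
    {h \<circledcirc>\<^bsub>C\<^esub> g | I g h. injective C I \<and> g \<in> arr C A I \<and> h \<in> arr C I B}"

text \<open>The morphisms \<open>A \<rightarrow> B\<close> in the quotient categories are the cosets of these submodules.\<close>

definition proj_class :: "('r, 'o, 'a, 'e, 'z) ext_cat_scheme \<Rightarrow> 'o \<Rightarrow> 'o \<Rightarrow> 'a \<Rightarrow> 'a set"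
  where "proj_class C A B f = proj_ideal C A B +>\<^bsub>Hom C A B\<^esub> f"

definition inj_class :: "('r, 'o, 'a, 'e, 'z) ext_cat_scheme \<Rightarrow> 'o \<Rightarrow> 'o \<Rightarrow> 'a \<Rightarrow> 'a set"
  where "inj_class C A B f = inj_ideal C A B +>\<^bsub>Hom C A B\<^esub> f"

text \<open>\<open>\<Omega>\<close> sends the class of \<open>f : A \<rightarrow> B\<close> to the class of any \<open>a : \<Omega>A \<rightarrow> \<Omega>B\<close> such that \<open>(a, f)\<close> is a
  morphism of extensions \<open>\<omega> A \<rightarrow> \<omega> B\<close>. As this class is independent of \<open>f\<close> and \<open>a\<close>, the union
  below is a single coset. Dually for \<open>\<Sigma>\<close>.\<close>

definition syzygy_map ::
    "('r, 'o, 'a, 'e, 'z) ext_cat_scheme \<Rightarrow> ('o \<Rightarrow> 'o) \<Rightarrow> ('o \<Rightarrow> 'e) \<Rightarrow> 'o \<Rightarrow> 'o \<Rightarrow> 'a set \<Rightarrow> 'a set"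
  where "syzygy_map C \<Omega> \<omega> A B F =
    (\<Union>f\<in>F. \<Union>a\<in>{a \<in> arr C (\<Omega> A) (\<Omega> B). push C A a (\<omega> A) = pull C (\<Omega> B) f (\<omega> B)}.
       proj_class C (\<Omega> A) (\<Omega> B) a)"

definition cosyzygy_map ::
    "('r, 'o, 'a, 'e, 'z) ext_cat_scheme \<Rightarrow> ('o \<Rightarrow> 'o) \<Rightarrow> ('o \<Rightarrow> 'e) \<Rightarrow> 'o \<Rightarrow> 'o \<Rightarrow> 'a set \<Rightarrow> 'a set"
  where "cosyzygy_map C \<Sigma> \<sigma> A B F =
    (\<Union>f\<in>F. \<Union>c\<in>{c \<in> arr C (\<Sigma> A) (\<Sigma> B). push C (\<Sigma> A) f (\<sigma> A) = pull C B c (\<sigma> B)}.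
       inj_class C (\<Sigma> A) (\<Sigma> B) c)"

primrec syzygy_map_pow ::
    "('r, 'o, 'a, 'e, 'z) ext_cat_scheme \<Rightarrow> ('o \<Rightarrow> 'o) \<Rightarrow> ('o \<Rightarrow> 'e) \<Rightarrow> nat \<Rightarrow> 'o \<Rightarrow> 'o \<Rightarrow>
     'a set \<Rightarrow> 'a set"
  where
    "syzygy_map_pow C \<Omega> \<omega> 0 A B F = F"
  | "syzygy_map_pow C \<Omega> \<omega> (Suc n) A B F =
       syzygy_map C \<Omega> \<omega> ((\<Omega> ^^ n) A) ((\<Omega> ^^ n) B) (syzygy_map_pow C \<Omega> \<omega> n A B F)"

primrec cosyzygy_map_pow ::
    "('r, 'o, 'a, 'e, 'z) ext_cat_scheme \<Rightarrow> ('o \<Rightarrow> 'o) \<Rightarrow> ('o \<Rightarrow> 'e) \<Rightarrow> nat \<Rightarrow> 'o \<Rightarrow> 'o \<Rightarrow>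
     'a set \<Rightarrow> 'a set"
  where
    "cosyzygy_map_pow C \<Sigma> \<sigma> 0 A B F = F"
  | "cosyzygy_map_pow C \<Sigma> \<sigma> (Suc n) A B F =
       cosyzygy_map C \<Sigma> \<sigma> ((\<Sigma> ^^ n) A) ((\<Sigma> ^^ n) B) (cosyzygy_map_pow C \<Sigma> \<sigma> n A B F)"

text \<open>The bifunctors \<open>\<E>(\<Omega>\<^sup>m X, Y)\<close> and \<open>\<E>(X, \<Sigma>\<^sup>m Y)\<close>. On morphisms, all members of a coset induce
  the same map on \<open>\<E>\<close>, whence \<open>the_elem\<close>.\<close>

definition syzygy_ext ::
    "('r, 'o, 'a, 'e, 'z) ext_cat_scheme \<Rightarrow> ('o \<Rightarrow> 'o) \<Rightarrow> ('o \<Rightarrow> 'e) \<Rightarrow> nat \<Rightarrow>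
     ('r, 'o, 'a, 'e) bifunctor"
  where "syzygy_ext C \<Omega> \<omega> m =
    \<lparr>bval = (\<lambda>X Y. Ext C ((\<Omega> ^^ m) X) Y),
     bmap = (\<lambda>c a \<delta>. the_elem ((\<lambda>k. bmap (EE C) k a \<delta>) `
       syzygy_map_pow C \<Omega> \<omega> m (src C c) (tgt C c) (proj_class C (src C c) (tgt C c) c)))\<rparr>"

definition cosyzygy_ext ::
    "('r, 'o, 'a, 'e, 'z) ext_cat_scheme \<Rightarrow> ('o \<Rightarrow> 'o) \<Rightarrow> ('o \<Rightarrow> 'e) \<Rightarrow> nat \<Rightarrow>
     ('r, 'o, 'a, 'e) bifunctor"
  where "cosyzygy_ext C \<Sigma> \<sigma> m =
    \<lparr>bval = (\<lambda>X Y. Ext C X ((\<Sigma> ^^ m) Y)),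
     bmap = (\<lambda>c a \<delta>. the_elem ((\<lambda>k. bmap (EE C) c k \<delta>) `
       cosyzygy_map_pow C \<Sigma> \<sigma> m (src C a) (tgt C a) (inj_class C (src C a) (tgt C a) a)))\<rparr>"

end

theory Submission
  imports Defs
begin

text \<open>
  The chosen triangles \<open>\<Omega>X \<rightarrow> P X \<rightarrow> X\<close>, with extensions \<open>\<omega> X\<close>, describe all extensions of \<open>X\<close>: every
  \<open>\<delta> \<in> \<E>(X, M)\<close> has the form \<open>a\<^sub>* (\<omega> X)\<close> with \<open>a : \<Omega>X \<rightarrow> M\<close>, and if \<open>a\<^sub>* (\<omega> X) = 0\<close> then \<open>a\<close> factors through
  \<open>\<Omega>X \<rightarrow> P X\<close> (\<open>classifying_map_exists\<close>, \<open>classifying_zero_factors\<close>). The proof of both isomorphisms uses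
  only this, the dual description by \<open>Y \<rightarrow> I Y \<rightarrow> \<Sigma>Y\<close> with extensions \<open>\<sigma> Y\<close>, and the vanishing of \<open>\<E>\<close> on
  projectives and injectives.

  For the coends, let \<open>F\<close> be a bilinear bifunctor with \<open>F(P X, -) = 0\<close>. Then the coend over \<open>M\<close> of
  \<open>F(M, Y) \<otimes> \<E>(X, M)\<close> is \<open>F(\<Omega>X, Y)\<close>: the maps \<open>\<xi> \<otimes> a\<^sub>* (\<omega> X) \<mapsto> F(a, Y) \<xi>\<close> and \<open>\<xi> \<mapsto> \<xi> \<otimes> \<omega> X\<close> are inverse to each
  other (\<open>coend_eval\<close>). The first is well defined since two choices of \<open>a\<close> differ by a map through
  \<open>P X\<close>, on which \<open>F\<close> vanishes. The bifunctor \<open>\<E>\<^sup>n\<close> vanishes on projectives in its first variable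
  (\<open>higher_ext_Suc_projective\<close>), so \<open>\<E>\<^sup>n\<^sup>+\<^sup>1(X, Y) \<cong> \<E>\<^sup>n(\<Omega>X, Y)\<close>, and \<open>\<E>\<^sup>n\<^sup>+\<^sup>1(X, Y) \<cong> \<E>(\<Omega>\<^sup>n X, Y)\<close> by induction
  (\<open>higher_ext_Suc_iso\<close>).

  To compare the two resolutions, send \<open>a : \<Omega>X \<rightarrow> \<Sigma>Y\<close> to \<open>a\<^sup>* (\<sigma> Y) \<in> \<E>(\<Omega>X, Y)\<close> and to
  \<open>a\<^sub>* (\<omega> X) \<in> \<E>(X, \<Sigma>Y)\<close>. Both maps are surjective and they have the same kernel, so
  \<open>\<E>(\<Omega>X, Y) \<cong> \<E>(X, \<Sigma>Y)\<close> (\<open>dimension_shift\<close>); iteration gives \<open>\<E>(\<Omega>\<^sup>n X, Y) \<cong> \<E>(X, \<Sigma>\<^sup>n Y)\<close>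
  (\<open>syzygy_cosyzygy_iso\<close>).

  Naturality of all these maps comes down to one computation: if \<open>k : \<Omega>X' \<rightarrow> \<Omega>X\<close> lies over \<open>c : X' \<rightarrow> X\<close>,
  then \<open>c\<^sup>* a\<^sub>* (\<omega> X) = (a \<circledcirc> k)\<^sub>* (\<omega> X')\<close> (\<open>pull_of_classified\<close>). The morphisms \<open>k\<close> over a given \<open>c\<close> differ,
  but they act alike on \<open>\<E>\<close> (\<open>syzygy_map_pow_members\<close>).

  Of the coend as an explicit quotient of a sum of tensor products, the argument needs the universal
  property and the generation by the classes of \<open>\<xi> \<otimes> \<delta>\<close> (\<open>cotensor_lift\<close>, \<open>cotensor_generated\<close>); these
  are derived from the corresponding facts for quotients, free modules, tensor products and direct
  sums.
\<close>

section \<open>Linear maps and submodules\<close>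

lemma mod_homI:
  assumes "\<And>x. x \<in> carrier M \<Longrightarrow> h x \<in> carrier N"
    and "\<And>x y. x \<in> carrier M \<Longrightarrow> y \<in> carrier M \<Longrightarrow> h (x \<oplus>\<^bsub>M\<^esub> y) = h x \<oplus>\<^bsub>N\<^esub> h y"
    and "\<And>r x. r \<in> carrier R \<Longrightarrow> x \<in> carrier M \<Longrightarrow> h (r \<odot>\<^bsub>M\<^esub> x) = r \<odot>\<^bsub>N\<^esub> h x"
  shows "h \<in> mod_hom R M N"
  using assms by (auto simp: mod_hom_def)

lemma mod_hom_closed: "h \<in> mod_hom R M N \<Longrightarrow> x \<in> carrier M \<Longrightarrow> h x \<in> carrier N"
  by (auto simp: mod_hom_def)

lemma mod_hom_add:
  "h \<in> mod_hom R M N \<Longrightarrow> x \<in> carrier M \<Longrightarrow> y \<in> carrier M \<Longrightarrow> h (x \<oplus>\<^bsub>M\<^esub> y) = h x \<oplus>\<^bsub>N\<^esub> h y"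
  by (auto simp: mod_hom_def)

lemma mod_hom_smult:
  "h \<in> mod_hom R M N \<Longrightarrow> r \<in> carrier R \<Longrightarrow> x \<in> carrier M \<Longrightarrow> h (r \<odot>\<^bsub>M\<^esub> x) = r \<odot>\<^bsub>N\<^esub> h x"
  by (auto simp: mod_hom_def)

lemma module_zero: "module R M \<Longrightarrow> \<zero>\<^bsub>M\<^esub> \<in> carrier M"
  by (simp add: module_def abelian_group_def abelian_monoid.zero_closed)

lemma module_add:
  "module R M \<Longrightarrow> x \<in> carrier M \<Longrightarrow> y \<in> carrier M \<Longrightarrow> x \<oplus>\<^bsub>M\<^esub> y \<in> carrier M"
  by (simp add: module_def abelian_group_def abelian_monoid.a_closed)

lemma module_minus:
  "module R M \<Longrightarrow> x \<in> carrier M \<Longrightarrow> y \<in> carrier M \<Longrightarrow> x \<ominus>\<^bsub>M\<^esub> y \<in> carrier M"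
  by (simp add: module_def abelian_group.minus_closed)

lemma module_smult:
  "module R M \<Longrightarrow> r \<in> carrier R \<Longrightarrow> x \<in> carrier M \<Longrightarrow> r \<odot>\<^bsub>M\<^esub> x \<in> carrier M"
  by (simp add: module.smult_closed)

lemma module_minus_self: "module R M \<Longrightarrow> x \<in> carrier M \<Longrightarrow> x \<ominus>\<^bsub>M\<^esub> x = \<zero>\<^bsub>M\<^esub>"
  by (simp add: module_def abelian_group.r_neg a_minus_def)

lemma module_minus_zero:
  assumes "module R M" "x \<in> carrier M"
  shows "x \<ominus>\<^bsub>M\<^esub> \<zero>\<^bsub>M\<^esub> = x"
proof -
  interpret module R M by fact
  show ?thesis using assms(2) by (simp add: a_minus_def)
qed

lemma module_minus_eq_zero:
  assumes "module R M" "x \<in> carrier M" "y \<in> carrier M"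
  shows "x \<ominus>\<^bsub>M\<^esub> y = \<zero>\<^bsub>M\<^esub> \<longleftrightarrow> x = y"
proof -
  interpret module R M by fact
  show ?thesis
    using assms(2,3) by (metis M.add.inv_closed M.add.inv_solve_right' M.l_zero M.r_neg M.zero_closed a_minus_def)
qed

lemma mod_hom_zero:
  assumes "module R M" "module R N" "h \<in> mod_hom R M N"
  shows "h \<zero>\<^bsub>M\<^esub> = \<zero>\<^bsub>N\<^esub>"
proof -
  interpret M: module R M by fact
  interpret N: module R N by fact
  have c: "h \<zero>\<^bsub>M\<^esub> \<in> carrier N" by (rule mod_hom_closed[OF assms(3)]) simp
  have "h \<zero>\<^bsub>M\<^esub> \<oplus>\<^bsub>N\<^esub> h \<zero>\<^bsub>M\<^esub> = h \<zero>\<^bsub>M\<^esub>"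
    using mod_hom_add[OF assms(3), of "\<zero>\<^bsub>M\<^esub>" "\<zero>\<^bsub>M\<^esub>"] by simp
  then show ?thesis using c by simp
qed

lemma mod_hom_minus:
  assumes "module R M" "module R N" "h \<in> mod_hom R M N" "x \<in> carrier M" "y \<in> carrier M"
  shows "h (x \<ominus>\<^bsub>M\<^esub> y) = h x \<ominus>\<^bsub>N\<^esub> h y"
proof -
  interpret M: module R M by fact
  interpret N: module R N by fact
  have "h (x \<ominus>\<^bsub>M\<^esub> y) \<oplus>\<^bsub>N\<^esub> h y = h ((x \<ominus>\<^bsub>M\<^esub> y) \<oplus>\<^bsub>M\<^esub> y)"
    using assms(4,5) by (simp add: mod_hom_add[OF assms(3)])
  also have "(x \<ominus>\<^bsub>M\<^esub> y) \<oplus>\<^bsub>M\<^esub> y = x"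
    using assms(4,5) by (simp add: a_minus_def M.M.a_assoc M.M.l_neg)
  finally show ?thesis
    using assms(4,5) mod_hom_closed[OF assms(3)]
    by (metis M.M.minus_closed N.M.add.inv_solve_right a_minus_def)
qed

lemma mod_hom_comp: "h \<in> mod_hom R M N \<Longrightarrow> k \<in> mod_hom R N P \<Longrightarrow> (\<lambda>x. k (h x)) \<in> mod_hom R M P"
  by (auto simp: mod_hom_def Pi_iff)

lemma mod_hom_id: "(\<lambda>x. x) \<in> mod_hom R M M"
  by (simp add: mod_hom_def)

text \<open>Closure under negatives is closure under the scalar \<open>-1\<close>.\<close>

lemma submodule_of_linear_closed:
  assumes M: "module R M" and sub: "H \<subseteq> carrier M" and "\<zero>\<^bsub>M\<^esub> \<in> H"
    and "\<And>x y. x \<in> H \<Longrightarrow> y \<in> H \<Longrightarrow> x \<oplus>\<^bsub>M\<^esub> y \<in> H"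
    and smult: "\<And>r x. r \<in> carrier R \<Longrightarrow> x \<in> H \<Longrightarrow> r \<odot>\<^bsub>M\<^esub> x \<in> H"
  shows "submodule H R M"
proof -
  interpret module R M by (rule M)
  show ?thesis
  proof (rule submoduleI)
    fix x assume x: "x \<in> H"
    have "\<ominus>\<^bsub>M\<^esub> x = (\<ominus>\<^bsub>R\<^esub> \<one>\<^bsub>R\<^esub>) \<odot>\<^bsub>M\<^esub> x"
      using x sub by (simp add: smult_l_minus subsetD)
    then show "\<ominus>\<^bsub>M\<^esub> x \<in> H" using smult[OF _ x] by simp
  qed (use assms in auto)
qed

lemma submodule_vimage:
  assumes "module R M" "module R N" "h \<in> mod_hom R M N" "submodule H R N"
  shows "submodule {x \<in> carrier M. h x \<in> H} R M"
proof -
  note E = module.submoduleE[OF assms(2,4)]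
  have "\<zero>\<^bsub>N\<^esub> \<in> H" using subgroup.one_closed[OF submodule.axioms(1)[OF assms(4)]] by simp
  then show ?thesis
    using E(4,5) mod_hom_zero[OF assms(1-3)] assms(1,3)
    by (intro submodule_of_linear_closed)
      (auto simp: mod_hom_add mod_hom_smult module_zero module_add module_smult)
qed

lemma submodule_zero: "module R M \<Longrightarrow> submodule H R M \<Longrightarrow> \<zero>\<^bsub>M\<^esub> \<in> H"
  using subgroup.one_closed[OF submodule.axioms(1)] by fastforce

lemma submodule_singleton_zero:
  assumes "module R M" shows "submodule {\<zero>\<^bsub>M\<^esub>} R M"
proof -
  interpret module R M by fact
  show ?thesis by (rule submoduleI) auto
qed

lemma mod_span_submodule:
  assumes "module R M" "S \<subseteq> carrier M"
  shows "submodule (mod_span R M S) R M"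
proof -
  interpret module R M by fact
  note E = submoduleE
  show ?thesis
    unfolding mod_span_def
  proof (rule submoduleI)
    show "\<Inter> {H. submodule H R M \<and> S \<subseteq> H} \<subseteq> carrier M"
      using carrier_is_submodule assms(2) by blast
  qed (auto simp: submodule_zero[OF assms(1)] E)
qed

lemma mod_span_superset: "S \<subseteq> mod_span R M S"
  by (auto simp: mod_span_def)

lemma mod_span_least: "submodule H R M \<Longrightarrow> S \<subseteq> H \<Longrightarrow> mod_span R M S \<subseteq> H"
  by (auto simp: mod_span_def)

lemma submodule_equalizer:
  assumes "module R M" "module R N" "h \<in> mod_hom R M N" "k \<in> mod_hom R M N"
  shows "submodule {x \<in> carrier M. h x = k x} R M"
  using mod_hom_zero[OF assms(1-3)] mod_hom_zero[OF assms(1,2,4)] assms(1,3,4)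
  by (intro submodule_of_linear_closed)
    (auto simp: mod_hom_add mod_hom_smult module_zero module_add module_smult)

lemma mod_hom_eq_on_generators:
  assumes "module R M" "module R N" "h \<in> mod_hom R M N" "k \<in> mod_hom R M N"
    and gen: "carrier M \<subseteq> mod_span R M S"
    and eq: "\<And>s. s \<in> S \<Longrightarrow> s \<in> carrier M \<and> h s = k s" and x: "x \<in> carrier M"
  shows "h x = k x"
  using mod_span_least[OF submodule_equalizer[OF assms(1-4)], of S] gen eq x by blast

lemma generators_image:
  assumes "module R M" "module R N" "h \<in> mod_hom R M N"
    and surj: "carrier N \<subseteq> h ` carrier M"
    and gen: "S \<subseteq> carrier M" "carrier M \<subseteq> mod_span R M S"
  shows "carrier N \<subseteq> mod_span R N (h ` S)"
proof
  fix y assume y: "y \<in> carrier N"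
  have "S \<subseteq> {x \<in> carrier M. h x \<in> mod_span R N (h ` S)}"
    using gen(1) mod_span_superset[of "h ` S" R N] by auto
  moreover have "submodule (mod_span R N (h ` S)) R N"
    using gen(1) mod_hom_closed[OF assms(3)] by (intro mod_span_submodule[OF assms(2)]) auto
  ultimately have "carrier M \<subseteq> {x \<in> carrier M. h x \<in> mod_span R N (h ` S)}"
    using mod_span_least[OF submodule_vimage[OF assms(1-3)]] gen(2) by blast
  then show "y \<in> mod_span R N (h ` S)" using surj y by blast
qed

section \<open>Quotient modules\<close>

context
  fixes R :: "('r, 'k) ring_scheme" and M :: "('r, 'm) module" and H :: "'m set"
  assumes M: "module R M" and H: "submodule H R M"
begin

interpretation M: module R M by (rule M)

lemma quot_abelian_subgroup: "abelian_subgroup H M"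
  by (rule abelian_subgroupI2[OF M.a_comm_group submodule.axioms(1)[OF H]])

interpretation H: abelian_subgroup H M by (rule quot_abelian_subgroup)

lemma quot_carrier: "carrier (quot_module M H) = (\<lambda>x. H +>\<^bsub>M\<^esub> x) ` carrier M"
  by (auto simp: quot_module_def A_RCOSETS_def')

lemma coset_eq_iff:
  assumes "x \<in> carrier M" "y \<in> carrier M"
  shows "H +>\<^bsub>M\<^esub> x = H +>\<^bsub>M\<^esub> y \<longleftrightarrow> x \<ominus>\<^bsub>M\<^esub> y \<in> H"
proof
  assume "H +>\<^bsub>M\<^esub> x = H +>\<^bsub>M\<^esub> y"
  then have "x \<in> H +>\<^bsub>M\<^esub> y" using H.a_rcos_self[OF assms(1)] by simp
  then show "x \<ominus>\<^bsub>M\<^esub> y \<in> H" using H.a_rcos_module_imp[OF assms(2)] by (simp add: a_minus_def)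
next
  assume "x \<ominus>\<^bsub>M\<^esub> y \<in> H"
  then have "x \<in> H +>\<^bsub>M\<^esub> y" using H.a_rcos_module_rev[OF assms(2,1)] by (simp add: a_minus_def)
  then show "H +>\<^bsub>M\<^esub> x = H +>\<^bsub>M\<^esub> y" using H.a_repr_independence' assms(2) by blast
qed

lemma quot_zero: "\<zero>\<^bsub>quot_module M H\<^esub> = H +>\<^bsub>M\<^esub> \<zero>\<^bsub>M\<^esub>"
  by (simp add: quot_module_def H.a_subset)

lemma quot_add:
  "x \<in> carrier M \<Longrightarrow> y \<in> carrier M \<Longrightarrow>
    (H +>\<^bsub>M\<^esub> x) \<oplus>\<^bsub>quot_module M H\<^esub> (H +>\<^bsub>M\<^esub> y) = H +>\<^bsub>M\<^esub> (x \<oplus>\<^bsub>M\<^esub> y)"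
  by (simp add: quot_module_def H.a_rcos_sum)

text \<open>Scalar multiplication on a quotient and the maps between quotients are defined as unions over
  all representatives. This evaluates such a union at one representative.\<close>

lemma coset_UN_const:
  assumes x: "x \<in> carrier M" and eq: "\<And>y. y \<in> carrier M \<Longrightarrow> y \<ominus>\<^bsub>M\<^esub> x \<in> H \<Longrightarrow> f y = f x"
  shows "(\<Union>y\<in>H +>\<^bsub>M\<^esub> x. f y) = f x"
proof -
  have "f y = f x" if "y \<in> H +>\<^bsub>M\<^esub> x" for y
  proof -
    have y: "y \<in> carrier M" using that x H.a_elemrcos_carrier by blast
    show ?thesis
      using H.a_rcos_module[OF x y] that eq[OF y] by (simp add: a_minus_def)
  qed
  then show ?thesis using H.a_rcos_self[OF x] by blast
qed

lemma quot_smult: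
  assumes r: "r \<in> carrier R" and x: "x \<in> carrier M"
  shows "r \<odot>\<^bsub>quot_module M H\<^esub> (H +>\<^bsub>M\<^esub> x) = H +>\<^bsub>M\<^esub> (r \<odot>\<^bsub>M\<^esub> x)"
proof -
  have "H +>\<^bsub>M\<^esub> (r \<odot>\<^bsub>M\<^esub> y) = H +>\<^bsub>M\<^esub> (r \<odot>\<^bsub>M\<^esub> x)"
    if y: "y \<in> carrier M" "y \<ominus>\<^bsub>M\<^esub> x \<in> H" for y
  proof -
    have "(r \<odot>\<^bsub>M\<^esub> y) \<ominus>\<^bsub>M\<^esub> (r \<odot>\<^bsub>M\<^esub> x) = r \<odot>\<^bsub>M\<^esub> (y \<ominus>\<^bsub>M\<^esub> x)"
      using r x y(1) by (simp add: a_minus_def M.smult_r_distr M.smult_r_minus)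
    then show ?thesis
      using M.submoduleE(4)[OF H r y(2)] r x y(1) by (simp add: coset_eq_iff)
  qed
  then show ?thesis
    unfolding quot_module_def by (simp add: coset_UN_const[OF x])
qed

lemma quot_module_module: "module R (quot_module M H)"
proof (rule moduleI)
  show "cring R" using M by (simp add: module_def)
  show "abelian_group (quot_module M H)"
  proof (rule abelian_groupI)
    fix K assume "K \<in> carrier (quot_module M H)"
    then obtain x where x: "x \<in> carrier M" "K = H +>\<^bsub>M\<^esub> x" by (auto simp: quot_carrier)
    then have "(H +>\<^bsub>M\<^esub> (\<ominus>\<^bsub>M\<^esub> x)) \<oplus>\<^bsub>quot_module M H\<^esub> K = \<zero>\<^bsub>quot_module M H\<^esub>"
      by (simp add: quot_add quot_zero M.M.l_neg del: M.M.a_coset_add_zero)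
    then show "\<exists>L\<in>carrier (quot_module M H). L \<oplus>\<^bsub>quot_module M H\<^esub> K = \<zero>\<^bsub>quot_module M H\<^esub>"
      using x by (auto simp: quot_carrier)
  qed (auto simp: quot_carrier quot_add quot_zero M.M.a_ac simp del: M.M.a_coset_add_zero)
qed (auto simp: quot_carrier quot_smult quot_add M.smult_l_distr M.smult_r_distr M.smult_assoc1
    M.R.add.m_closed)

lemma quot_proj_hom: "(\<lambda>x. H +>\<^bsub>M\<^esub> x) \<in> mod_hom R M (quot_module M H)"
  by (rule mod_homI) (auto simp: quot_carrier quot_smult quot_add)

lemma quot_proj_zeroD:
  assumes "x \<in> carrier M" "H +>\<^bsub>M\<^esub> x = \<zero>\<^bsub>quot_module M H\<^esub>"
  shows "x \<in> H"
  using assms coset_eq_iff[OF assms(1) module_zero[OF M]] by (simp only: quot_zero module_minus_zero[OF M])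

lemma mod_hom_on_quotI:
  assumes "module R N" "h \<in> mod_hom R M N" "\<And>x. x \<in> carrier M \<Longrightarrow> k (H +>\<^bsub>M\<^esub> x) = h x"
  shows "k \<in> mod_hom R (quot_module M H) N"
  using assms by (intro mod_homI) (auto simp: quot_carrier quot_smult quot_add mod_hom_def)

lemma quot_lift:
  assumes N: "module R N" and h: "h \<in> mod_hom R M N" and kill: "\<And>x. x \<in> H \<Longrightarrow> h x = \<zero>\<^bsub>N\<^esub>"
  obtains k where "k \<in> mod_hom R (quot_module M H) N"
    and "\<And>x. x \<in> carrier M \<Longrightarrow> k (H +>\<^bsub>M\<^esub> x) = h x"
proof -
  define k where "k K = h (SOME x. x \<in> carrier M \<and> K = H +>\<^bsub>M\<^esub> x)" for K
  have k: "k (H +>\<^bsub>M\<^esub> x) = h x" if x: "x \<in> carrier M" for x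
  proof -
    let ?y = "SOME y. y \<in> carrier M \<and> H +>\<^bsub>M\<^esub> x = H +>\<^bsub>M\<^esub> y"
    have y: "?y \<in> carrier M \<and> H +>\<^bsub>M\<^esub> x = H +>\<^bsub>M\<^esub> ?y" by (rule someI[of _ x]) (simp add: x)
    then have "x \<ominus>\<^bsub>M\<^esub> ?y \<in> H" using x coset_eq_iff by blast
    then have "h x \<ominus>\<^bsub>N\<^esub> h ?y = \<zero>\<^bsub>N\<^esub>"
      using kill mod_hom_minus[OF M N h x, of ?y] y by simp
    then have "h x = h ?y"
      using module_minus_eq_zero[OF N mod_hom_closed[OF h x] mod_hom_closed[OF h, of ?y]] y by simp
    then show ?thesis by (simp add: k_def)
  qed
  then show thesis using that mod_hom_on_quotI[OF N h] by blast
qed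

end

lemma quot_map_coset:
  assumes M: "module R M" and H: "submodule H R M" and M': "module R M'" and H': "submodule H' R M'"
    and h: "h \<in> mod_hom R M M'" and sub: "\<And>x. x \<in> H \<Longrightarrow> h x \<in> H'" and x: "x \<in> carrier M"
  shows "quot_map M' H' h (H +>\<^bsub>M\<^esub> x) = H' +>\<^bsub>M'\<^esub> h x"
  unfolding quot_map_def
proof (rule coset_UN_const[OF M H x])
  fix y assume "y \<in> carrier M" "y \<ominus>\<^bsub>M\<^esub> x \<in> H"
  then show "H' +>\<^bsub>M'\<^esub> h y = H' +>\<^bsub>M'\<^esub> h x"
    using coset_eq_iff[OF M' H'] mod_hom_closed[OF h] mod_hom_minus[OF M M' h] sub x by metis
qed

lemma quot_map_hom:
  assumes M: "module R M" and H: "submodule H R M" and M': "module R M'" and H': "submodule H' R M'"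
    and h: "h \<in> mod_hom R M M'" and sub: "\<And>x. x \<in> H \<Longrightarrow> h x \<in> H'"
  shows "quot_map M' H' h \<in> mod_hom R (quot_module M H) (quot_module M' H')"
  using quot_module_module[OF M' H'] mod_hom_comp[OF h quot_proj_hom[OF M' H']]
  by (rule mod_hom_on_quotI[OF M H]) (rule quot_map_coset[OF assms])

lemma mod_span_hom_image:
  assumes "module R M" "module R N" "h \<in> mod_hom R M N" "submodule H R N"
    and S: "S \<subseteq> carrier M" and "\<And>s. s \<in> S \<Longrightarrow> h s \<in> H" and x: "x \<in> mod_span R M S"
  shows "h x \<in> H"
  using mod_span_least[OF submodule_vimage[OF assms(1-4)], of S] assms(5-7) by blast


section \<open>Free modules\<close>

context cring
begin

lemma free_carrier_closed: "p \<in> carrier (free_module R S) \<Longrightarrow> p s \<in> carrier R"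
  by (simp add: free_module_def)

lemma free_zero_outside: "p \<in> carrier (free_module R S) \<Longrightarrow> s \<notin> S \<Longrightarrow> p s = \<zero>"
  by (simp add: free_module_def)

lemma free_finite_support: "p \<in> carrier (free_module R S) \<Longrightarrow> finite {s. p s \<noteq> \<zero>}"
  by (simp add: free_module_def)

lemma free_support_subset: "p \<in> carrier (free_module R S) \<Longrightarrow> {s. p s \<noteq> \<zero>} \<subseteq> S"
  by (auto simp: free_module_def)

lemma free_add: "p \<oplus>\<^bsub>free_module R S\<^esub> q = (\<lambda>s. p s \<oplus> q s)"
  by (simp add: free_module_def)

lemma free_smult: "r \<odot>\<^bsub>free_module R S\<^esub> p = (\<lambda>s. r \<otimes> p s)"
  by (simp add: free_module_def)

lemma free_zero: "\<zero>\<^bsub>free_module R S\<^esub> = (\<lambda>_. \<zero>)"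
  by (simp add: free_module_def)

lemma free_module_module: "module R (free_module R S)"
proof (rule moduleI)
  show "cring R" by (rule cring_axioms)
  have closed: "f \<in> carrier (free_module R S)"
    if "\<And>s. f s \<in> carrier R" "{s. f s \<noteq> \<zero>} \<subseteq> A" "finite A" "A \<subseteq> S" for f A
    using that finite_subset[of "{s. f s \<noteq> \<zero>}" A] by (auto simp: free_module_def)
  note facts = free_carrier_closed free_finite_support free_support_subset
  show "abelian_group (free_module R S)"
  proof (rule abelian_groupI)
    fix p assume p: "p \<in> carrier (free_module R S)"
    show "\<zero>\<^bsub>free_module R S\<^esub> \<oplus>\<^bsub>free_module R S\<^esub> p = p"
      using facts(1)[OF p] by (simp add: free_add free_zero)
    have "(\<lambda>s. \<ominus> p s) \<oplus>\<^bsub>free_module R S\<^esub> p = \<zero>\<^bsub>free_module R S\<^esub>"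
      using facts(1)[OF p] by (simp add: free_add free_zero l_neg)
    moreover have "(\<lambda>s. \<ominus> p s) \<in> carrier (free_module R S)"
      using facts[OF p] by (intro closed[of _ "{s. p s \<noteq> \<zero>}"]) auto
    ultimately show "\<exists>q\<in>carrier (free_module R S). q \<oplus>\<^bsub>free_module R S\<^esub> p = \<zero>\<^bsub>free_module R S\<^esub>"
      by blast
    fix q assume q: "q \<in> carrier (free_module R S)"
    show "p \<oplus>\<^bsub>free_module R S\<^esub> q \<in> carrier (free_module R S)"
      unfolding free_add using facts[OF p] facts[OF q]
      by (intro closed[of _ "{s. p s \<noteq> \<zero>} \<union> {s. q s \<noteq> \<zero>}"]) auto
    show "p \<oplus>\<^bsub>free_module R S\<^esub> q = q \<oplus>\<^bsub>free_module R S\<^esub> p"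
      using facts(1)[OF p] facts(1)[OF q] by (simp add: free_add a_comm)
    fix r assume r: "r \<in> carrier (free_module R S)"
    show "p \<oplus>\<^bsub>free_module R S\<^esub> q \<oplus>\<^bsub>free_module R S\<^esub> r = p \<oplus>\<^bsub>free_module R S\<^esub> (q \<oplus>\<^bsub>free_module R S\<^esub> r)"
      using facts(1)[OF p] facts(1)[OF q] facts(1)[OF r] by (simp add: free_add a_assoc)
  next
    show "\<zero>\<^bsub>free_module R S\<^esub> \<in> carrier (free_module R S)"
      by (simp add: free_module_def)
  qed
  fix p assume p: "p \<in> carrier (free_module R S)"
  show "\<one> \<odot>\<^bsub>free_module R S\<^esub> p = p"
    using facts(1)[OF p] by (simp add: free_smult)
  fix r assume r: "r \<in> carrier R"
  show "r \<odot>\<^bsub>free_module R S\<^esub> p \<in> carrier (free_module R S)"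
    unfolding free_smult using facts[OF p] r
    by (intro closed[of _ "{s. p s \<noteq> \<zero>}"]) auto
  show "r \<odot>\<^bsub>free_module R S\<^esub> (p \<oplus>\<^bsub>free_module R S\<^esub> q) =
      r \<odot>\<^bsub>free_module R S\<^esub> p \<oplus>\<^bsub>free_module R S\<^esub> r \<odot>\<^bsub>free_module R S\<^esub> q"
    if q: "q \<in> carrier (free_module R S)" for q
    using facts(1)[OF p] facts(1)[OF q] r by (simp add: free_smult free_add r_distr)
  fix r' assume r': "r' \<in> carrier R"
  show "(r \<oplus> r') \<odot>\<^bsub>free_module R S\<^esub> p = r \<odot>\<^bsub>free_module R S\<^esub> p \<oplus>\<^bsub>free_module R S\<^esub> r' \<odot>\<^bsub>free_module R S\<^esub> p"
    using facts(1)[OF p] r r' by (simp add: free_smult free_add l_distr)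
  show "(r \<otimes> r') \<odot>\<^bsub>free_module R S\<^esub> p = r \<odot>\<^bsub>free_module R S\<^esub> (r' \<odot>\<^bsub>free_module R S\<^esub> p)"
    using facts(1)[OF p] r r' by (simp add: free_smult m_assoc)
qed

lemma free_gen_closed: "s \<in> S \<Longrightarrow> free_gen R s \<in> carrier (free_module R S)"
  by (auto simp: free_module_def free_gen_def)

text \<open>Induction on the support, splitting off one coordinate.\<close>

lemma free_generated: "carrier (free_module R S) \<subseteq> mod_span R (free_module R S) (free_gen R ` S)"
proof
  let ?F = "free_module R S"
  let ?H = "mod_span R ?F (free_gen R ` S)"
  interpret F: module R ?F by (rule free_module_module)
  have H: "submodule ?H R ?F"
    by (intro mod_span_submodule free_module_module) (auto intro: free_gen_closed)
  note E = F.submoduleE[OF H]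
  fix p assume "p \<in> carrier ?F"
  with free_finite_support[OF this] show "p \<in> ?H"
  proof (induction "{s. p s \<noteq> \<zero>}" arbitrary: p rule: finite_psubset_induct)
    case (psubset p)
    show ?case
    proof (cases "{s. p s \<noteq> \<zero>} = {}")
      case True
      then have "p = \<zero>\<^bsub>?F\<^esub>" by (auto simp: free_zero)
      then show ?thesis using submodule_zero[OF free_module_module H] by simp
    next
      case False
      then obtain s where s: "p s \<noteq> \<zero>" by auto
      then have sS: "s \<in> S" using psubset.prems free_support_subset by blast
      define q where "q = p(s := \<zero>)"
      have supp: "{t. q t \<noteq> \<zero>} = {t. p t \<noteq> \<zero>} - {s}" by (auto simp: q_def)
      have "finite {t. q t \<noteq> \<zero>}" using psubset.hyps(1) supp by simp
      then have "q \<in> carrier ?F"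
        using free_carrier_closed[OF psubset.prems] free_zero_outside[OF psubset.prems]
        by (simp add: free_module_def) (simp add: q_def)
      then have q: "q \<in> ?H" using psubset.hyps(2)[of q] s supp by auto
      have eq: "p = q \<oplus>\<^bsub>?F\<^esub> (p s \<odot>\<^bsub>?F\<^esub> free_gen R s)"
      proof
        fix t
        show "p t = (q \<oplus>\<^bsub>?F\<^esub> (p s \<odot>\<^bsub>?F\<^esub> free_gen R s)) t"
          using free_carrier_closed[OF psubset.prems, of t] free_carrier_closed[OF psubset.prems, of s]
          by (cases "t = s") (simp_all add: free_add free_smult free_gen_def q_def)
      qed
      have "free_gen R s \<in> ?H" by (intro subsetD[OF mod_span_superset] imageI sS)
      then show ?thesis
        by (subst eq) (rule E(5)[OF q E(4)[OF free_carrier_closed[OF psubset.prems]]])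
    qed
  qed
qed

text \<open>The sum over the support may be taken over any finite set containing the support. This makes
  additivity visible, because two elements can be summed over a common set.\<close>

lemma free_lift:
  assumes N: "module R N" and \<phi>: "\<And>s. s \<in> S \<Longrightarrow> \<phi> s \<in> carrier N"
  obtains k where "k \<in> mod_hom R (free_module R S) N" and "\<And>s. s \<in> S \<Longrightarrow> k (free_gen R s) = \<phi> s"
proof -
  define k where "k p = finsum N (\<lambda>s. p s \<odot>\<^bsub>N\<^esub> \<phi> s) {s. p s \<noteq> \<zero>}" for p
  interpret N: module R N by (rule N)
  have k: "k p = finsum N (\<lambda>s. p s \<odot>\<^bsub>N\<^esub> \<phi> s) A"
    if A: "{s. p s \<noteq> \<zero>} \<subseteq> A" "finite A" "A \<subseteq> S" and p: "\<And>s. p s \<in> carrier R" for p A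
    unfolding k_def
  proof (rule N.add.finprod_mono_neutral_cong_left[OF A(2) A(1)])
    show "p i \<odot>\<^bsub>N\<^esub> \<phi> i = \<zero>\<^bsub>N\<^esub>" if "i \<in> A - {s. p s \<noteq> \<zero>}" for i
      using that A(3) \<phi> by auto
  qed (use A(3) \<phi> p in auto)
  have hom: "k \<in> mod_hom R (free_module R S) N"
  proof (rule mod_homI)
    fix p assume p: "p \<in> carrier (free_module R S)"
    note [simp] = free_carrier_closed[OF p]
    show "k p \<in> carrier N"
      unfolding k_def using p \<phi> free_support_subset[OF p] by (intro N.finsum_closed) auto
    fix q assume q: "q \<in> carrier (free_module R S)"
    note [simp] = free_carrier_closed[OF q]
    let ?A = "{s. p s \<noteq> \<zero>} \<union> {s. q s \<noteq> \<zero>}"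
    have A: "finite ?A" "?A \<subseteq> S" "{s. p s \<noteq> \<zero>} \<subseteq> ?A" "{s. q s \<noteq> \<zero>} \<subseteq> ?A" "{s. p s \<oplus> q s \<noteq> \<zero>} \<subseteq> ?A"
      using free_finite_support[OF p] free_finite_support[OF q] free_support_subset[OF p] free_support_subset[OF q]
      by auto
    have "k (p \<oplus>\<^bsub>free_module R S\<^esub> q) = finsum N (\<lambda>s. (p s \<oplus> q s) \<odot>\<^bsub>N\<^esub> \<phi> s) ?A"
      unfolding free_add using p q by (intro k A) auto
    also have "\<dots> = finsum N (\<lambda>s. p s \<odot>\<^bsub>N\<^esub> \<phi> s \<oplus>\<^bsub>N\<^esub> q s \<odot>\<^bsub>N\<^esub> \<phi> s) ?A"
      using p q A(2) \<phi> by (intro N.finsum_cong') (auto simp: N.smult_l_distr)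
    also have "\<dots> = finsum N (\<lambda>s. p s \<odot>\<^bsub>N\<^esub> \<phi> s) ?A \<oplus>\<^bsub>N\<^esub> finsum N (\<lambda>s. q s \<odot>\<^bsub>N\<^esub> \<phi> s) ?A"
      using p q A(2) \<phi> by (intro N.finsum_addf) auto
    also have "\<dots> = k p \<oplus>\<^bsub>N\<^esub> k q"
      using p q A by (simp add: k[of _ ?A])
    finally show "k (p \<oplus>\<^bsub>free_module R S\<^esub> q) = k p \<oplus>\<^bsub>N\<^esub> k q" .
  next
    fix r p assume r: "r \<in> carrier R" and p: "p \<in> carrier (free_module R S)"
    note [simp] = free_carrier_closed[OF p]
    let ?A = "{s. p s \<noteq> \<zero>}"
    have A: "finite ?A" "?A \<subseteq> S" "{s. r \<otimes> p s \<noteq> \<zero>} \<subseteq> ?A"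
      using r free_finite_support[OF p] free_support_subset[OF p] by (auto simp: p)
    have "k (r \<odot>\<^bsub>free_module R S\<^esub> p) = finsum N (\<lambda>s. (r \<otimes> p s) \<odot>\<^bsub>N\<^esub> \<phi> s) ?A"
      unfolding free_smult using r p by (intro k A) auto
    also have "\<dots> = finsum N (\<lambda>s. r \<odot>\<^bsub>N\<^esub> (p s \<odot>\<^bsub>N\<^esub> \<phi> s)) ?A"
      using r p A(2) \<phi> by (intro N.finsum_cong') (auto simp: N.smult_assoc1)
    also have "\<dots> = r \<odot>\<^bsub>N\<^esub> finsum N (\<lambda>s. p s \<odot>\<^bsub>N\<^esub> \<phi> s) ?A"
      using r p A \<phi> by (intro N.finsum_smult_ldistr[symmetric]) auto
    finally show "k (r \<odot>\<^bsub>free_module R S\<^esub> p) = r \<odot>\<^bsub>N\<^esub> k p" by (simp add: k_def)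
  qed
  have "k (free_gen R s) = \<phi> s" if s: "s \<in> S" for s
  proof -
    have "k (free_gen R s) = finsum N (\<lambda>t. free_gen R s t \<odot>\<^bsub>N\<^esub> \<phi> t) {s}"
      using s by (intro k) (auto simp: free_gen_def)
    then show ?thesis using \<phi>[OF s] by (simp add: free_gen_def)
  qed
  then show thesis using that hom by blast
qed

lemma free_map_hom:
  assumes h: "\<And>s. s \<in> S \<Longrightarrow> h s \<in> T"
  shows "free_map R h \<in> mod_hom R (free_module R S) (free_module R T)"
    and "s \<in> S \<Longrightarrow> free_map R h (free_gen R s) = free_gen R (h s)"
proof -
  have k: "free_map R h p t = finsum R (\<lambda>s. if h s = t then p s else \<zero>) A"
    if A: "{s. p s \<noteq> \<zero>} \<subseteq> A" "finite A" and p: "\<And>s. p s \<in> carrier R" for p A t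
    unfolding free_map_def
    by (rule add.finprod_mono_neutral_cong_left[OF A(2)]) (use A(1) p in auto)
  show "free_map R h \<in> mod_hom R (free_module R S) (free_module R T)"
  proof (rule mod_homI)
    fix p assume p: "p \<in> carrier (free_module R S)"
    note [simp] = free_carrier_closed[OF p]
    have 1: "free_map R h p t \<in> carrier R" for t
      unfolding free_map_def using p by (intro finsum_closed) auto
    have supp: "\<exists>s. p s \<noteq> \<zero> \<and> h s = t" if "free_map R h p t \<noteq> \<zero>" for t
    proof (rule ccontr)
      assume "\<not> ?thesis"
      then have e: "{s. p s \<noteq> \<zero> \<and> h s = t} = {}" by auto
      show False using that unfolding free_map_def e by simp
    qed
    have "{t. free_map R h p t \<noteq> \<zero>} \<subseteq> h ` {s. p s \<noteq> \<zero>}" using supp by blast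
    then have 2: "finite {t. free_map R h p t \<noteq> \<zero>}"
      using free_finite_support[OF p] by (rule finite_surj[rotated])
    have 3: "free_map R h p t = \<zero>" if "t \<notin> T" for t
      using supp[of t] that h free_support_subset[OF p] by blast
    show "free_map R h p \<in> carrier (free_module R T)"
      using 1 2 3 by (simp add: free_module_def)
    fix q assume q: "q \<in> carrier (free_module R S)"
    note [simp] = free_carrier_closed[OF q]
    let ?A = "{s. p s \<noteq> \<zero>} \<union> {s. q s \<noteq> \<zero>}"
    have A: "finite ?A" "{s. p s \<noteq> \<zero>} \<subseteq> ?A" "{s. q s \<noteq> \<zero>} \<subseteq> ?A" "{s. p s \<oplus> q s \<noteq> \<zero>} \<subseteq> ?A"
      using free_finite_support[OF p] free_finite_support[OF q] by auto
    show "free_map R h (p \<oplus>\<^bsub>free_module R S\<^esub> q) =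
        free_map R h p \<oplus>\<^bsub>free_module R T\<^esub> free_map R h q"
    proof
      fix t
      have "free_map R h (p \<oplus>\<^bsub>free_module R S\<^esub> q) t =
          finsum R (\<lambda>s. if h s = t then p s \<oplus> q s else \<zero>) ?A"
        unfolding free_add using p q by (intro k A) auto
      also have "\<dots> = finsum R (\<lambda>s. (if h s = t then p s else \<zero>) \<oplus> (if h s = t then q s else \<zero>)) ?A"
        using p q by (intro finsum_cong') auto
      also have "\<dots> = finsum R (\<lambda>s. if h s = t then p s else \<zero>) ?A \<oplus>
          finsum R (\<lambda>s. if h s = t then q s else \<zero>) ?A"
        using p q by (intro finsum_addf) auto
      also have "\<dots> = free_map R h p t \<oplus> free_map R h q t"
        using p q A by (simp add: k[of _ ?A])
      finally show "free_map R h (p \<oplus>\<^bsub>free_module R S\<^esub> q) t =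
          (free_map R h p \<oplus>\<^bsub>free_module R T\<^esub> free_map R h q) t" by (simp add: free_add)
    qed
  next
    fix r p assume r: "r \<in> carrier R" and p: "p \<in> carrier (free_module R S)"
    note [simp] = free_carrier_closed[OF p]
    let ?A = "{s. p s \<noteq> \<zero>}"
    have A: "finite ?A" "{s. r \<otimes> p s \<noteq> \<zero>} \<subseteq> ?A"
      using r free_finite_support[OF p] by auto
    show "free_map R h (r \<odot>\<^bsub>free_module R S\<^esub> p) = r \<odot>\<^bsub>free_module R T\<^esub> free_map R h p"
    proof
      fix t
      have "free_map R h (r \<odot>\<^bsub>free_module R S\<^esub> p) t =
          finsum R (\<lambda>s. if h s = t then r \<otimes> p s else \<zero>) ?A"
        unfolding free_smult using r p by (intro k A) auto
      also have "\<dots> = finsum R (\<lambda>s. r \<otimes> (if h s = t then p s else \<zero>)) ?A"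
        using r p by (intro finsum_cong') auto
      also have "\<dots> = r \<otimes> finsum R (\<lambda>s. if h s = t then p s else \<zero>) ?A"
        using r p A by (intro finsum_rdistr[symmetric]) auto
      also have "finsum R (\<lambda>s. if h s = t then p s else \<zero>) ?A = free_map R h p t"
        using p A by (intro k[symmetric]) auto
      finally show "free_map R h (r \<odot>\<^bsub>free_module R S\<^esub> p) t =
          (r \<odot>\<^bsub>free_module R T\<^esub> free_map R h p) t" by (simp add: free_smult)
    qed
  qed
  show "free_map R h (free_gen R s) = free_gen R (h s)" if s: "s \<in> S"
  proof
    fix t
    have "free_map R h (free_gen R s) t = finsum R (\<lambda>u. if h u = t then free_gen R s u else \<zero>) {s}"
      by (intro k) (auto simp: free_gen_def)
    then show "free_map R h (free_gen R s) t = free_gen R (h s) t"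
      by (simp add: free_gen_def)
  qed
qed

end

section \<open>Tensor products\<close>

definition bilinear ::
    "('r, 'k) ring_scheme \<Rightarrow> ('r, 'm) module \<Rightarrow> ('r, 'n) module \<Rightarrow> ('r, 'p) module \<Rightarrow> ('m \<Rightarrow> 'n \<Rightarrow> 'p) \<Rightarrow> bool"
  where "bilinear R M N P \<beta> \<longleftrightarrow>
    (\<forall>y\<in>carrier N. (\<lambda>x. \<beta> x y) \<in> mod_hom R M P) \<and> (\<forall>x\<in>carrier M. \<beta> x \<in> mod_hom R N P)"

lemma bilinearD:
  assumes "bilinear R M N P \<beta>"
  shows "y \<in> carrier N \<Longrightarrow> (\<lambda>x. \<beta> x y) \<in> mod_hom R M P" and "x \<in> carrier M \<Longrightarrow> \<beta> x \<in> mod_hom R N P"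
  using assms by (auto simp: bilinear_def)

context
  fixes R :: "('r, 'k) ring_scheme" and M :: "('r, 'm) module" and N :: "('r, 'n) module"
  assumes M: "module R M" and N: "module R N"
begin

interpretation M: module R M by (rule M)
interpretation N: module R N by (rule N)

private abbreviation "F \<equiv> free_module R (carrier M \<times> carrier N)"
private abbreviation "g \<equiv> free_gen R"

private definition "rels =
     {g (x \<oplus>\<^bsub>M\<^esub> x', y) \<ominus>\<^bsub>F\<^esub> (g (x, y) \<oplus>\<^bsub>F\<^esub> g (x', y)) | x x' y.
         x \<in> carrier M \<and> x' \<in> carrier M \<and> y \<in> carrier N} \<union>
      {g (x, y \<oplus>\<^bsub>N\<^esub> y') \<ominus>\<^bsub>F\<^esub> (g (x, y) \<oplus>\<^bsub>F\<^esub> g (x, y')) | x y y'.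
         x \<in> carrier M \<and> y \<in> carrier N \<and> y' \<in> carrier N} \<union>
      {g (r \<odot>\<^bsub>M\<^esub> x, y) \<ominus>\<^bsub>F\<^esub> r \<odot>\<^bsub>F\<^esub> g (x, y) | r x y.
         r \<in> carrier R \<and> x \<in> carrier M \<and> y \<in> carrier N} \<union>
      {g (x, r \<odot>\<^bsub>N\<^esub> y) \<ominus>\<^bsub>F\<^esub> r \<odot>\<^bsub>F\<^esub> g (x, y) | r x y.
         r \<in> carrier R \<and> x \<in> carrier M \<and> y \<in> carrier N}"

private lemma relsI:
  "x \<in> carrier M \<Longrightarrow> x' \<in> carrier M \<Longrightarrow> y \<in> carrier N \<Longrightarrow>
    g (x \<oplus>\<^bsub>M\<^esub> x', y) \<ominus>\<^bsub>F\<^esub> (g (x, y) \<oplus>\<^bsub>F\<^esub> g (x', y)) \<in> rels"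
  "x \<in> carrier M \<Longrightarrow> y \<in> carrier N \<Longrightarrow> y' \<in> carrier N \<Longrightarrow>
    g (x, y \<oplus>\<^bsub>N\<^esub> y') \<ominus>\<^bsub>F\<^esub> (g (x, y) \<oplus>\<^bsub>F\<^esub> g (x, y')) \<in> rels"
  "r \<in> carrier R \<Longrightarrow> x \<in> carrier M \<Longrightarrow> y \<in> carrier N \<Longrightarrow>
    g (r \<odot>\<^bsub>M\<^esub> x, y) \<ominus>\<^bsub>F\<^esub> r \<odot>\<^bsub>F\<^esub> g (x, y) \<in> rels"
  "r \<in> carrier R \<Longrightarrow> x \<in> carrier M \<Longrightarrow> y \<in> carrier N \<Longrightarrow>
    g (x, r \<odot>\<^bsub>N\<^esub> y) \<ominus>\<^bsub>F\<^esub> r \<odot>\<^bsub>F\<^esub> g (x, y) \<in> rels"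
  unfolding rels_def by blast+

private lemma tensor_rel_eq: "tensor_rel R M N = mod_span R F rels"
  by (simp add: tensor_rel_def rels_def Let_def)

private lemma free_pair_module: "module R F"
  by (rule M.R.free_module_module)

private lemma g_closed: "x \<in> carrier M \<Longrightarrow> y \<in> carrier N \<Longrightarrow> g (x, y) \<in> carrier F"
  by (rule M.R.free_gen_closed) simp

private lemma rels_closed: "rels \<subseteq> carrier F"
  unfolding rels_def
  by (auto intro!: module_minus[OF free_pair_module] module_add[OF free_pair_module] module_smult[OF free_pair_module] g_closed)

lemma tensor_rel_submodule: "submodule (tensor_rel R M N) R (free_module R (carrier M \<times> carrier N))"
  unfolding tensor_rel_eq by (rule mod_span_submodule[OF free_pair_module rels_closed])

lemma tensor_module: "module R (tensor R M N)"
  unfolding tensor_def by (rule quot_module_module[OF free_pair_module tensor_rel_submodule])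

lemma pure_tensor_closed:
  "x \<in> carrier M \<Longrightarrow> y \<in> carrier N \<Longrightarrow> pure_tensor R M N x y \<in> carrier (tensor R M N)"
  unfolding tensor_def pure_tensor_def quot_carrier[OF free_pair_module tensor_rel_submodule] by (auto intro: g_closed)

private lemma rel_coset_eq:
  assumes "a \<ominus>\<^bsub>F\<^esub> b \<in> rels" "a \<in> carrier F" "b \<in> carrier F"
  shows "tensor_rel R M N +>\<^bsub>F\<^esub> a = tensor_rel R M N +>\<^bsub>F\<^esub> b"
proof -
  have "a \<ominus>\<^bsub>F\<^esub> b \<in> tensor_rel R M N"
    unfolding tensor_rel_eq by (rule subsetD[OF mod_span_superset assms(1)])
  then show ?thesis using coset_eq_iff[OF free_pair_module tensor_rel_submodule assms(2,3)] by simp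
qed

lemma pure_tensor_bilinear: "bilinear R M N (tensor R M N) (pure_tensor R M N)"
proof -
  note q = quot_add[OF free_pair_module tensor_rel_submodule] quot_smult[OF free_pair_module tensor_rel_submodule]
  note c = module_add[OF free_pair_module] module_smult[OF free_pair_module] g_closed
  show ?thesis
    unfolding bilinear_def
  proof (intro conjI ballI mod_homI pure_tensor_closed)
    fix x x' y assume a: "x \<in> carrier M" "x' \<in> carrier M" "y \<in> carrier N"
    show "pure_tensor R M N (x \<oplus>\<^bsub>M\<^esub> x') y = pure_tensor R M N x y \<oplus>\<^bsub>tensor R M N\<^esub> pure_tensor R M N x' y"
      unfolding tensor_def pure_tensor_def q(1)[OF g_closed[OF a(1,3)] g_closed[OF a(2,3)]]
      by (rule rel_coset_eq) (use a in \<open>simp_all add: relsI c\<close>)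
  next
    fix r x y assume a: "r \<in> carrier R" "x \<in> carrier M" "y \<in> carrier N"
    show "pure_tensor R M N (r \<odot>\<^bsub>M\<^esub> x) y = r \<odot>\<^bsub>tensor R M N\<^esub> pure_tensor R M N x y"
      unfolding tensor_def pure_tensor_def q(2)[OF a(1) g_closed[OF a(2,3)]]
      by (rule rel_coset_eq) (use a in \<open>simp_all add: relsI c\<close>)
    show "pure_tensor R M N x (r \<odot>\<^bsub>N\<^esub> y) = r \<odot>\<^bsub>tensor R M N\<^esub> pure_tensor R M N x y"
      unfolding tensor_def pure_tensor_def q(2)[OF a(1) g_closed[OF a(2,3)]]
      by (rule rel_coset_eq) (use a in \<open>simp_all add: relsI c\<close>)
  next
    fix x y y' assume a: "x \<in> carrier M" "y \<in> carrier N" "y' \<in> carrier N"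
    show "pure_tensor R M N x (y \<oplus>\<^bsub>N\<^esub> y') = pure_tensor R M N x y \<oplus>\<^bsub>tensor R M N\<^esub> pure_tensor R M N x y'"
      unfolding tensor_def pure_tensor_def q(1)[OF g_closed[OF a(1,2)] g_closed[OF a(1,3)]]
      by (rule rel_coset_eq) (use a in \<open>simp_all add: relsI c\<close>)
  qed auto
qed

lemma tensor_generated:
  "carrier (tensor R M N) \<subseteq>
    mod_span R (tensor R M N) {pure_tensor R M N x y | x y. x \<in> carrier M \<and> y \<in> carrier N}"
proof -
  have "carrier (tensor R M N) \<subseteq> mod_span R (tensor R M N)
      ((\<lambda>p. tensor_rel R M N +>\<^bsub>F\<^esub> p) ` g ` (carrier M \<times> carrier N))"
    unfolding tensor_def
    by (rule generators_image[OF free_pair_module quot_module_module[OF free_pair_module tensor_rel_submodule]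
          quot_proj_hom[OF free_pair_module tensor_rel_submodule]])
      (auto simp: quot_carrier[OF free_pair_module tensor_rel_submodule] g_closed M.R.free_generated)
  also have "(\<lambda>p. tensor_rel R M N +>\<^bsub>F\<^esub> p) ` g ` (carrier M \<times> carrier N) =
      {pure_tensor R M N x y | x y. x \<in> carrier M \<and> y \<in> carrier N}"
    by (auto simp: pure_tensor_def)
  finally show ?thesis .
qed

text \<open>What makes maps out of a tensor product well defined. As \<open>h\<close> is any linear map with bilinear
  values on the generators, the lemma also covers the map of free modules that underlies \<open>f \<otimes> h\<close>.\<close>

lemma tensor_rel_killed:
  assumes P: "module R P" and \<beta>: "bilinear R M N P \<beta>"
    and h: "h \<in> mod_hom R (free_module R (carrier M \<times> carrier N)) P"
    and hg: "\<And>x y. x \<in> carrier M \<Longrightarrow> y \<in> carrier N \<Longrightarrow> h (free_gen R (x, y)) = \<beta> x y"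
    and s: "s \<in> tensor_rel R M N"
  shows "h s = \<zero>\<^bsub>P\<^esub>"
proof -
  have closed: "\<beta> x y \<in> carrier P" if "x \<in> carrier M" "y \<in> carrier N" for x y
    using mod_hom_closed[OF bilinearD(1)[OF \<beta> that(2)] that(1)] .
  have "h s \<in> {\<zero>\<^bsub>P\<^esub>}" if "s \<in> rels" for s
    using that unfolding rels_def
    by (auto simp: mod_hom_minus[OF free_pair_module P h] mod_hom_add[OF h] mod_hom_smult[OF h] hg closed
        module_minus_self[OF P] module_add[OF P] module_smult[OF P]
        module_add[OF free_pair_module] module_smult[OF free_pair_module] g_closed
        mod_hom_add[OF bilinearD(1)[OF \<beta>]] mod_hom_add[OF bilinearD(2)[OF \<beta>]]
        mod_hom_smult[OF bilinearD(1)[OF \<beta>]] mod_hom_smult[OF bilinearD(2)[OF \<beta>]])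
  then show ?thesis
    using mod_span_hom_image[OF free_pair_module P h submodule_singleton_zero[OF P] rels_closed] s
    unfolding tensor_rel_eq by blast
qed

lemma tensor_lift:
  assumes P: "module R P" and \<beta>: "bilinear R M N P \<beta>"
  obtains k where "k \<in> mod_hom R (tensor R M N) P"
    and "\<And>x y. x \<in> carrier M \<Longrightarrow> y \<in> carrier N \<Longrightarrow> k (pure_tensor R M N x y) = \<beta> x y"
proof -
  have c: "case_prod \<beta> s \<in> carrier P" if "s \<in> carrier M \<times> carrier N" for s
    using that mod_hom_closed[OF bilinearD(1)[OF \<beta>]] by auto
  obtain h where h: "h \<in> mod_hom R F P"
    and hg': "\<And>s. s \<in> carrier M \<times> carrier N \<Longrightarrow> h (g s) = case_prod \<beta> s"
    by (rule M.R.free_lift[OF P, of "carrier M \<times> carrier N" "case_prod \<beta>"]) (use c that in blast)+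
  have hg: "h (g (x, y)) = \<beta> x y" if "x \<in> carrier M" "y \<in> carrier N" for x y
    using hg'[of "(x, y)"] that by simp
  obtain k where "k \<in> mod_hom R (tensor R M N) P"
      "\<And>p. p \<in> carrier F \<Longrightarrow> k (tensor_rel R M N +>\<^bsub>F\<^esub> p) = h p"
    using quot_lift[OF free_pair_module tensor_rel_submodule P h tensor_rel_killed[OF P \<beta> h hg]]
    unfolding tensor_def by metis
  then show thesis using that hg g_closed unfolding pure_tensor_def by simp
qed

end

text \<open>The map of free modules followed by the projection to \<open>M' \<otimes> N'\<close> is bilinear on generators and
  therefore kills the relations of \<open>M \<otimes> N\<close>; that is, relations go to relations.\<close>

lemma tensor_map_hom:
  assumes M: "module R M" and N: "module R N" and M': "module R M'" and N': "module R N'"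
    and f: "f \<in> mod_hom R M M'" and h: "h \<in> mod_hom R N N'"
  shows "tensor_map R M' N' f h \<in> mod_hom R (tensor R M N) (tensor R M' N')"
    and "x \<in> carrier M \<Longrightarrow> y \<in> carrier N \<Longrightarrow>
      tensor_map R M' N' f h (pure_tensor R M N x y) = pure_tensor R M' N' (f x) (h y)"
proof -
  interpret M: module R M by (rule M)
  let ?F = "free_module R (carrier M \<times> carrier N)" and ?F' = "free_module R (carrier M' \<times> carrier N')"
  let ?m = "free_map R (map_prod f h)"
  let ?q = "\<lambda>p. tensor_rel R M' N' +>\<^bsub>?F'\<^esub> ?m p"
  have mp: "map_prod f h s \<in> carrier M' \<times> carrier N'" if "s \<in> carrier M \<times> carrier N" for s
    using that f h by (auto simp: mod_hom_closed)
  have F: "module R ?F" and F': "module R ?F'" by (rule M.R.free_module_module)+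
  note m = M.R.free_map_hom[OF mp]
  note S = tensor_rel_submodule[OF M N] and S' = tensor_rel_submodule[OF M' N']
  have q: "?q \<in> mod_hom R ?F (tensor R M' N')"
    unfolding tensor_def by (rule mod_hom_comp[OF m(1) quot_proj_hom[OF F' S']])
  have bil: "bilinear R M N (tensor R M' N') (\<lambda>x y. pure_tensor R M' N' (f x) (h y))"
    unfolding bilinear_def
    by (intro conjI ballI mod_hom_comp[OF f] mod_hom_comp[OF h] bilinearD[OF pure_tensor_bilinear[OF M' N']]
        mod_hom_closed[OF f] mod_hom_closed[OF h])
  have qg: "?q (free_gen R (x, y)) = pure_tensor R M' N' (f x) (h y)"
    if "x \<in> carrier M" "y \<in> carrier N" for x y
    using m(2)[where s = "(x, y)"] that by (simp add: pure_tensor_def free_gen_def)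
  have sub: "?m s \<in> tensor_rel R M' N'" if s: "s \<in> tensor_rel R M N" for s
  proof -
    have c: "?m s \<in> carrier ?F'"
      by (rule mod_hom_closed[OF m(1) subsetD[OF module.submoduleE(1)[OF F S] s]])
    have "?q s = \<zero>\<^bsub>tensor R M' N'\<^esub>"
      by (rule tensor_rel_killed[OF M N tensor_module[OF M' N'] bil q qg s])
    then show ?thesis by (intro quot_proj_zeroD[OF F' S' c]) (simp add: tensor_def)
  qed
  show "tensor_map R M' N' f h \<in> mod_hom R (tensor R M N) (tensor R M' N')"
    unfolding tensor_map_def tensor_def by (rule quot_map_hom[OF F S F' S' m(1) sub])
  show "tensor_map R M' N' f h (pure_tensor R M N x y) = pure_tensor R M' N' (f x) (h y)"
    if "x \<in> carrier M" "y \<in> carrier N"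
    using quot_map_coset[OF F S F' S' m(1) sub, of "free_gen R (x, y)"] qg[OF that] that
    by (simp add: tensor_map_def pure_tensor_def M.R.free_gen_closed)
qed

section \<open>Direct sums\<close>

context
  fixes R :: "('r, 'k) ring_scheme" and I :: "'i set" and F :: "'i \<Rightarrow> ('r, 'm) module"
  assumes R: "cring R" and F: "\<And>i. i \<in> I \<Longrightarrow> module R (F i)"
begin

lemma direct_sum_carrierI:
  assumes "u \<in> extensional I" "\<And>i. i \<in> I \<Longrightarrow> u i \<in> carrier (F i)"
    and "{i \<in> I. u i \<noteq> \<zero>\<^bsub>F i\<^esub>} \<subseteq> A" "finite A"
  shows "u \<in> carrier (direct_sum I F)"
  using assms finite_subset[OF assms(3,4)] by (auto simp: direct_sum_def PiE_def)

lemma direct_sum_carrierD: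
  assumes "u \<in> carrier (direct_sum I F)"
  shows "u \<in> extensional I" "i \<in> I \<Longrightarrow> u i \<in> carrier (F i)" "finite {i \<in> I. u i \<noteq> \<zero>\<^bsub>F i\<^esub>}"
  using assms by (auto simp: direct_sum_def PiE_def)

lemma direct_sum_add: "u \<oplus>\<^bsub>direct_sum I F\<^esub> v = (\<lambda>i\<in>I. u i \<oplus>\<^bsub>F i\<^esub> v i)"
  by (simp add: direct_sum_def)

lemma direct_sum_smult: "r \<odot>\<^bsub>direct_sum I F\<^esub> u = (\<lambda>i\<in>I. r \<odot>\<^bsub>F i\<^esub> u i)"
  by (simp add: direct_sum_def)

lemma direct_sum_zero: "\<zero>\<^bsub>direct_sum I F\<^esub> = (\<lambda>i\<in>I. \<zero>\<^bsub>F i\<^esub>)"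
  by (simp add: direct_sum_def)

lemma direct_sum_zero_closed: "\<zero>\<^bsub>direct_sum I F\<^esub> \<in> carrier (direct_sum I F)"
  unfolding direct_sum_zero by (rule direct_sum_carrierI[where A = "{}"]) (auto simp: module_zero[OF F])

lemma direct_sum_add_closed:
  assumes u: "u \<in> carrier (direct_sum I F)" and v: "v \<in> carrier (direct_sum I F)"
  shows "u \<oplus>\<^bsub>direct_sum I F\<^esub> v \<in> carrier (direct_sum I F)"
  unfolding direct_sum_add
proof (rule direct_sum_carrierI)
  let ?A = "{i \<in> I. u i \<noteq> \<zero>\<^bsub>F i\<^esub>} \<union> {i \<in> I. v i \<noteq> \<zero>\<^bsub>F i\<^esub>}"
  show "finite ?A" using direct_sum_carrierD(3)[OF u] direct_sum_carrierD(3)[OF v] by simp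
  have "\<zero>\<^bsub>F i\<^esub> \<oplus>\<^bsub>F i\<^esub> \<zero>\<^bsub>F i\<^esub> = \<zero>\<^bsub>F i\<^esub>" if "i \<in> I" for i
  proof -
    interpret module R "F i" by (rule F[OF that])
    show ?thesis by simp
  qed
  then show "{i \<in> I. (\<lambda>i\<in>I. u i \<oplus>\<^bsub>F i\<^esub> v i) i \<noteq> \<zero>\<^bsub>F i\<^esub>} \<subseteq> ?A" by auto
qed (use direct_sum_carrierD(2)[OF u] direct_sum_carrierD(2)[OF v] in \<open>auto simp: module_add[OF F]\<close>)

lemma direct_sum_smult_closed:
  assumes r: "r \<in> carrier R" and u: "u \<in> carrier (direct_sum I F)"
  shows "r \<odot>\<^bsub>direct_sum I F\<^esub> u \<in> carrier (direct_sum I F)"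
  unfolding direct_sum_smult
proof (rule direct_sum_carrierI)
  show "finite {i \<in> I. u i \<noteq> \<zero>\<^bsub>F i\<^esub>}" by (rule direct_sum_carrierD(3)[OF u])
  show "{i \<in> I. (\<lambda>i\<in>I. r \<odot>\<^bsub>F i\<^esub> u i) i \<noteq> \<zero>\<^bsub>F i\<^esub>} \<subseteq> {i \<in> I. u i \<noteq> \<zero>\<^bsub>F i\<^esub>}"
    using r module.smult_r_null[OF F] by auto
qed (use r direct_sum_carrierD(2)[OF u] in \<open>auto simp: module_smult[OF F]\<close>)

lemma direct_sum_module: "module R (direct_sum I F)"
proof (rule moduleI)
  let ?D = "direct_sum I F"
  have ext: "u = v" if "u \<in> carrier ?D" "v \<in> carrier ?D" "\<And>i. i \<in> I \<Longrightarrow> u i = v i" for u v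
    using that direct_sum_carrierD(1) by (metis extensionalityI)
  note closed = direct_sum_add_closed direct_sum_smult_closed direct_sum_zero_closed
  note comp = direct_sum_carrierD(2)
  have ag: "abelian_group (F i)" if "i \<in> I" for i using F[OF that] by (simp add: module_def)
  note am = ag[unfolded abelian_group_def, THEN conjunct1]
  show "cring R" by (rule R)
  show "abelian_group ?D"
  proof (rule abelian_groupI)
    show "\<zero>\<^bsub>?D\<^esub> \<in> carrier ?D" by (rule closed)
    fix u assume u: "u \<in> carrier ?D"
    show "\<zero>\<^bsub>?D\<^esub> \<oplus>\<^bsub>?D\<^esub> u = u"
    proof (rule ext)
      show "(\<zero>\<^bsub>?D\<^esub> \<oplus>\<^bsub>?D\<^esub> u) i = u i" if "i \<in> I" for i
        using that comp[OF u that] by (simp add: direct_sum_zero direct_sum_add abelian_monoid.l_zero[OF am])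
    qed (intro closed u)+
    let ?v = "(\<ominus>\<^bsub>R\<^esub> \<one>\<^bsub>R\<^esub>) \<odot>\<^bsub>?D\<^esub> u"
    have r: "\<ominus>\<^bsub>R\<^esub> \<one>\<^bsub>R\<^esub> \<in> carrier R" using R by (simp add: cring_def ring.ring_simprules)
    have "?v \<oplus>\<^bsub>?D\<^esub> u = \<zero>\<^bsub>?D\<^esub>"
    proof (rule ext)
      fix i assume i: "i \<in> I"
      interpret module R "F i" by (rule F[OF i])
      show "(?v \<oplus>\<^bsub>?D\<^esub> u) i = \<zero>\<^bsub>?D\<^esub> i"
        using i comp[OF u i] by (simp add: direct_sum_add direct_sum_smult direct_sum_zero smult_l_minus M.l_neg)
    qed (intro closed r u)+
    then show "\<exists>v\<in>carrier ?D. v \<oplus>\<^bsub>?D\<^esub> u = \<zero>\<^bsub>?D\<^esub>" using closed(2)[OF r u] by blast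
    fix v assume v: "v \<in> carrier ?D"
    show "u \<oplus>\<^bsub>?D\<^esub> v \<in> carrier ?D" by (intro closed u v)
    show "u \<oplus>\<^bsub>?D\<^esub> v = v \<oplus>\<^bsub>?D\<^esub> u"
      using comp[OF u] comp[OF v] by (auto simp: direct_sum_add abelian_monoid.a_comm[OF am] intro!: restrict_ext)
    fix w assume w: "w \<in> carrier ?D"
    show "u \<oplus>\<^bsub>?D\<^esub> v \<oplus>\<^bsub>?D\<^esub> w = u \<oplus>\<^bsub>?D\<^esub> (v \<oplus>\<^bsub>?D\<^esub> w)"
      using comp[OF u] comp[OF v] comp[OF w]
      by (auto simp: direct_sum_add abelian_monoid.a_assoc[OF am] intro!: restrict_ext)
  qed
  fix u assume u: "u \<in> carrier ?D"
  have one: "\<one>\<^bsub>R\<^esub> \<in> carrier R" using R by (simp add: cring_def ring.ring_simprules)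
  show "\<one>\<^bsub>R\<^esub> \<odot>\<^bsub>?D\<^esub> u = u"
  proof (rule ext)
    show "(\<one>\<^bsub>R\<^esub> \<odot>\<^bsub>?D\<^esub> u) i = u i" if "i \<in> I" for i
      using that comp[OF u that] by (simp add: direct_sum_smult module.smult_one[OF F])
  qed (intro closed u one)+
  fix r assume r: "r \<in> carrier R"
  show "r \<odot>\<^bsub>?D\<^esub> u \<in> carrier ?D" by (intro closed r u)
  show "r \<odot>\<^bsub>?D\<^esub> (u \<oplus>\<^bsub>?D\<^esub> v) = r \<odot>\<^bsub>?D\<^esub> u \<oplus>\<^bsub>?D\<^esub> r \<odot>\<^bsub>?D\<^esub> v" if v: "v \<in> carrier ?D" for v
    using comp[OF u] comp[OF v] r
    by (auto simp: direct_sum_add direct_sum_smult module.smult_r_distr[OF F] intro!: restrict_ext)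
  fix s assume s: "s \<in> carrier R"
  show "(r \<oplus>\<^bsub>R\<^esub> s) \<odot>\<^bsub>?D\<^esub> u = r \<odot>\<^bsub>?D\<^esub> u \<oplus>\<^bsub>?D\<^esub> s \<odot>\<^bsub>?D\<^esub> u"
    using comp[OF u] r s
    by (auto simp: direct_sum_add direct_sum_smult module.smult_l_distr[OF F] intro!: restrict_ext)
  show "(r \<otimes>\<^bsub>R\<^esub> s) \<odot>\<^bsub>?D\<^esub> u = r \<odot>\<^bsub>?D\<^esub> (s \<odot>\<^bsub>?D\<^esub> u)"
    using comp[OF u] r s
    by (auto simp: direct_sum_smult module.smult_assoc1[OF F] intro!: restrict_ext)
qed

lemma sum_inj_hom:
  assumes i: "i \<in> I"
  shows "sum_inj I F i \<in> mod_hom R (F i) (direct_sum I F)"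
proof (rule mod_homI)
  fix x assume x: "x \<in> carrier (F i)"
  show "sum_inj I F i x \<in> carrier (direct_sum I F)"
    unfolding sum_inj_def
    by (rule direct_sum_carrierI[where A = "{i}"]) (use x i in \<open>auto simp: module_zero[OF F]\<close>)
  have z: "\<zero>\<^bsub>F j\<^esub> \<oplus>\<^bsub>F j\<^esub> \<zero>\<^bsub>F j\<^esub> = \<zero>\<^bsub>F j\<^esub>" if "j \<in> I" for j
  proof -
    interpret module R "F j" by (rule F[OF that])
    show ?thesis by simp
  qed
  show "sum_inj I F i (x \<oplus>\<^bsub>F i\<^esub> y) = sum_inj I F i x \<oplus>\<^bsub>direct_sum I F\<^esub> sum_inj I F i y" for y
    by (auto simp: direct_sum_add sum_inj_def z intro!: restrict_ext)
next
  fix r x assume "r \<in> carrier R"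
  then show "sum_inj I F i (r \<odot>\<^bsub>F i\<^esub> x) = r \<odot>\<^bsub>direct_sum I F\<^esub> sum_inj I F i x"
    by (auto simp: direct_sum_smult sum_inj_def module.smult_r_null[OF F] intro!: restrict_ext)
qed

text \<open>As for free modules, induction on the support.\<close>

lemma direct_sum_generated:
  "carrier (direct_sum I F) \<subseteq>
    mod_span R (direct_sum I F) {sum_inj I F i x | i x. i \<in> I \<and> x \<in> carrier (F i)}"
proof
  let ?D = "direct_sum I F" and ?G = "{sum_inj I F i x | i x. i \<in> I \<and> x \<in> carrier (F i)}"
  let ?H = "mod_span R ?D ?G"
  interpret D: module R ?D by (rule direct_sum_module)
  have H: "submodule ?H R ?D"
    by (intro mod_span_submodule direct_sum_module) (auto intro: mod_hom_closed[OF sum_inj_hom])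
  note E = D.submoduleE[OF H]
  fix u assume "u \<in> carrier ?D"
  with direct_sum_carrierD(3)[OF this] show "u \<in> ?H"
  proof (induction "{i \<in> I. u i \<noteq> \<zero>\<^bsub>F i\<^esub>}" arbitrary: u rule: finite_psubset_induct)
    case (psubset u)
    show ?case
    proof (cases "{i \<in> I. u i \<noteq> \<zero>\<^bsub>F i\<^esub>} = {}")
      case True
      then have "u = \<zero>\<^bsub>?D\<^esub>"
        using direct_sum_carrierD(1)[OF psubset.prems]
        by (intro extensionalityI[of _ I]) (auto simp: direct_sum_zero)
      then show ?thesis using submodule_zero[OF direct_sum_module H] by simp
    next
      case False
      then obtain i where i: "i \<in> I" "u i \<noteq> \<zero>\<^bsub>F i\<^esub>" by auto
      define v where "v = (\<lambda>j\<in>I. if j = i then \<zero>\<^bsub>F i\<^esub> else u j)"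
      have supp: "{j \<in> I. v j \<noteq> \<zero>\<^bsub>F j\<^esub>} = {j \<in> I. u j \<noteq> \<zero>\<^bsub>F j\<^esub>} - {i}" by (auto simp: v_def)
      have v: "v \<in> carrier ?D"
        by (rule direct_sum_carrierI[where A = "{j \<in> I. u j \<noteq> \<zero>\<^bsub>F j\<^esub>}"])
          (use psubset.hyps(1) supp i(1) module_zero[OF F] direct_sum_carrierD(2)[OF psubset.prems] in
            \<open>simp_all add: v_def Diff_subset\<close>)
      have vH: "v \<in> ?H" by (rule psubset.hyps(2)[OF _ v]) (use i supp in auto)
      have ui: "u i \<in> carrier (F i)" by (rule direct_sum_carrierD(2)[OF psubset.prems i(1)])
      have gH: "sum_inj I F i (u i) \<in> ?H"
        by (rule subsetD[OF mod_span_superset]) (use i(1) ui in blast)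
      have "u = v \<oplus>\<^bsub>?D\<^esub> sum_inj I F i (u i)"
      proof (rule extensionalityI[of _ I])
        fix j assume j: "j \<in> I"
        interpret module R "F j" by (rule F[OF j])
        show "u j = (v \<oplus>\<^bsub>?D\<^esub> sum_inj I F i (u i)) j"
          using j direct_sum_carrierD(2)[OF psubset.prems j] M.l_zero[of "u j"]
          by (cases "j = i") (auto simp: direct_sum_add v_def sum_inj_def)
      qed (use direct_sum_carrierD(1)[OF psubset.prems] in \<open>auto simp: direct_sum_add\<close>)
      then show ?thesis using E(5)[OF vH gH] by (simp only:)
    qed
  qed
qed

text \<open>Since the \<open>\<phi> i\<close> send zero to zero, the sum over the support may again be taken over any finite
  set containing it.\<close>

lemma direct_sum_lift:
  assumes N: "module R N" and \<phi>: "\<And>i. i \<in> I \<Longrightarrow> \<phi> i \<in> mod_hom R (F i) N"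
  obtains k where "k \<in> mod_hom R (direct_sum I F) N"
    and "\<And>i x. i \<in> I \<Longrightarrow> x \<in> carrier (F i) \<Longrightarrow> k (sum_inj I F i x) = \<phi> i x"
proof -
  define k where "k u = finsum N (\<lambda>i. \<phi> i (u i)) {i \<in> I. u i \<noteq> \<zero>\<^bsub>F i\<^esub>}" for u
  interpret N: module R N by (rule N)
  have k: "k u = finsum N (\<lambda>i. \<phi> i (u i)) A"
    if A: "{i \<in> I. u i \<noteq> \<zero>\<^bsub>F i\<^esub>} \<subseteq> A" "finite A" "A \<subseteq> I" and u: "\<And>i. i \<in> I \<Longrightarrow> u i \<in> carrier (F i)" for u A
    unfolding k_def
  proof (rule N.add.finprod_mono_neutral_cong_left[OF A(2) A(1)])
    show "\<phi> i (u i) = \<zero>\<^bsub>N\<^esub>" if "i \<in> A - {i \<in> I. u i \<noteq> \<zero>\<^bsub>F i\<^esub>}" for i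
      using that A(3) mod_hom_zero[OF F N \<phi>] by auto
  qed (use A(3) u mod_hom_closed[OF \<phi>] in auto)
  note closed = mod_hom_closed[OF \<phi>]
  have hom: "k \<in> mod_hom R (direct_sum I F) N"
  proof (rule mod_homI)
    fix u assume u: "u \<in> carrier (direct_sum I F)"
    note uc = direct_sum_carrierD(2)[OF u]
    show "k u \<in> carrier N"
      unfolding k_def by (intro N.finsum_closed) (auto intro: closed uc)
    fix v assume v: "v \<in> carrier (direct_sum I F)"
    note vc = direct_sum_carrierD(2)[OF v]
    note uvc = direct_sum_carrierD[OF direct_sum_add_closed[OF u v]]
    let ?A = "{i \<in> I. u i \<noteq> \<zero>\<^bsub>F i\<^esub>} \<union> {i \<in> I. v i \<noteq> \<zero>\<^bsub>F i\<^esub>} \<union> {i \<in> I. (u \<oplus>\<^bsub>direct_sum I F\<^esub> v) i \<noteq> \<zero>\<^bsub>F i\<^esub>}"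
    have A: "finite ?A" "?A \<subseteq> I"
      using direct_sum_carrierD(3)[OF u] direct_sum_carrierD(3)[OF v] uvc(3) by auto
    have "k (u \<oplus>\<^bsub>direct_sum I F\<^esub> v) = finsum N (\<lambda>i. \<phi> i ((u \<oplus>\<^bsub>direct_sum I F\<^esub> v) i)) ?A"
      by (intro k A uvc) auto
    also have "\<dots> = finsum N (\<lambda>i. \<phi> i (u i) \<oplus>\<^bsub>N\<^esub> \<phi> i (v i)) ?A"
      using A(2) by (intro N.finsum_cong') (auto simp: direct_sum_add mod_hom_add[OF \<phi>] uc vc closed)
    also have "\<dots> = finsum N (\<lambda>i. \<phi> i (u i)) ?A \<oplus>\<^bsub>N\<^esub> finsum N (\<lambda>i. \<phi> i (v i)) ?A"
      using A(2) by (intro N.finsum_addf) (auto intro: closed uc vc)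
    also have "finsum N (\<lambda>i. \<phi> i (u i)) ?A = k u"
      by (intro k[symmetric] A uc) auto
    also have "finsum N (\<lambda>i. \<phi> i (v i)) ?A = k v"
      by (intro k[symmetric] A vc) auto
    finally show "k (u \<oplus>\<^bsub>direct_sum I F\<^esub> v) = k u \<oplus>\<^bsub>N\<^esub> k v" .
  next
    fix r u assume r: "r \<in> carrier R" and u: "u \<in> carrier (direct_sum I F)"
    note uc = direct_sum_carrierD(2)[OF u]
    note ruc = direct_sum_carrierD[OF direct_sum_smult_closed[OF r u]]
    let ?A = "{i \<in> I. u i \<noteq> \<zero>\<^bsub>F i\<^esub>} \<union> {i \<in> I. (r \<odot>\<^bsub>direct_sum I F\<^esub> u) i \<noteq> \<zero>\<^bsub>F i\<^esub>}"
    have A: "finite ?A" "?A \<subseteq> I" using direct_sum_carrierD(3)[OF u] ruc(3) by auto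
    have "k (r \<odot>\<^bsub>direct_sum I F\<^esub> u) = finsum N (\<lambda>i. \<phi> i ((r \<odot>\<^bsub>direct_sum I F\<^esub> u) i)) ?A"
      by (intro k A ruc) auto
    also have "\<dots> = finsum N (\<lambda>i. r \<odot>\<^bsub>N\<^esub> \<phi> i (u i)) ?A"
      using A(2) r by (intro N.finsum_cong') (auto simp: direct_sum_smult mod_hom_smult[OF \<phi>] uc closed)
    also have "\<dots> = r \<odot>\<^bsub>N\<^esub> finsum N (\<lambda>i. \<phi> i (u i)) ?A"
      using A by (intro N.finsum_smult_ldistr[symmetric] r) (auto intro: closed uc)
    also have "finsum N (\<lambda>i. \<phi> i (u i)) ?A = k u"
      by (intro k[symmetric] A uc) auto
    finally show "k (r \<odot>\<^bsub>direct_sum I F\<^esub> u) = r \<odot>\<^bsub>N\<^esub> k u" .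
  qed
  have "k (sum_inj I F i x) = \<phi> i x" if i: "i \<in> I" and x: "x \<in> carrier (F i)" for i x
  proof -
    have "k (sum_inj I F i x) = finsum N (\<lambda>j. \<phi> j (sum_inj I F i x j)) {i}"
      using i x by (intro k) (auto simp: sum_inj_def module_zero[OF F])
    then show ?thesis using closed[OF i x] i by (simp add: sum_inj_def)
  qed
  then show thesis using that hom by blast
qed

end

lemma direct_sum_map_hom:
  assumes R: "cring R" and F: "\<And>i. i \<in> I \<Longrightarrow> module R (F i)" and G: "\<And>i. i \<in> I \<Longrightarrow> module R (G i)"
    and \<tau>: "\<And>i. i \<in> I \<Longrightarrow> \<tau> i \<in> mod_hom R (F i) (G i)"
  shows "(\<lambda>u. \<lambda>i\<in>I. \<tau> i (u i)) \<in> mod_hom R (direct_sum I F) (direct_sum I G)"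
    and "i \<in> I \<Longrightarrow> (\<lambda>j\<in>I. \<tau> j (sum_inj I F i x j)) = sum_inj I G i (\<tau> i x)"
proof -
  show "(\<lambda>u. \<lambda>i\<in>I. \<tau> i (u i)) \<in> mod_hom R (direct_sum I F) (direct_sum I G)"
  proof (rule mod_homI)
    fix u assume u: "u \<in> carrier (direct_sum I F)"
    note uc = direct_sum_carrierD[OF R F u]
    show "(\<lambda>i\<in>I. \<tau> i (u i)) \<in> carrier (direct_sum I G)"
      by (rule direct_sum_carrierI[OF R G, where A = "{i \<in> I. u i \<noteq> \<zero>\<^bsub>F i\<^esub>}"])
        (use uc mod_hom_closed[OF \<tau>] mod_hom_zero[OF F G \<tau>] in auto)
    fix v assume v: "v \<in> carrier (direct_sum I F)"
    show "(\<lambda>i\<in>I. \<tau> i ((u \<oplus>\<^bsub>direct_sum I F\<^esub> v) i)) =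
        (\<lambda>i\<in>I. \<tau> i (u i)) \<oplus>\<^bsub>direct_sum I G\<^esub> (\<lambda>i\<in>I. \<tau> i (v i))"
      using uc(2) direct_sum_carrierD(2)[OF R F v]
      by (auto simp: direct_sum_def mod_hom_add[OF \<tau>] intro!: restrict_ext)
  next
    fix r u assume r: "r \<in> carrier R" and u: "u \<in> carrier (direct_sum I F)"
    show "(\<lambda>i\<in>I. \<tau> i ((r \<odot>\<^bsub>direct_sum I F\<^esub> u) i)) = r \<odot>\<^bsub>direct_sum I G\<^esub> (\<lambda>i\<in>I. \<tau> i (u i))"
      using r direct_sum_carrierD(2)[OF R F u]
      by (auto simp: direct_sum_def mod_hom_smult[OF \<tau>] intro!: restrict_ext)
  qed
  show "(\<lambda>j\<in>I. \<tau> j (sum_inj I F i x j)) = sum_inj I G i (\<tau> i x)" if "i \<in> I"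
    using that mod_hom_zero[OF F G \<tau>] by (auto simp: sum_inj_def intro!: restrict_ext)
qed

section \<open>Coends\<close>

text \<open>The part of a bifunctor that enters its coend: its values and, for \<open>f : M \<rightarrow> N\<close>, the two maps
  from \<open>T(N, M)\<close> to the diagonal.\<close>

locale diagonal_bifunctor = linear_category R C
  for R :: "('r, 'k) ring_scheme" and C :: "('r, 'o, 'a, 'z) lin_cat_scheme" (structure) +
  fixes T :: "('r, 'o, 'a, 't) bifunctor"
  assumes T_module: "M \<in> Obj C \<Longrightarrow> N \<in> Obj C \<Longrightarrow> module R (bval T M N)"
    and T_left: "M \<in> Obj C \<Longrightarrow> N \<in> Obj C \<Longrightarrow> f \<in> arr C M N \<Longrightarrow>
      bmap T f (Id C M) \<in> mod_hom R (bval T N M) (bval T M M)"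
    and T_right: "M \<in> Obj C \<Longrightarrow> N \<in> Obj C \<Longrightarrow> f \<in> arr C M N \<Longrightarrow>
      bmap T (Id C N) f \<in> mod_hom R (bval T N M) (bval T N N)"
begin

abbreviation (input) "csum \<equiv> coend_sum C T"
abbreviation (input) "cinj \<equiv> sum_inj (Obj C) (\<lambda>M. bval T M M)"

lemma coend_sum_module: "module R (coend_sum C T)"
  unfolding coend_sum_def by (rule direct_sum_module[OF cring_axioms T_module])

lemma cinj_hom: "M \<in> Obj C \<Longrightarrow> cinj M \<in> mod_hom R (bval T M M) csum"
  unfolding coend_sum_def
  by (rule sum_inj_hom[where F = "\<lambda>M. bval T M M", OF cring_axioms T_module])

definition coend_relators :: "('o \<Rightarrow> 't) set"
  where "coend_relators = {cinj M (bmap T f (Id C M) t) \<ominus>\<^bsub>csum\<^esub> cinj N (bmap T (Id C N) f t) | M N f t.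
    M \<in> Obj C \<and> N \<in> Obj C \<and> f \<in> arr C M N \<and> t \<in> carrier (bval T N M)}"

lemma coend_rel_eq: "coend_rel R C T = mod_span R csum coend_relators"
  by (simp add: coend_rel_def coend_relators_def Let_def)

lemma coend_relators_closed: "coend_relators \<subseteq> carrier csum"
  unfolding coend_relators_def
  using mod_hom_closed[OF T_left] mod_hom_closed[OF T_right]
  by (auto intro!: module_minus[OF coend_sum_module] mod_hom_closed[OF cinj_hom])

lemma coend_rel_submodule: "submodule (coend_rel R C T) R csum"
  unfolding coend_rel_eq by (rule mod_span_submodule[OF coend_sum_module coend_relators_closed])

lemma coend_module: "module R (coend R C T)"
  unfolding coend_def by (rule quot_module_module[OF coend_sum_module coend_rel_submodule])

lemma coend_in_hom:
  assumes "M \<in> Obj C" shows "coend_in R C T M \<in> mod_hom R (bval T M M) (coend R C T)"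
  using mod_hom_comp[OF cinj_hom[OF assms] quot_proj_hom[OF coend_sum_module coend_rel_submodule]]
  unfolding coend_def coend_in_def[abs_def] .

lemma coend_in_dinatural:
  assumes "M \<in> Obj C" "N \<in> Obj C" "f \<in> arr C M N" "t \<in> carrier (bval T N M)"
  shows "coend_in R C T M (bmap T f (Id C M) t) = coend_in R C T N (bmap T (Id C N) f t)"
proof -
  have "cinj M (bmap T f (Id C M) t) \<ominus>\<^bsub>csum\<^esub> cinj N (bmap T (Id C N) f t) \<in> coend_relators"
    using assms unfolding coend_relators_def by blast
  then have "cinj M (bmap T f (Id C M) t) \<ominus>\<^bsub>csum\<^esub> cinj N (bmap T (Id C N) f t) \<in> coend_rel R C T"
    unfolding coend_rel_eq by (rule subsetD[OF mod_span_superset])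
  then show ?thesis
    unfolding coend_in_def
    by (rule iffD2[OF coset_eq_iff[OF coend_sum_module coend_rel_submodule
            mod_hom_closed[OF cinj_hom[OF assms(1)] mod_hom_closed[OF T_left[OF assms(1-3)] assms(4)]]
            mod_hom_closed[OF cinj_hom[OF assms(2)] mod_hom_closed[OF T_right[OF assms(1-3)] assms(4)]]]])
qed

lemma coend_generated:
  "carrier (coend R C T) \<subseteq>
    mod_span R (coend R C T) {coend_in R C T M t | M t. M \<in> Obj C \<and> t \<in> carrier (bval T M M)}"
proof -
  let ?G = "{cinj M t | M t. M \<in> Obj C \<and> t \<in> carrier (bval T M M)}"
  have "carrier (coend R C T) \<subseteq> mod_span R (coend R C T)
      ((\<lambda>u. coend_rel R C T +>\<^bsub>csum\<^esub> u) ` ?G)"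
    unfolding coend_def
  proof (rule generators_image[OF coend_sum_module quot_module_module[OF coend_sum_module coend_rel_submodule]
          quot_proj_hom[OF coend_sum_module coend_rel_submodule]])
    show "?G \<subseteq> carrier csum" by (auto intro: mod_hom_closed[OF cinj_hom])
    show "carrier csum \<subseteq> mod_span R csum ?G"
      unfolding coend_sum_def
      by (rule direct_sum_generated[where F = "\<lambda>M. bval T M M", OF cring_axioms T_module])
  qed (simp add: quot_carrier[OF coend_sum_module coend_rel_submodule])
  also have "(\<lambda>u. coend_rel R C T +>\<^bsub>csum\<^esub> u) ` ?G =
      {coend_in R C T M t | M t. M \<in> Obj C \<and> t \<in> carrier (bval T M M)}"
    unfolding coend_in_def by blast
  finally show ?thesis .
qed

text \<open>The condition on \<open>h\<close> is dinaturality. It is imposed on a map of the whole direct sum, so that the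
  lemma applies to a dinatural family and to a map between two coends alike.\<close>

lemma coend_rel_killed:
  assumes P: "module R P" and h: "h \<in> mod_hom R csum P"
    and din: "\<And>M N f t. M \<in> Obj C \<Longrightarrow> N \<in> Obj C \<Longrightarrow> f \<in> arr C M N \<Longrightarrow> t \<in> carrier (bval T N M) \<Longrightarrow>
      h (cinj M (bmap T f (Id C M) t)) = h (cinj N (bmap T (Id C N) f t))"
    and s: "s \<in> coend_rel R C T"
  shows "h s = \<zero>\<^bsub>P\<^esub>"
proof -
  have "h s \<in> {\<zero>\<^bsub>P\<^esub>}" if s: "s \<in> coend_relators" for s
  proof -
    obtain M N f t where *: "M \<in> Obj C" "N \<in> Obj C" "f \<in> arr C M N" "t \<in> carrier (bval T N M)"
      and s: "s = cinj M (bmap T f (Id C M) t) \<ominus>\<^bsub>csum\<^esub> cinj N (bmap T (Id C N) f t)"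
      using s unfolding coend_relators_def by blast
    have c: "cinj M (bmap T f (Id C M) t) \<in> carrier csum" "cinj N (bmap T (Id C N) f t) \<in> carrier csum"
      using * by (auto intro: mod_hom_closed[OF cinj_hom] mod_hom_closed[OF T_left] mod_hom_closed[OF T_right])
    show ?thesis
      unfolding s mod_hom_minus[OF coend_sum_module P h c] din[OF *]
      by (simp add: module_minus_self[OF P] mod_hom_closed[OF h] c)
  qed
  then show ?thesis
    using mod_span_hom_image[OF coend_sum_module P h submodule_singleton_zero[OF P] coend_relators_closed] s
    unfolding coend_rel_eq by blast
qed

lemma coend_lift:
  assumes P: "module R P" and \<phi>: "\<And>M. M \<in> Obj C \<Longrightarrow> \<phi> M \<in> mod_hom R (bval T M M) P"
    and din: "\<And>M N f t. M \<in> Obj C \<Longrightarrow> N \<in> Obj C \<Longrightarrow> f \<in> arr C M N \<Longrightarrow> t \<in> carrier (bval T N M) \<Longrightarrow>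
      \<phi> M (bmap T f (Id C M) t) = \<phi> N (bmap T (Id C N) f t)"
  obtains k where "k \<in> mod_hom R (coend R C T) P"
    and "\<And>M t. M \<in> Obj C \<Longrightarrow> t \<in> carrier (bval T M M) \<Longrightarrow> k (coend_in R C T M t) = \<phi> M t"
proof -
  obtain h where h: "h \<in> mod_hom R csum P"
    and hi: "\<And>M t. M \<in> Obj C \<Longrightarrow> t \<in> carrier (bval T M M) \<Longrightarrow> h (cinj M t) = \<phi> M t"
    unfolding coend_sum_def
    by (rule direct_sum_lift[of R "Obj C" "\<lambda>M. bval T M M" P \<phi>])
      (use cring_axioms T_module P \<phi> that in \<open>blast+\<close>)
  have kill: "h s = \<zero>\<^bsub>P\<^esub>" if s: "s \<in> coend_rel R C T" for s
    by (rule coend_rel_killed[OF P h _ s])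
      (simp add: hi din mod_hom_closed[OF T_left] mod_hom_closed[OF T_right])
  obtain k where k: "k \<in> mod_hom R (coend R C T) P"
      "\<And>u. u \<in> carrier csum \<Longrightarrow> k (coend_rel R C T +>\<^bsub>csum\<^esub> u) = h u"
    unfolding coend_def by (rule quot_lift[OF coend_sum_module coend_rel_submodule P h kill]) blast+
  have "k (coend_in R C T M t) = \<phi> M t" if "M \<in> Obj C" "t \<in> carrier (bval T M M)" for M t
    unfolding coend_in_def using k(2)[OF mod_hom_closed[OF cinj_hom[OF that(1)] that(2)]] hi[OF that] by simp
  then show thesis using that k(1) by blast
qed

end

text \<open>The relations of \<open>T\<close> are respected because the images of both sides agree in the coend
  of \<open>T'\<close>.\<close>

lemma coend_map_hom:
  assumes "diagonal_bifunctor R C T" and "diagonal_bifunctor R C T'"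
    and \<tau>: "\<And>M. M \<in> Obj C \<Longrightarrow> \<tau> M \<in> mod_hom R (bval T M M) (bval T' M M)"
    and din: "\<And>M N f t. M \<in> Obj C \<Longrightarrow> N \<in> Obj C \<Longrightarrow> f \<in> arr C M N \<Longrightarrow> t \<in> carrier (bval T N M) \<Longrightarrow>
      coend_in R C T' M (\<tau> M (bmap T f (Id C M) t)) = coend_in R C T' N (\<tau> N (bmap T (Id C N) f t))"
  shows "coend_map R C T' \<tau> \<in> mod_hom R (coend R C T) (coend R C T')"
    and "M \<in> Obj C \<Longrightarrow> t \<in> carrier (bval T M M) \<Longrightarrow>
      coend_map R C T' \<tau> (coend_in R C T M t) = coend_in R C T' M (\<tau> M t)"
proof -
  interpret T: diagonal_bifunctor R C T by fact
  interpret T': diagonal_bifunctor R C T' by fact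
  let ?m = "\<lambda>u. \<lambda>M\<in>Obj C. \<tau> M (u M)"
  let ?S = "coend_sum C T" and ?S' = "coend_sum C T'"
  let ?H = "coend_rel R C T" and ?H' = "coend_rel R C T'"
  note S = T.coend_sum_module and H = T.coend_rel_submodule
    and S' = T'.coend_sum_module and H' = T'.coend_rel_submodule
  have m: "?m \<in> mod_hom R ?S ?S'"
    unfolding coend_sum_def
    by (rule direct_sum_map_hom(1)[where F = "\<lambda>M. bval T M M" and G = "\<lambda>M. bval T' M M",
          OF T.cring_axioms T.T_module T'.T_module \<tau>])
  have mi: "?m (sum_inj (Obj C) (\<lambda>M. bval T M M) M t) = sum_inj (Obj C) (\<lambda>M. bval T' M M) M (\<tau> M t)"
    if "M \<in> Obj C" for M t
    by (rule direct_sum_map_hom(2)[where F = "\<lambda>M. bval T M M" and G = "\<lambda>M. bval T' M M",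
          OF T.cring_axioms T.T_module T'.T_module \<tau> that])
  let ?q = "\<lambda>u. ?H' +>\<^bsub>?S'\<^esub> ?m u"
  have q: "?q \<in> mod_hom R ?S (coend R C T')"
    unfolding coend_def by (rule mod_hom_comp[OF m quot_proj_hom[OF S' H']])
  have sub: "?m s \<in> ?H'" if s: "s \<in> ?H" for s
  proof -
    have c: "?m s \<in> carrier ?S'"
      by (rule mod_hom_closed[OF m subsetD[OF module.submoduleE(1)[OF S H] s]])
    have "?q s = \<zero>\<^bsub>coend R C T'\<^esub>"
      by (rule T.coend_rel_killed[OF T'.coend_module q _ s])
        (unfold mi, fold coend_in_def, rule din)
    then show ?thesis by (intro quot_proj_zeroD[OF S' H' c]) (simp add: coend_def)
  qed
  show "coend_map R C T' \<tau> \<in> mod_hom R (coend R C T) (coend R C T')"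
    unfolding coend_map_def coend_def by (rule quot_map_hom[OF S H S' H' m sub])
  show "coend_map R C T' \<tau> (coend_in R C T M t) = coend_in R C T' M (\<tau> M t)"
    if "M \<in> Obj C" "t \<in> carrier (bval T M M)"
    unfolding coend_map_def coend_in_def mi[OF that(1), symmetric]
    by (rule quot_map_coset[OF S H S' H' m sub mod_hom_closed[OF T.cinj_hom[OF that(1)] that(2)]])
qed


section \<open>Bilinear bifunctors\<close>

context bilinear_bifunctor
begin

lemma bmap_closed:
  assumes "X \<in> Obj C" "X' \<in> Obj C" "Y \<in> Obj C" "Y' \<in> Obj C" "c \<in> arr C X' X" "a \<in> arr C Y Y'"
    "\<delta> \<in> carrier (bval F X Y)"
  shows "bmap F c a \<delta> \<in> carrier (bval F X' Y')"
  using mod_hom_closed[OF bmap_hom[OF assms(1-6)] assms(7)] .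

lemma bmap_split_left:
  assumes "X \<in> Obj C" "X' \<in> Obj C" "Y \<in> Obj C" "Y' \<in> Obj C" "c \<in> arr C X' X" "a \<in> arr C Y Y'"
    "\<delta> \<in> carrier (bval F X Y)"
  shows "bmap F c a \<delta> = bmap F c (Id C Y') (bmap F (Id C X) a \<delta>)"
  using bmap_cmp[of X X X' Y Y' Y' "Id C X" c a "Id C Y'" \<delta>] assms
  by (simp add: Id_closed Id_left[of X' X] Id_left[of Y Y'])

lemma bmap_split_right:
  assumes "X \<in> Obj C" "X' \<in> Obj C" "Y \<in> Obj C" "Y' \<in> Obj C" "c \<in> arr C X' X" "a \<in> arr C Y Y'"
    "\<delta> \<in> carrier (bval F X Y)"
  shows "bmap F c a \<delta> = bmap F (Id C X') a (bmap F c (Id C Y) \<delta>)"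
  using bmap_cmp[of X X' X' Y Y Y' c "Id C X'" "Id C Y" a \<delta>] assms
  by (simp add: Id_closed Id_right[of X' X] Id_right[of Y Y'])

lemma bmap_cmp_left:
  assumes "X \<in> Obj C" "X' \<in> Obj C" "X'' \<in> Obj C" "Y \<in> Obj C" "c \<in> arr C X' X" "c' \<in> arr C X'' X'"
    "\<delta> \<in> carrier (bval F X Y)"
  shows "bmap F (c \<circledcirc> c') (Id C Y) \<delta> = bmap F c' (Id C Y) (bmap F c (Id C Y) \<delta>)"
  using bmap_cmp[of X X' X'' Y Y Y c c' "Id C Y" "Id C Y" \<delta>] assms
  by (simp add: Id_closed Id_left[of Y Y])

lemma bmap_cmp_right:
  assumes "X \<in> Obj C" "Y \<in> Obj C" "Y' \<in> Obj C" "Y'' \<in> Obj C" "a \<in> arr C Y Y'" "a' \<in> arr C Y' Y''"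
    "\<delta> \<in> carrier (bval F X Y)"
  shows "bmap F (Id C X) (a' \<circledcirc> a) \<delta> = bmap F (Id C X) a' (bmap F (Id C X) a \<delta>)"
  using bmap_cmp[of X X X Y Y' Y'' "Id C X" "Id C X" a a' \<delta>] assms
  by (simp add: Id_closed Id_left[of X X])

lemma bmap_zero:
  assumes "X \<in> Obj C" "X' \<in> Obj C" "Y \<in> Obj C" "Y' \<in> Obj C" "c \<in> arr C X' X" "a \<in> arr C Y Y'"
  shows "bmap F c a \<zero>\<^bsub>bval F X Y\<^esub> = \<zero>\<^bsub>bval F X' Y'\<^esub>"
  by (rule mod_hom_zero[OF bval_module[OF assms(1,3)] bval_module[OF assms(2,4)] bmap_hom[OF assms]])

end

section \<open>The coend composition of two bifunctors\<close>

locale bifunctor_pair = F: bilinear_bifunctor R C F + G: bilinear_bifunctor R C G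
  for R :: "('r, 'k) ring_scheme" and C :: "('r, 'o, 'a, 'z) lin_cat_scheme" (structure)
    and F :: "('r, 'o, 'a, 'f) bifunctor" and G :: "('r, 'o, 'a, 'g) bifunctor"
begin

abbreviation (input) "TB X Y \<equiv> tensor_bifunctor R C F G X Y"

text \<open>The class of \<open>\<xi> \<otimes> \<delta> \<in> F(M, Y) \<otimes> G(X, M)\<close> in the coend.\<close>

definition cotensor :: "'o \<Rightarrow> 'o \<Rightarrow> 'o \<Rightarrow> 'f \<Rightarrow> 'g \<Rightarrow> ('o \<Rightarrow> ('f \<times> 'g \<Rightarrow> 'r) set) set"
  where "cotensor X Y M \<xi> \<delta> = coend_in R C (TB X Y) M
    (pure_tensor R (bval F M Y) (bval G X M) \<xi> \<delta>)"

lemma tensor_bifunctor_bmap: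
  assumes obj: "X \<in> Obj C" "Y \<in> Obj C" "M \<in> Obj C" "M' \<in> Obj C" "N \<in> Obj C" "N' \<in> Obj C"
    and f: "f \<in> arr C M' M" and g: "g \<in> arr C N N'"
  shows "bmap (TB X Y) f g \<in>
      mod_hom R (bval (TB X Y) M N) (bval (TB X Y) M' N')"
    and "\<xi> \<in> carrier (bval F M Y) \<Longrightarrow> \<delta> \<in> carrier (bval G X N) \<Longrightarrow>
      bmap (TB X Y) f g (pure_tensor R (bval F M Y) (bval G X N) \<xi> \<delta>) =
      pure_tensor R (bval F M' Y) (bval G X N') (bmap F f (Id C Y) \<xi>) (bmap G (Id C X) g \<delta>)"
proof -
  have s: "src C f = M'" "tgt C g = N'" using F.src_tgt obj f g by blast+
  note h = F.bmap_hom[OF obj(3,4,2,2) f F.Id_closed[OF obj(2)]] G.bmap_hom[OF obj(1,1,5,6) F.Id_closed[OF obj(1)] g]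
  note m = F.bval_module[OF obj(3,2)] G.bval_module[OF obj(1,5)] F.bval_module[OF obj(4,2)] G.bval_module[OF obj(1,6)]
  show "bmap (TB X Y) f g \<in>
      mod_hom R (bval (TB X Y) M N) (bval (TB X Y) M' N')"
    unfolding tensor_bifunctor_def bifunctor.simps s by (rule tensor_map_hom(1)[OF m h])
  show "bmap (TB X Y) f g (pure_tensor R (bval F M Y) (bval G X N) \<xi> \<delta>) =
      pure_tensor R (bval F M' Y) (bval G X N') (bmap F f (Id C Y) \<xi>) (bmap G (Id C X) g \<delta>)"
    if "\<xi> \<in> carrier (bval F M Y)" "\<delta> \<in> carrier (bval G X N)"
    unfolding tensor_bifunctor_def bifunctor.simps s by (rule tensor_map_hom(2)[OF m h that])
qed

lemma bval_tensor: "bval (TB X Y) M N = tensor R (bval F M Y) (bval G X N)"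
  by (simp add: tensor_bifunctor_def)

context
  fixes X Y assumes X: "X \<in> Obj C" and Y: "Y \<in> Obj C"
begin

lemma tensor_diagonal: "diagonal_bifunctor R C (TB X Y)"
proof (intro diagonal_bifunctor.intro diagonal_bifunctor_axioms.intro)
  show "linear_category R C" by (rule F.linear_category_axioms)
next
  fix M N assume MN: "M \<in> Obj C" "N \<in> Obj C"
  show "module R (bval (TB X Y) M N)"
    unfolding bval_tensor by (rule tensor_module[OF F.bval_module[OF MN(1) Y] G.bval_module[OF X MN(2)]])
next
  fix M N f assume MN: "M \<in> Obj C" "N \<in> Obj C" and f: "f \<in> arr C M N"
  show "bmap (TB X Y) f (Id C M) \<in>
      mod_hom R (bval (TB X Y) N M) (bval (TB X Y) M M)"
    by (rule tensor_bifunctor_bmap(1)[OF X Y MN(2,1,1,1) f F.Id_closed[OF MN(1)]])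
  show "bmap (TB X Y) (Id C N) f \<in>
      mod_hom R (bval (TB X Y) N M) (bval (TB X Y) N N)"
    by (rule tensor_bifunctor_bmap(1)[OF X Y MN(2,2,1,2) F.Id_closed[OF MN(2)] f])
qed

interpretation T: diagonal_bifunctor R C "TB X Y"
  by (rule tensor_diagonal)

lemma coend_comp_module: "module R (bval (coend_comp R C F G) X Y)"
  unfolding coend_comp_def by (simp add: T.coend_module)

lemma bval_coend_comp: "bval (coend_comp R C F G) X Y = coend R C (TB X Y)"
  by (simp add: coend_comp_def)

lemma cotensor_bilinear:
  assumes M: "M \<in> Obj C"
  shows "bilinear R (bval F M Y) (bval G X M) (bval (coend_comp R C F G) X Y) (cotensor X Y M)"
  unfolding bilinear_def bval_coend_comp cotensor_def[abs_def]
  by (intro conjI ballI mod_hom_comp[OF _ T.coend_in_hom[OF M, unfolded bval_tensor]]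
      bilinearD[OF pure_tensor_bilinear[OF F.bval_module[OF M Y] G.bval_module[OF X M]]])

lemma cotensor_closed:
  assumes M: "M \<in> Obj C" and "\<xi> \<in> carrier (bval F M Y)" "\<delta> \<in> carrier (bval G X M)"
  shows "cotensor X Y M \<xi> \<delta> \<in> carrier (bval (coend_comp R C F G) X Y)"
  using mod_hom_closed[OF bilinearD(1)[OF cotensor_bilinear[OF M]]] assms(2,3) by blast

text \<open>Dinaturality at a pure tensor: a morphism can be moved across the tensor sign.\<close>

lemma cotensor_slide:
  assumes M: "M \<in> Obj C" and N: "N \<in> Obj C" and f: "f \<in> arr C M N"
    and \<xi>: "\<xi> \<in> carrier (bval F N Y)" and \<delta>: "\<delta> \<in> carrier (bval G X M)"
  shows "cotensor X Y M (bmap F f (Id C Y) \<xi>) \<delta> = cotensor X Y N \<xi> (bmap G (Id C X) f \<delta>)"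
proof -
  have p: "pure_tensor R (bval F N Y) (bval G X M) \<xi> \<delta> \<in> carrier (bval (TB X Y) N M)"
    unfolding bval_tensor
    by (rule pure_tensor_closed[OF F.bval_module[OF N Y] G.bval_module[OF X M] \<xi> \<delta>])
  show ?thesis
    using T.coend_in_dinatural[OF M N f p]
      tensor_bifunctor_bmap(2)[OF X Y N M M M f F.Id_closed[OF M] \<xi> \<delta>]
      tensor_bifunctor_bmap(2)[OF X Y N N M N F.Id_closed[OF N] f \<xi> \<delta>]
      F.bmap_Id[OF N Y \<xi>] G.bmap_Id[OF X M \<delta>]
    by (simp add: cotensor_def)
qed

text \<open>The tensor products are generated by pure tensors, and \<open>coend_in\<close> is linear.\<close>

lemma cotensor_generated:
  "carrier (bval (coend_comp R C F G) X Y) \<subseteq> mod_span R (bval (coend_comp R C F G) X Y)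
    {cotensor X Y M \<xi> \<delta> | M \<xi> \<delta>. M \<in> Obj C \<and> \<xi> \<in> carrier (bval F M Y) \<and> \<delta> \<in> carrier (bval G X M)}"
    (is "_ \<subseteq> mod_span R ?E ?G")
proof -
  have E: "module R ?E" by (rule coend_comp_module)
  have H: "submodule (mod_span R ?E ?G) R ?E"
    by (rule mod_span_submodule[OF E]) (auto intro: cotensor_closed)
  have "coend_in R C (TB X Y) M t \<in> mod_span R ?E ?G"
    if M: "M \<in> Obj C" and t: "t \<in> carrier (bval (TB X Y) M M)" for M t
  proof -
    let ?P = "{pure_tensor R (bval F M Y) (bval G X M) \<xi> \<delta> | \<xi> \<delta>.
        \<xi> \<in> carrier (bval F M Y) \<and> \<delta> \<in> carrier (bval G X M)}"
    note m = F.bval_module[OF M Y] G.bval_module[OF X M]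
    show ?thesis
    proof (rule mod_span_hom_image[OF T.T_module[OF M M] E _ H, where S = ?P])
      show "coend_in R C (TB X Y) M \<in>
          mod_hom R (bval (TB X Y) M M) ?E"
        unfolding bval_coend_comp by (rule T.coend_in_hom[OF M])
      show "?P \<subseteq> carrier (bval (TB X Y) M M)"
        unfolding bval_tensor by (auto intro: pure_tensor_closed[OF m])
      show "t \<in> mod_span R (bval (TB X Y) M M) ?P"
        using t tensor_generated[OF m] unfolding bval_tensor by blast
      fix s assume "s \<in> ?P"
      then have "coend_in R C (TB X Y) M s \<in> ?G"
        using M unfolding cotensor_def by blast
      then show "coend_in R C (TB X Y) M s \<in> mod_span R ?E ?G"
        by (rule subsetD[OF mod_span_superset])
    qed
  qed
  then have "{coend_in R C (TB X Y) M t | M t.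
      M \<in> Obj C \<and> t \<in> carrier (bval (TB X Y) M M)} \<subseteq> mod_span R ?E ?G"
    by blast
  from mod_span_least[OF H this] show ?thesis
    using T.coend_generated unfolding bval_coend_comp by blast
qed

text \<open>Together with \<open>cotensor_slide\<close> and \<open>cotensor_generated\<close>, this is all that is used of the
  construction of the coend. Both sides of the dinaturality condition are linear on
  \<open>F(N, Y) \<otimes> G(X, M)\<close>, so it suffices to impose it on pure tensors.\<close>

lemma cotensor_lift:
  assumes P: "module R P"
    and \<beta>: "\<And>M. M \<in> Obj C \<Longrightarrow> bilinear R (bval F M Y) (bval G X M) P (\<beta> M)"
    and slide: "\<And>M N f \<xi> \<delta>. M \<in> Obj C \<Longrightarrow> N \<in> Obj C \<Longrightarrow> f \<in> arr C M N \<Longrightarrow>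
      \<xi> \<in> carrier (bval F N Y) \<Longrightarrow> \<delta> \<in> carrier (bval G X M) \<Longrightarrow>
      \<beta> M (bmap F f (Id C Y) \<xi>) \<delta> = \<beta> N \<xi> (bmap G (Id C X) f \<delta>)"
  obtains k where "k \<in> mod_hom R (bval (coend_comp R C F G) X Y) P"
    and "\<And>M \<xi> \<delta>. M \<in> Obj C \<Longrightarrow> \<xi> \<in> carrier (bval F M Y) \<Longrightarrow> \<delta> \<in> carrier (bval G X M) \<Longrightarrow>
      k (cotensor X Y M \<xi> \<delta>) = \<beta> M \<xi> \<delta>"
proof -
  have "\<exists>\<phi>. \<phi> \<in> mod_hom R (tensor R (bval F M Y) (bval G X M)) P \<and>
      (\<forall>\<xi>\<in>carrier (bval F M Y). \<forall>\<delta>\<in>carrier (bval G X M).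
        \<phi> (pure_tensor R (bval F M Y) (bval G X M) \<xi> \<delta>) = \<beta> M \<xi> \<delta>)" if M: "M \<in> Obj C" for M
    by (rule tensor_lift[OF F.bval_module[OF M Y] G.bval_module[OF X M] P \<beta>[OF M]]) blast
  then obtain \<phi> where \<phi>: "\<And>M. M \<in> Obj C \<Longrightarrow> \<phi> M \<in> mod_hom R (tensor R (bval F M Y) (bval G X M)) P"
    and \<phi>p: "\<And>M \<xi> \<delta>. M \<in> Obj C \<Longrightarrow> \<xi> \<in> carrier (bval F M Y) \<Longrightarrow> \<delta> \<in> carrier (bval G X M) \<Longrightarrow>
        \<phi> M (pure_tensor R (bval F M Y) (bval G X M) \<xi> \<delta>) = \<beta> M \<xi> \<delta>"
    by metis
  have din: "\<phi> M (bmap (TB X Y) f (Id C M) t) =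
      \<phi> N (bmap (TB X Y) (Id C N) f t)"
    if M: "M \<in> Obj C" and N: "N \<in> Obj C" and f: "f \<in> arr C M N"
      and t: "t \<in> carrier (bval (TB X Y) N M)" for M N f t
  proof (rule mod_hom_eq_on_generators[OF T.T_module[OF N M] P _ _ _ _ t])
    show "(\<lambda>t. \<phi> M (bmap (TB X Y) f (Id C M) t)) \<in>
        mod_hom R (bval (TB X Y) N M) P"
      by (rule mod_hom_comp[OF T.T_left[OF M N f]]) (unfold bval_tensor, rule \<phi>[OF M])
    show "(\<lambda>t. \<phi> N (bmap (TB X Y) (Id C N) f t)) \<in>
        mod_hom R (bval (TB X Y) N M) P"
      by (rule mod_hom_comp[OF T.T_right[OF M N f]]) (unfold bval_tensor, rule \<phi>[OF N])
    note m = F.bval_module[OF N Y] G.bval_module[OF X M]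
    show "carrier (bval (TB X Y) N M) \<subseteq>
        mod_span R (bval (TB X Y) N M) {pure_tensor R (bval F N Y) (bval G X M) \<xi> \<delta> | \<xi> \<delta>.
          \<xi> \<in> carrier (bval F N Y) \<and> \<delta> \<in> carrier (bval G X M)}"
      unfolding bval_tensor by (rule tensor_generated[OF m])
    fix s assume "s \<in> {pure_tensor R (bval F N Y) (bval G X M) \<xi> \<delta> | \<xi> \<delta>.
          \<xi> \<in> carrier (bval F N Y) \<and> \<delta> \<in> carrier (bval G X M)}"
    then obtain \<xi> \<delta> where s: "s = pure_tensor R (bval F N Y) (bval G X M) \<xi> \<delta>"
      and \<xi>: "\<xi> \<in> carrier (bval F N Y)" and \<delta>: "\<delta> \<in> carrier (bval G X M)" by blast
    have "\<phi> M (bmap (TB X Y) f (Id C M) s) = \<beta> M (bmap F f (Id C Y) \<xi>) \<delta>"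
      unfolding s tensor_bifunctor_bmap(2)[OF X Y N M M M f F.Id_closed[OF M] \<xi> \<delta>] G.bmap_Id[OF X M \<delta>]
      by (rule \<phi>p[OF M F.bmap_closed[OF N M Y Y f F.Id_closed[OF Y] \<xi>] \<delta>])
    also have "\<dots> = \<beta> N \<xi> (bmap G (Id C X) f \<delta>)" by (rule slide[OF M N f \<xi> \<delta>])
    also have "\<dots> = \<phi> N (bmap (TB X Y) (Id C N) f s)"
      unfolding s tensor_bifunctor_bmap(2)[OF X Y N N M N F.Id_closed[OF N] f \<xi> \<delta>] F.bmap_Id[OF N Y \<xi>]
      by (rule \<phi>p[OF N \<xi> G.bmap_closed[OF X X M N F.Id_closed[OF X] f \<delta>], symmetric])
    finally show "s \<in> carrier (bval (TB X Y) N M) \<and>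
        \<phi> M (bmap (TB X Y) f (Id C M) s) =
        \<phi> N (bmap (TB X Y) (Id C N) f s)"
      unfolding s bval_tensor using pure_tensor_closed[OF m \<xi> \<delta>] by simp
  qed
  have \<phi>': "\<phi> M \<in> mod_hom R (bval (TB X Y) M M) P" if "M \<in> Obj C" for M
    unfolding bval_tensor by (rule \<phi>[OF that])
  obtain k where k: "k \<in> mod_hom R (coend R C (TB X Y)) P"
    and ki: "\<And>M t. M \<in> Obj C \<Longrightarrow> t \<in> carrier (bval (TB X Y) M M) \<Longrightarrow>
      k (coend_in R C (TB X Y) M t) = \<phi> M t"
    by (rule T.coend_lift[of P \<phi>]) (use P \<phi>' din that in blast)+
  have "k (cotensor X Y M \<xi> \<delta>) = \<beta> M \<xi> \<delta>"
    if "M \<in> Obj C" "\<xi> \<in> carrier (bval F M Y)" "\<delta> \<in> carrier (bval G X M)" for M \<xi> \<delta>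
    using ki[OF that(1)] \<phi>p[OF that] pure_tensor_closed[OF F.bval_module[OF that(1) Y] G.bval_module[OF X that(1)] that(2,3)]
    by (simp add: cotensor_def bval_tensor)
  then show thesis using that k unfolding bval_coend_comp by blast
qed

text \<open>Scalars are absorbed into the first factor, so a list without coefficients suffices.\<close>

lemma coend_sum_list_surj:
  assumes K: "K \<in> carrier (bval (coend_comp R C F G) X Y)"
  shows "\<exists>l. (\<forall>(M, \<xi>, \<delta>)\<in>set l. M \<in> Obj C \<and> \<xi> \<in> carrier (bval F M Y) \<and> \<delta> \<in> carrier (bval G X M)) \<and>
    coend_sum_list R C F G X Y l = K"
proof -
  let ?E = "bval (coend_comp R C F G) X Y"
  let ?v = "\<lambda>l. \<forall>(M, \<xi>, \<delta>)\<in>set l. M \<in> Obj C \<and> \<xi> \<in> carrier (bval F M Y) \<and> \<delta> \<in> carrier (bval G X M)"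
  let ?s = "coend_sum_list R C F G X Y"
  interpret E: module R ?E by (rule coend_comp_module)
  have nil: "?s [] = \<zero>\<^bsub>?E\<^esub>"
    by (simp add: coend_sum_list_def Let_def bval_coend_comp)
  have cons: "?s ((M, \<xi>, \<delta>) # l) = cotensor X Y M \<xi> \<delta> \<oplus>\<^bsub>?E\<^esub> ?s l" for M \<xi> \<delta> l
    by (simp add: coend_sum_list_def Let_def bval_coend_comp cotensor_def)
  have closed: "?s l \<in> carrier ?E" if "?v l" for l
    using that by (induction l) (auto simp: nil cons intro!: cotensor_closed)
  have app: "?s (l @ l') = ?s l \<oplus>\<^bsub>?E\<^esub> ?s l'" if "?v l" "?v l'" for l l'
    using that(1) that by (induction l) (auto simp: nil cons closed E.M.a_assoc cotensor_closed)
  have smult: "\<exists>l'. ?v l' \<and> ?s l' = r \<odot>\<^bsub>?E\<^esub> ?s l" if "?v l" and r: "r \<in> carrier R" for r l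
    using that(1)
  proof (induction l)
    case Nil
    then show ?case by (intro exI[of _ "[]"]) (simp add: nil r)
  next
    case (Cons t l)
    obtain M \<xi> \<delta> where t: "t = (M, \<xi>, \<delta>)" by (cases t)
    then have c: "M \<in> Obj C" "\<xi> \<in> carrier (bval F M Y)" "\<delta> \<in> carrier (bval G X M)" "?v l"
      using Cons.prems by auto
    obtain l' where l': "?v l'" "?s l' = r \<odot>\<^bsub>?E\<^esub> ?s l" using Cons.IH c(4) by blast
    have "cotensor X Y M (r \<odot>\<^bsub>bval F M Y\<^esub> \<xi>) \<delta> = r \<odot>\<^bsub>?E\<^esub> cotensor X Y M \<xi> \<delta>"
      by (rule mod_hom_smult[OF bilinearD(1)[OF cotensor_bilinear[OF c(1)] c(3)] r c(2)])
    then have "?s ((M, r \<odot>\<^bsub>bval F M Y\<^esub> \<xi>, \<delta>) # l') = r \<odot>\<^bsub>?E\<^esub> ?s (t # l)"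
      using c l' r by (simp add: t cons E.smult_r_distr cotensor_closed closed)
    moreover have "?v ((M, r \<odot>\<^bsub>bval F M Y\<^esub> \<xi>, \<delta>) # l')"
      using c l' module_smult[OF F.bval_module[OF c(1) Y] r c(2)] by simp
    ultimately show ?case by blast
  qed
  define H where "H = {?s l | l. ?v l}"
  have HI: "?v l \<Longrightarrow> ?s l \<in> H" for l by (auto simp: H_def)
  have "submodule H R ?E"
  proof (rule submodule_of_linear_closed[OF coend_comp_module])
    show "H \<subseteq> carrier ?E" using closed by (auto simp: H_def)
    show "\<zero>\<^bsub>?E\<^esub> \<in> H" using HI[of "[]"] by (simp add: nil)
    show "a \<oplus>\<^bsub>?E\<^esub> b \<in> H" if ab: "a \<in> H" "b \<in> H" for a b
    proof -
      obtain l l' where l: "?v l" "a = ?s l" "?v l'" "b = ?s l'" using ab unfolding H_def by blast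
      then have "?v (l @ l')" by auto
      from HI[OF this] show ?thesis using app[OF l(1,3)] l(2,4) by simp
    qed
    show "r \<odot>\<^bsub>?E\<^esub> a \<in> H" if r: "r \<in> carrier R" and a: "a \<in> H" for r a
    proof -
      obtain l where l: "?v l" "a = ?s l" using a unfolding H_def by blast
      obtain l' where "?v l'" "?s l' = r \<odot>\<^bsub>?E\<^esub> ?s l" using smult[OF l(1) r] by blast
      then show ?thesis using HI[of l'] l(2) by simp
    qed
  qed
  moreover have "cotensor X Y M \<xi> \<delta> \<in> H"
    if "M \<in> Obj C" "\<xi> \<in> carrier (bval F M Y)" "\<delta> \<in> carrier (bval G X M)" for M \<xi> \<delta>
    using HI[of "[(M, \<xi>, \<delta>)]"] that cotensor_closed[OF that] by (simp add: nil cons)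
  ultimately have "carrier ?E \<subseteq> H"
    by (intro subset_trans[OF cotensor_generated] mod_span_least) blast+
  then show ?thesis using K unfolding H_def by blast
qed

end

text \<open>Sliding \<open>f : M \<rightarrow> N\<close> across the tensor sign commutes with \<open>F(M, a) \<otimes> G(c, M)\<close>, because \<open>f\<close> and \<open>a\<close>
  act on different variables of \<open>F\<close>, and \<open>f\<close> and \<open>c\<close> on different variables of \<open>G\<close>.\<close>

lemma coend_comp_bmap:
  assumes X: "X \<in> Obj C" and X': "X' \<in> Obj C" and Y: "Y \<in> Obj C" and Y': "Y' \<in> Obj C"
    and c: "c \<in> arr C X' X" and a: "a \<in> arr C Y Y'"
  shows "bmap (coend_comp R C F G) c a \<in>
      mod_hom R (bval (coend_comp R C F G) X Y) (bval (coend_comp R C F G) X' Y')"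
    and "M \<in> Obj C \<Longrightarrow> \<xi> \<in> carrier (bval F M Y) \<Longrightarrow> \<delta> \<in> carrier (bval G X M) \<Longrightarrow>
      bmap (coend_comp R C F G) c a (cotensor X Y M \<xi> \<delta>) =
      cotensor X' Y' M (bmap F (Id C M) a \<xi>) (bmap G c (Id C M) \<delta>)"
proof -
  have s: "src C c = X'" "tgt C a = Y'" using F.src_tgt assms by blast+
  let ?T = "TB X Y" and ?T' = "TB X' Y'"
  let ?\<tau> = "\<lambda>M. tensor_map R (bval F M Y') (bval G X' M) (bmap F (Id C M) a) (bmap G c (Id C M))"
  interpret T: diagonal_bifunctor R C ?T by (rule tensor_diagonal[OF X Y])
  interpret T': diagonal_bifunctor R C ?T' by (rule tensor_diagonal[OF X' Y'])
  have \<tau>: "?\<tau> M \<in> mod_hom R (bval ?T M M) (bval ?T' M M)"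
    and \<tau>p: "\<And>\<xi> \<delta>. \<xi> \<in> carrier (bval F M Y) \<Longrightarrow> \<delta> \<in> carrier (bval G X M) \<Longrightarrow>
      ?\<tau> M (pure_tensor R (bval F M Y) (bval G X M) \<xi> \<delta>) =
      pure_tensor R (bval F M Y') (bval G X' M) (bmap F (Id C M) a \<xi>) (bmap G c (Id C M) \<delta>)"
    if M: "M \<in> Obj C" for M
    unfolding bval_tensor
    by (rule tensor_map_hom[OF F.bval_module[OF M Y] G.bval_module[OF X M] F.bval_module[OF M Y']
          G.bval_module[OF X' M] F.bmap_hom[OF M M Y Y' F.Id_closed[OF M] a]
          G.bmap_hom[OF X X' M M c F.Id_closed[OF M]]]; assumption)+
  have din: "coend_in R C ?T' M (?\<tau> M (bmap ?T f (Id C M) t)) = coend_in R C ?T' N (?\<tau> N (bmap ?T (Id C N) f t))"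
    if M: "M \<in> Obj C" and N: "N \<in> Obj C" and f: "f \<in> arr C M N" and t: "t \<in> carrier (bval ?T N M)" for M N f t
  proof (rule mod_hom_eq_on_generators[OF T.T_module[OF N M] T'.coend_module _ _ _ _ t])
    show "(\<lambda>t. coend_in R C ?T' M (?\<tau> M (bmap ?T f (Id C M) t))) \<in> mod_hom R (bval ?T N M) (coend R C ?T')"
      by (rule mod_hom_comp[OF mod_hom_comp[OF T.T_left[OF M N f] \<tau>[OF M]] T'.coend_in_hom[OF M]])
    show "(\<lambda>t. coend_in R C ?T' N (?\<tau> N (bmap ?T (Id C N) f t))) \<in> mod_hom R (bval ?T N M) (coend R C ?T')"
      by (rule mod_hom_comp[OF mod_hom_comp[OF T.T_right[OF M N f] \<tau>[OF N]] T'.coend_in_hom[OF N]])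
    note m = F.bval_module[OF N Y] G.bval_module[OF X M]
    show "carrier (bval ?T N M) \<subseteq> mod_span R (bval ?T N M)
        {pure_tensor R (bval F N Y) (bval G X M) \<xi> \<delta> | \<xi> \<delta>.
          \<xi> \<in> carrier (bval F N Y) \<and> \<delta> \<in> carrier (bval G X M)}"
      unfolding bval_tensor by (rule tensor_generated[OF m])
    fix s assume "s \<in> {pure_tensor R (bval F N Y) (bval G X M) \<xi> \<delta> | \<xi> \<delta>.
          \<xi> \<in> carrier (bval F N Y) \<and> \<delta> \<in> carrier (bval G X M)}"
    then obtain \<xi> \<delta> where s: "s = pure_tensor R (bval F N Y) (bval G X M) \<xi> \<delta>"
      and \<xi>: "\<xi> \<in> carrier (bval F N Y)" and \<delta>: "\<delta> \<in> carrier (bval G X M)" by blast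
    note I = F.Id_closed
    have \<xi>a: "bmap F (Id C N) a \<xi> \<in> carrier (bval F N Y')"
      by (rule F.bmap_closed[OF N N Y Y' I[OF N] a \<xi>])
    have \<delta>c: "bmap G c (Id C M) \<delta> \<in> carrier (bval G X' M)"
      by (rule G.bmap_closed[OF X X' M M c I[OF M] \<delta>])
    have 1: "bmap F (Id C M) a (bmap F f (Id C Y) \<xi>) = bmap F f (Id C Y') (bmap F (Id C N) a \<xi>)"
      using F.bmap_cmp[OF N M M Y Y Y' f I[OF M] I[OF Y] a \<xi>]
        F.bmap_cmp[OF N N M Y Y' Y' I[OF N] f a I[OF Y'] \<xi>]
        F.Id_left[OF M N f] F.Id_right[OF M N f] F.Id_left[OF Y Y' a] F.Id_right[OF Y Y' a] by simp
    have 2: "bmap G c (Id C N) (bmap G (Id C X) f \<delta>) = bmap G (Id C X') f (bmap G c (Id C M) \<delta>)"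
      using G.bmap_cmp[OF X X X' M N N I[OF X] c f I[OF N] \<delta>]
        G.bmap_cmp[OF X X' X' M M N c I[OF X'] I[OF M] f \<delta>]
        F.Id_left[OF M N f] F.Id_right[OF M N f] F.Id_left[OF X' X c] F.Id_right[OF X' X c] by simp
    have "coend_in R C ?T' M (?\<tau> M (bmap ?T f (Id C M) s)) =
        cotensor X' Y' M (bmap F f (Id C Y') (bmap F (Id C N) a \<xi>)) (bmap G c (Id C M) \<delta>)"
      unfolding s tensor_bifunctor_bmap(2)[OF X Y N M M M f I[OF M] \<xi> \<delta>] G.bmap_Id[OF X M \<delta>]
        \<tau>p[OF M F.bmap_closed[OF N M Y Y f I[OF Y] \<xi>] \<delta>] 1 cotensor_def ..
    also have "\<dots> = cotensor X' Y' N (bmap F (Id C N) a \<xi>) (bmap G (Id C X') f (bmap G c (Id C M) \<delta>))"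
      by (rule cotensor_slide[OF X' Y' M N f \<xi>a \<delta>c])
    also have "\<dots> = coend_in R C ?T' N (?\<tau> N (bmap ?T (Id C N) f s))"
      unfolding s tensor_bifunctor_bmap(2)[OF X Y N N M N I[OF N] f \<xi> \<delta>] F.bmap_Id[OF N Y \<xi>]
        \<tau>p[OF N \<xi> G.bmap_closed[OF X X M N I[OF X] f \<delta>]] 2 cotensor_def ..
    finally show "s \<in> carrier (bval ?T N M) \<and>
        coend_in R C ?T' M (?\<tau> M (bmap ?T f (Id C M) s)) = coend_in R C ?T' N (?\<tau> N (bmap ?T (Id C N) f s))"
      unfolding s bval_tensor using pure_tensor_closed[OF m \<xi> \<delta>] by simp
  qed
  show "bmap (coend_comp R C F G) c a \<in>
      mod_hom R (bval (coend_comp R C F G) X Y) (bval (coend_comp R C F G) X' Y')"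
    unfolding coend_comp_def bifunctor.simps s
    by (rule coend_map_hom(1)[OF tensor_diagonal[OF X Y] tensor_diagonal[OF X' Y'] \<tau> din])
  show "bmap (coend_comp R C F G) c a (cotensor X Y M \<xi> \<delta>) =
      cotensor X' Y' M (bmap F (Id C M) a \<xi>) (bmap G c (Id C M) \<delta>)"
    if M: "M \<in> Obj C" and \<xi>: "\<xi> \<in> carrier (bval F M Y)" and \<delta>: "\<delta> \<in> carrier (bval G X M)"
  proof -
    have "coend_map R C ?T' ?\<tau> (coend_in R C ?T M (pure_tensor R (bval F M Y) (bval G X M) \<xi> \<delta>)) =
        coend_in R C ?T' M (?\<tau> M (pure_tensor R (bval F M Y) (bval G X M) \<xi> \<delta>))"
      by (rule coend_map_hom(2)[OF tensor_diagonal[OF X Y] tensor_diagonal[OF X' Y'] \<tau> din M])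
        (simp_all add: bval_tensor pure_tensor_closed[OF F.bval_module[OF M Y] G.bval_module[OF X M] \<xi> \<delta>])
    then show ?thesis
      by (simp add: \<tau>p[OF M \<xi> \<delta>] coend_comp_def cotensor_def s)
  qed
qed

end

section \<open>Transport of structure and bifunctoriality of the coend\<close>

lemma mod_hom_pointwise_add:
  assumes "module R N" "h \<in> mod_hom R M N" "k \<in> mod_hom R M N"
  shows "(\<lambda>x. h x \<oplus>\<^bsub>N\<^esub> k x) \<in> mod_hom R M N"
proof -
  interpret N: module R N by fact
  show ?thesis
    by (rule mod_homI)
      (simp_all add: mod_hom_closed[OF assms(2)] mod_hom_closed[OF assms(3)] mod_hom_add[OF assms(2)]
        mod_hom_add[OF assms(3)] mod_hom_smult[OF assms(2)] mod_hom_smult[OF assms(3)] N.M.a_ac N.smult_r_distr)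
qed

lemma mod_hom_pointwise_smult:
  assumes "module R N" "h \<in> mod_hom R M N" "r \<in> carrier R"
  shows "(\<lambda>x. r \<odot>\<^bsub>N\<^esub> h x) \<in> mod_hom R M N"
proof -
  interpret N: module R N by fact
  show ?thesis
    by (rule mod_homI)
      (simp_all add: mod_hom_closed[OF assms(2)] mod_hom_add[OF assms(2)] mod_hom_smult[OF assms(2)]
        N.smult_r_distr assms(3) flip: N.smult_assoc1, simp add: N.R.m_comm assms(3))
qed

lemma mod_isoI:
  assumes "h \<in> mod_hom R M N" "k \<in> carrier N \<rightarrow> carrier M"
    and "\<And>x. x \<in> carrier M \<Longrightarrow> k (h x) = x" "\<And>y. y \<in> carrier N \<Longrightarrow> h (k y) = y"
  shows "h \<in> mod_iso R M N"
  unfolding mod_iso_def using assms mod_hom_closed[OF assms(1)]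
  by (auto intro!: bij_betwI[where g = k])

lemma mod_iso_hom: "h \<in> mod_iso R M N \<Longrightarrow> h \<in> mod_hom R M N"
  by (simp add: mod_iso_def)

lemma mod_iso_comp: "h \<in> mod_iso R M N \<Longrightarrow> k \<in> mod_iso R N P \<Longrightarrow> (\<lambda>x. k (h x)) \<in> mod_iso R M P"
  using mod_hom_comp[of h R M N k P] bij_betw_trans[of h "carrier M" "carrier N" k "carrier P"]
  by (simp add: mod_iso_def comp_def)

lemma mod_iso_inv:
  assumes M: "module R M" and h: "h \<in> mod_iso R M N"
  shows "inv_into (carrier M) h \<in> mod_iso R N M"
proof -
  let ?g = "inv_into (carrier M) h"
  have hom: "h \<in> mod_hom R M N" and bij: "bij_betw h (carrier M) (carrier N)"
    using h by (auto simp: mod_iso_def)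
  have g: "?g y \<in> carrier M" "h (?g y) = y" if "y \<in> carrier N" for y
    using that bij by (auto simp: bij_betw_def f_inv_into_f intro: inv_into_into)
  have gh: "?g (h x) = x" if "x \<in> carrier M" for x
    using that bij by (simp add: bij_betw_def)
  have "?g \<in> mod_hom R N M"
  proof (rule mod_homI)
    fix x y assume xy: "x \<in> carrier N" "y \<in> carrier N"
    show "?g (x \<oplus>\<^bsub>N\<^esub> y) = ?g x \<oplus>\<^bsub>M\<^esub> ?g y"
      using gh[of "?g x \<oplus>\<^bsub>M\<^esub> ?g y"] mod_hom_add[OF hom, of "?g x" "?g y"] xy g
      by (simp add: module_add[OF M])
  next
    fix r x assume rx: "r \<in> carrier R" "x \<in> carrier N"
    show "?g (r \<odot>\<^bsub>N\<^esub> x) = r \<odot>\<^bsub>M\<^esub> ?g x"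
      using gh[of "r \<odot>\<^bsub>M\<^esub> ?g x"] mod_hom_smult[OF hom, of r "?g x"] rx g
      by (simp add: module_smult[OF M])
  qed (rule g)
  then show ?thesis using bij_betw_inv_into[OF bij] by (simp add: mod_iso_def)
qed

text \<open>Both \<open>A\<close> and \<open>B\<close> are the quotient of \<open>H\<close> by the common kernel.\<close>

lemma iso_of_same_kernel:
  assumes H: "module R H" and A: "module R A" and B: "module R B"
    and \<alpha>: "\<alpha> \<in> mod_hom R H A" and \<beta>: "\<beta> \<in> mod_hom R H B"
    and surj\<alpha>: "carrier A \<subseteq> \<alpha> ` carrier H" and surj\<beta>: "carrier B \<subseteq> \<beta> ` carrier H"
    and ker: "\<And>x. x \<in> carrier H \<Longrightarrow> \<alpha> x = \<zero>\<^bsub>A\<^esub> \<longleftrightarrow> \<beta> x = \<zero>\<^bsub>B\<^esub>"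
  obtains \<phi> where "\<phi> \<in> mod_iso R A B" and "\<And>x. x \<in> carrier H \<Longrightarrow> \<phi> (\<alpha> x) = \<beta> x"
proof -
  have eq: "\<alpha> x = \<alpha> y \<longleftrightarrow> \<beta> x = \<beta> y" if xy: "x \<in> carrier H" "y \<in> carrier H" for x y
    using ker[OF module_minus[OF H xy]]
    by (simp add: mod_hom_minus[OF H A \<alpha> xy] mod_hom_minus[OF H B \<beta> xy] xy
        module_minus_eq_zero[OF A] module_minus_eq_zero[OF B] mod_hom_closed[OF \<alpha>] mod_hom_closed[OF \<beta>])
  define \<phi> where "\<phi> y = \<beta> (inv_into (carrier H) \<alpha> y)" for y
  have \<phi>: "\<phi> (\<alpha> x) = \<beta> x" if x: "x \<in> carrier H" for x
  proof -
    have i: "\<alpha> x \<in> \<alpha> ` carrier H" using x by simp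
    show ?thesis
      unfolding \<phi>_def using eq[OF inv_into_into[OF i] x] f_inv_into_f[OF i] by simp
  qed
  have hom: "\<phi> \<in> mod_hom R A B"
  proof (rule mod_homI)
    fix y assume "y \<in> carrier A"
    then obtain x where x: "x \<in> carrier H" "y = \<alpha> x" using surj\<alpha> by blast
    show "\<phi> y \<in> carrier B" using x by (simp add: \<phi> mod_hom_closed[OF \<beta>])
    show "\<phi> (r \<odot>\<^bsub>A\<^esub> y) = r \<odot>\<^bsub>B\<^esub> \<phi> y" if "r \<in> carrier R" for r
      using x that \<phi>[OF module_smult[OF H that x(1)]]
      by (simp add: \<phi> mod_hom_smult[OF \<alpha>] mod_hom_smult[OF \<beta>])
    fix y' assume "y' \<in> carrier A"
    then obtain x' where x': "x' \<in> carrier H" "y' = \<alpha> x'" using surj\<alpha> by blast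
    show "\<phi> (y \<oplus>\<^bsub>A\<^esub> y') = \<phi> y \<oplus>\<^bsub>B\<^esub> \<phi> y'"
      using x x' \<phi>[OF module_add[OF H x(1) x'(1)]] by (simp add: \<phi> mod_hom_add[OF \<alpha>] mod_hom_add[OF \<beta>])
  qed
  have "inj_on \<phi> (carrier A)"
  proof (rule inj_onI)
    fix y y' assume "y \<in> carrier A" "y' \<in> carrier A" and e: "\<phi> y = \<phi> y'"
    then obtain x x' where "x \<in> carrier H" "y = \<alpha> x" "x' \<in> carrier H" "y' = \<alpha> x'" using surj\<alpha> by blast
    then show "y = y'" using e eq by (simp add: \<phi>)
  qed
  moreover have "\<phi> ` carrier A = carrier B"
  proof
    show "\<phi> ` carrier A \<subseteq> carrier B" using mod_hom_closed[OF hom] by blast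
    show "carrier B \<subseteq> \<phi> ` carrier A"
    proof
      fix z assume "z \<in> carrier B"
      then obtain x where "x \<in> carrier H" "z = \<beta> x" using surj\<beta> by blast
      then show "z \<in> \<phi> ` carrier A" using \<phi> mod_hom_closed[OF \<alpha>] by (metis imageI)
    qed
  qed
  ultimately have "\<phi> \<in> mod_iso R A B" using hom by (simp add: mod_iso_def bij_betw_def)
  then show thesis using that \<phi> by blast
qed

lemma transport_module_iso:
  assumes M: "module R M" and inj: "inj_on h (carrier M)"
  shows "module R (transport_module h M)" and "h \<in> mod_iso R M (transport_module h M)"
proof -
  interpret module R M by (rule M)
  let ?T = "transport_module h M"
  have c: "carrier ?T = h ` carrier M" and z: "\<zero>\<^bsub>?T\<^esub> = h \<zero>\<^bsub>M\<^esub>"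
    by (simp_all add: transport_module_def Let_def)
  have add: "h x \<oplus>\<^bsub>?T\<^esub> h y = h (x \<oplus>\<^bsub>M\<^esub> y)" if "x \<in> carrier M" "y \<in> carrier M" for x y
    using that inj by (simp add: transport_module_def Let_def)
  have smult: "r \<odot>\<^bsub>?T\<^esub> h x = h (r \<odot>\<^bsub>M\<^esub> x)" if "x \<in> carrier M" for r x
    using that inj by (simp add: transport_module_def Let_def)
  show "module R ?T"
  proof (rule moduleI)
    show "cring R" using M by (simp add: module_def)
    show "abelian_group ?T"
    proof (rule abelian_groupI)
      fix y assume "y \<in> carrier ?T"
      then obtain x where x: "x \<in> carrier M" "y = h x" by (auto simp: c)
      then have "h (\<ominus>\<^bsub>M\<^esub> x) \<oplus>\<^bsub>?T\<^esub> y = \<zero>\<^bsub>?T\<^esub>" by (simp add: add z M.l_neg)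
      then show "\<exists>y'\<in>carrier ?T. y' \<oplus>\<^bsub>?T\<^esub> y = \<zero>\<^bsub>?T\<^esub>" using x by (auto simp: c)
    qed (auto simp: c z add M.a_ac)
  qed (auto simp: c add smult smult_l_distr smult_r_distr smult_assoc1)
  show "h \<in> mod_iso R M ?T"
    using inj by (simp add: mod_iso_def mod_hom_def bij_betw_def c add smult)
qed

text \<open>The elements of the transported modules are exactly the \<open>h X Y \<xi>\<close>, so every law of \<open>F\<close> is carried
  over along \<open>h\<close>.\<close>

lemma transport_bifunctor_iso:
  assumes "bilinear_bifunctor R C F"
    and inj: "\<And>X Y. X \<in> Obj C \<Longrightarrow> Y \<in> Obj C \<Longrightarrow> inj_on (h X Y) (carrier (bval F X Y))"
  shows "bilinear_bifunctor R C (transport_bifunctor C h F)"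
    and "X \<in> Obj C \<Longrightarrow> Y \<in> Obj C \<Longrightarrow> h X Y \<in> mod_iso R (bval F X Y) (bval (transport_bifunctor C h F) X Y)"
    and "X \<in> Obj C \<Longrightarrow> X' \<in> Obj C \<Longrightarrow> Y \<in> Obj C \<Longrightarrow> Y' \<in> Obj C \<Longrightarrow> c \<in> arr C X' X \<Longrightarrow> a \<in> arr C Y Y' \<Longrightarrow>
      \<xi> \<in> carrier (bval F X Y) \<Longrightarrow>
      bmap (transport_bifunctor C h F) c a (h X Y \<xi>) = h X' Y' (bmap F c a \<xi>)"
proof -
  interpret F: bilinear_bifunctor R C F by fact
  let ?T = "transport_bifunctor C h F"
  have v: "bval ?T X Y = transport_module (h X Y) (bval F X Y)" for X Y
    by (simp add: transport_bifunctor_def)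
  have T: "module R (bval ?T X Y)" and iso: "h X Y \<in> mod_iso R (bval F X Y) (bval ?T X Y)"
    if "X \<in> Obj C" "Y \<in> Obj C" for X Y
    unfolding v using transport_module_iso[OF F.bval_module[OF that] inj[OF that]] .
  show "X \<in> Obj C \<Longrightarrow> Y \<in> Obj C \<Longrightarrow> h X Y \<in> mod_iso R (bval F X Y) (bval ?T X Y)"
    by (rule iso)
  have m: "bmap ?T c a (h X Y \<xi>) = h X' Y' (bmap F c a \<xi>)"
    if "X \<in> Obj C" "X' \<in> Obj C" "Y \<in> Obj C" "Y' \<in> Obj C" "c \<in> arr C X' X" "a \<in> arr C Y Y'"
      "\<xi> \<in> carrier (bval F X Y)" for X X' Y Y' c a \<xi>
  proof -
    have "src C c = X'" "tgt C c = X" "src C a = Y" "tgt C a = Y'"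
      using F.src_tgt that by blast+
    then show ?thesis using inj[OF that(1,3)] that(7) by (simp add: transport_bifunctor_def)
  qed
  then show "X \<in> Obj C \<Longrightarrow> X' \<in> Obj C \<Longrightarrow> Y \<in> Obj C \<Longrightarrow> Y' \<in> Obj C \<Longrightarrow> c \<in> arr C X' X \<Longrightarrow> a \<in> arr C Y Y' \<Longrightarrow>
      \<xi> \<in> carrier (bval F X Y) \<Longrightarrow> bmap ?T c a (h X Y \<xi>) = h X' Y' (bmap F c a \<xi>)" .
  have im: "\<exists>\<xi>\<in>carrier (bval F X Y). \<eta> = h X Y \<xi>" if "\<eta> \<in> carrier (bval ?T X Y)" for X Y \<eta>
    using that by (auto simp: v transport_module_def Let_def)
  note hom = mod_iso_hom[OF iso]
  note hc = mod_hom_closed[OF hom] and ha = mod_hom_add[OF hom, symmetric] and hs = mod_hom_smult[OF hom, symmetric]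
  show "bilinear_bifunctor R C ?T"
  proof (intro bilinear_bifunctor.intro bilinear_bifunctor_axioms.intro)
    show "linear_category R C" by (rule F.linear_category_axioms)
  next
    fix X Y assume XY: "X \<in> Obj C" "Y \<in> Obj C"
    show "module R (bval ?T X Y)" by (rule T[OF XY])
    fix \<eta> assume "\<eta> \<in> carrier (bval ?T X Y)"
    from im[OF this] obtain \<xi> where "\<xi> \<in> carrier (bval F X Y)" "\<eta> = h X Y \<xi>" by blast
    then show "bmap ?T (Id C X) (Id C Y) \<eta> = \<eta>"
      using m[OF XY(1,1,2,2) F.Id_closed[OF XY(1)] F.Id_closed[OF XY(2)]] F.bmap_Id[OF XY] by simp
  next
    fix X X' Y Y' c a
    assume o: "X \<in> Obj C" "X' \<in> Obj C" "Y \<in> Obj C" "Y' \<in> Obj C" and c: "c \<in> arr C X' X" and a: "a \<in> arr C Y Y'"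
    note m' = m[OF o c a] and cl = F.bmap_closed[OF o c a]
    note Fh = F.bmap_hom[OF o c a]
    show "bmap ?T c a \<in> mod_hom R (bval ?T X Y) (bval ?T X' Y')"
    proof (rule mod_homI)
      fix \<eta> assume "\<eta> \<in> carrier (bval ?T X Y)"
      from im[OF this] obtain \<xi> where x: "\<xi> \<in> carrier (bval F X Y)" "\<eta> = h X Y \<xi>" by blast
      show "bmap ?T c a \<eta> \<in> carrier (bval ?T X' Y')"
        unfolding x(2) m'[OF x(1)] by (rule hc[OF o(2,4) cl[OF x(1)]])
      show "bmap ?T c a (r \<odot>\<^bsub>bval ?T X Y\<^esub> \<eta>) = r \<odot>\<^bsub>bval ?T X' Y'\<^esub> bmap ?T c a \<eta>" if r: "r \<in> carrier R" for r
        unfolding x(2) hs[OF o(1,3) r x(1)] m'[OF x(1)] m'[OF module_smult[OF F.bval_module[OF o(1,3)] r x(1)]]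
          mod_hom_smult[OF Fh r x(1)] hs[OF o(2,4) r cl[OF x(1)]] ..
      fix \<eta>' assume "\<eta>' \<in> carrier (bval ?T X Y)"
      from im[OF this] obtain \<xi>' where x': "\<xi>' \<in> carrier (bval F X Y)" "\<eta>' = h X Y \<xi>'" by blast
      show "bmap ?T c a (\<eta> \<oplus>\<^bsub>bval ?T X Y\<^esub> \<eta>') = bmap ?T c a \<eta> \<oplus>\<^bsub>bval ?T X' Y'\<^esub> bmap ?T c a \<eta>'"
        unfolding x(2) x'(2) ha[OF o(1,3) x(1) x'(1)] m'[OF x(1)] m'[OF x'(1)]
          m'[OF module_add[OF F.bval_module[OF o(1,3)] x(1) x'(1)]]
          mod_hom_add[OF Fh x(1) x'(1)] ha[OF o(2,4) cl[OF x(1)] cl[OF x'(1)]] ..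
    qed
  next
    fix X X' X'' Y Y' Y'' c c' a a' \<eta>
    assume o: "X \<in> Obj C" "X' \<in> Obj C" "X'' \<in> Obj C" "Y \<in> Obj C" "Y' \<in> Obj C" "Y'' \<in> Obj C"
      and c: "c \<in> arr C X' X" "c' \<in> arr C X'' X'" and a: "a \<in> arr C Y Y'" "a' \<in> arr C Y' Y''"
      and "\<eta> \<in> carrier (bval ?T X Y)"
    from im[OF this(11)] obtain \<xi> where x: "\<xi> \<in> carrier (bval F X Y)" "\<eta> = h X Y \<xi>" by blast
    show "bmap ?T (c \<circledcirc>\<^bsub>C\<^esub> c') (a' \<circledcirc>\<^bsub>C\<^esub> a) \<eta> = bmap ?T c' a' (bmap ?T c a \<eta>)"
      unfolding x(2) m[OF o(1,2,4,5) c(1) a(1) x(1)]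
        m[OF o(2,3,5,6) c(2) a(2) F.bmap_closed[OF o(1,2,4,5) c(1) a(1) x(1)]]
        m[OF o(1,3,4,6) F.cmp_closed[OF o(3,2,1) c(2,1)] F.cmp_closed[OF o(4,5,6) a] x(1)]
        F.bmap_cmp[OF o c a x(1)] ..
  next
    fix X X' Y Y' a \<eta>
    assume o: "X \<in> Obj C" "X' \<in> Obj C" "Y \<in> Obj C" "Y' \<in> Obj C" and a: "a \<in> arr C Y Y'"
      and "\<eta> \<in> carrier (bval ?T X Y)"
    from im[OF this(6)] obtain \<xi> where x: "\<xi> \<in> carrier (bval F X Y)" "\<eta> = h X Y \<xi>" by blast
    have "(\<lambda>c. h X' Y' (bmap F c a \<xi>)) \<in> mod_hom R (Hom C X' X) (bval ?T X' Y')"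
      by (rule mod_hom_comp[OF F.bmap_linear_left[OF o a x(1)] hom[OF o(2,4)]])
    then show "(\<lambda>c. bmap ?T c a \<eta>) \<in> mod_hom R (Hom C X' X) (bval ?T X' Y')"
      using m[OF o _ a x(1)] module_add[OF F.Hom_module[OF o(2,1)]] module_smult[OF F.Hom_module[OF o(2,1)]]
      by (simp add: x(2) mod_hom_def Pi_iff)
  next
    fix X X' Y Y' c \<eta>
    assume o: "X \<in> Obj C" "X' \<in> Obj C" "Y \<in> Obj C" "Y' \<in> Obj C" and c: "c \<in> arr C X' X"
      and "\<eta> \<in> carrier (bval ?T X Y)"
    from im[OF this(6)] obtain \<xi> where x: "\<xi> \<in> carrier (bval F X Y)" "\<eta> = h X Y \<xi>" by blast
    have "(\<lambda>a. h X' Y' (bmap F c a \<xi>)) \<in> mod_hom R (Hom C Y Y') (bval ?T X' Y')"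
      by (rule mod_hom_comp[OF F.bmap_linear_right[OF o c x(1)] hom[OF o(2,4)]])
    then show "(\<lambda>a. bmap ?T c a \<eta>) \<in> mod_hom R (Hom C Y Y') (bval ?T X' Y')"
      using m[OF o c _ x(1)] module_add[OF F.Hom_module[OF o(3,4)]] module_smult[OF F.Hom_module[OF o(3,4)]]
      by (simp add: x(2) mod_hom_def Pi_iff)
  qed
qed

context bifunctor_pair
begin

lemma coend_comp_eqI:
  assumes X: "X \<in> Obj C" and Y: "Y \<in> Obj C" and P: "module R P"
    and h: "h \<in> mod_hom R (bval (coend_comp R C F G) X Y) P" and k: "k \<in> mod_hom R (bval (coend_comp R C F G) X Y) P"
    and eq: "\<And>M \<xi> \<delta>. M \<in> Obj C \<Longrightarrow> \<xi> \<in> carrier (bval F M Y) \<Longrightarrow> \<delta> \<in> carrier (bval G X M) \<Longrightarrow>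
      h (cotensor X Y M \<xi> \<delta>) = k (cotensor X Y M \<xi> \<delta>)"
    and K: "K \<in> carrier (bval (coend_comp R C F G) X Y)"
  shows "h K = k K"
  by (rule mod_hom_eq_on_generators[OF coend_comp_module[OF X Y] P h k cotensor_generated[OF X Y] _ K])
    (use eq cotensor_closed[OF X Y] in auto)

text \<open>For fixed morphisms each law is an equality of two linear maps on the coend. It is therefore
  enough to check it at the classes of \<open>\<xi> \<otimes> \<delta>\<close>, where it reduces to the laws of \<open>F\<close> and \<open>G\<close>.\<close>

lemma coend_comp_bilinear: "bilinear_bifunctor R C (coend_comp R C F G)"
proof -
  let ?E = "coend_comp R C F G"
  note I = F.Id_closed
  show ?thesis
  proof (intro bilinear_bifunctor.intro bilinear_bifunctor_axioms.intro)
    show "linear_category R C" by (rule F.linear_category_axioms)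
  next
    fix X Y assume XY: "X \<in> Obj C" "Y \<in> Obj C"
    show "module R (bval ?E X Y)" by (rule coend_comp_module[OF XY])
    fix K assume K: "K \<in> carrier (bval ?E X Y)"
    show "bmap ?E (Id C X) (Id C Y) K = K"
      by (rule coend_comp_eqI[OF XY coend_comp_module[OF XY]
            coend_comp_bmap(1)[OF XY(1,1,2,2) I[OF XY(1)] I[OF XY(2)]] mod_hom_id _ K])
        (simp add: coend_comp_bmap(2)[OF XY(1,1,2,2) I[OF XY(1)] I[OF XY(2)]] F.bmap_Id XY G.bmap_Id)
  next
    fix X X' Y Y' c a
    assume "X \<in> Obj C" "X' \<in> Obj C" "Y \<in> Obj C" "Y' \<in> Obj C" "c \<in> arr C X' X" "a \<in> arr C Y Y'"
    then show "bmap ?E c a \<in> mod_hom R (bval ?E X Y) (bval ?E X' Y')" by (rule coend_comp_bmap(1))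
  next
    fix X X' X'' Y Y' Y'' c c' a a' K
    assume o: "X \<in> Obj C" "X' \<in> Obj C" "X'' \<in> Obj C" "Y \<in> Obj C" "Y' \<in> Obj C" "Y'' \<in> Obj C"
      and c: "c \<in> arr C X' X" "c' \<in> arr C X'' X'" and a: "a \<in> arr C Y Y'" "a' \<in> arr C Y' Y''"
      and K: "K \<in> carrier (bval ?E X Y)"
    note cc = F.cmp_closed[OF o(3,2,1) c(2,1)] and aa = F.cmp_closed[OF o(4,5,6) a]
    show "bmap ?E (c \<circledcirc>\<^bsub>C\<^esub> c') (a' \<circledcirc>\<^bsub>C\<^esub> a) K = bmap ?E c' a' (bmap ?E c a K)"
    proof (rule coend_comp_eqI[OF o(1,4) coend_comp_module[OF o(3,6)] coend_comp_bmap(1)[OF o(1,3,4,6) cc aa]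
            mod_hom_comp[OF coend_comp_bmap(1)[OF o(1,2,4,5) c(1) a(1)] coend_comp_bmap(1)[OF o(2,3,5,6) c(2) a(2)]] _ K])
      fix M \<xi> \<delta> assume M: "M \<in> Obj C" and \<xi>: "\<xi> \<in> carrier (bval F M Y)" and \<delta>: "\<delta> \<in> carrier (bval G X M)"
      show "bmap ?E (c \<circledcirc>\<^bsub>C\<^esub> c') (a' \<circledcirc>\<^bsub>C\<^esub> a) (cotensor X Y M \<xi> \<delta>) = bmap ?E c' a' (bmap ?E c a (cotensor X Y M \<xi> \<delta>))"
        unfolding coend_comp_bmap(2)[OF o(1,3,4,6) cc aa M \<xi> \<delta>] coend_comp_bmap(2)[OF o(1,2,4,5) c(1) a(1) M \<xi> \<delta>]
          coend_comp_bmap(2)[OF o(2,3,5,6) c(2) a(2) M F.bmap_closed[OF M M o(4,5) I[OF M] a(1) \<xi>]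
            G.bmap_closed[OF o(1,2) M M c(1) I[OF M] \<delta>]]
          F.bmap_cmp_right[OF M o(4,5,6) a \<xi>] G.bmap_cmp_left[OF o(1,2,3) M c \<delta>] ..
    qed
  next
    fix X X' Y Y' a K
    assume o: "X \<in> Obj C" "X' \<in> Obj C" "Y \<in> Obj C" "Y' \<in> Obj C" and a: "a \<in> arr C Y Y'"
      and K: "K \<in> carrier (bval ?E X Y)"
    note E' = coend_comp_module[OF o(2,4)] and h = coend_comp_bmap(1)[OF o _ a] and g = coend_comp_bmap(2)[OF o _ a]
    have lin: "(\<lambda>c. cotensor X' Y' M (bmap F (Id C M) a \<xi>) (bmap G c (Id C M) \<delta>)) \<in> mod_hom R (Hom C X' X) (bval ?E X' Y')"
      if "M \<in> Obj C" "\<xi> \<in> carrier (bval F M Y)" "\<delta> \<in> carrier (bval G X M)" for M \<xi> \<delta>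
      by (rule mod_hom_comp[OF G.bmap_linear_left[OF o(1,2) that(1,1) I[OF that(1)] that(3)]
            bilinearD(2)[OF cotensor_bilinear[OF o(2,4) that(1)] F.bmap_closed[OF that(1,1) o(3,4) I[OF that(1)] a that(2)]]])
    show "(\<lambda>c. bmap ?E c a K) \<in> mod_hom R (Hom C X' X) (bval ?E X' Y')"
    proof (rule mod_homI)
      fix c assume c: "c \<in> arr C X' X"
      show "bmap ?E c a K \<in> carrier (bval ?E X' Y')" by (rule mod_hom_closed[OF h[OF c] K])
      show "bmap ?E (r \<odot>\<^bsub>Hom C X' X\<^esub> c) a K = r \<odot>\<^bsub>bval ?E X' Y'\<^esub> bmap ?E c a K" if r: "r \<in> carrier R" for r
        by (rule coend_comp_eqI[OF o(1,3) E' h[OF module_smult[OF F.Hom_module[OF o(2,1)] r c]]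
              mod_hom_pointwise_smult[OF E' h[OF c] r] _ K])
          (simp add: g[OF c] g[OF module_smult[OF F.Hom_module[OF o(2,1)] r c]] mod_hom_smult[OF lin r c])
      fix c' assume c': "c' \<in> arr C X' X"
      show "bmap ?E (c \<oplus>\<^bsub>Hom C X' X\<^esub> c') a K = bmap ?E c a K \<oplus>\<^bsub>bval ?E X' Y'\<^esub> bmap ?E c' a K"
        by (rule coend_comp_eqI[OF o(1,3) E' h[OF module_add[OF F.Hom_module[OF o(2,1)] c c']]
              mod_hom_pointwise_add[OF E' h[OF c] h[OF c']] _ K])
          (simp add: g[OF c] g[OF c'] g[OF module_add[OF F.Hom_module[OF o(2,1)] c c']] mod_hom_add[OF lin c c'])
    qed
  next
    fix X X' Y Y' c K
    assume o: "X \<in> Obj C" "X' \<in> Obj C" "Y \<in> Obj C" "Y' \<in> Obj C" and c: "c \<in> arr C X' X"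
      and K: "K \<in> carrier (bval ?E X Y)"
    note E' = coend_comp_module[OF o(2,4)] and h = coend_comp_bmap(1)[OF o c] and g = coend_comp_bmap(2)[OF o c]
    have lin: "(\<lambda>a. cotensor X' Y' M (bmap F (Id C M) a \<xi>) (bmap G c (Id C M) \<delta>)) \<in> mod_hom R (Hom C Y Y') (bval ?E X' Y')"
      if "M \<in> Obj C" "\<xi> \<in> carrier (bval F M Y)" "\<delta> \<in> carrier (bval G X M)" for M \<xi> \<delta>
      by (rule mod_hom_comp[OF F.bmap_linear_right[OF that(1,1) o(3,4) I[OF that(1)] that(2)]
            bilinearD(1)[OF cotensor_bilinear[OF o(2,4) that(1)] G.bmap_closed[OF o(1,2) that(1,1) c I[OF that(1)] that(3)]]])
    show "(\<lambda>a. bmap ?E c a K) \<in> mod_hom R (Hom C Y Y') (bval ?E X' Y')"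
    proof (rule mod_homI)
      fix a assume a: "a \<in> arr C Y Y'"
      show "bmap ?E c a K \<in> carrier (bval ?E X' Y')" by (rule mod_hom_closed[OF h[OF a] K])
      show "bmap ?E c (r \<odot>\<^bsub>Hom C Y Y'\<^esub> a) K = r \<odot>\<^bsub>bval ?E X' Y'\<^esub> bmap ?E c a K" if r: "r \<in> carrier R" for r
        by (rule coend_comp_eqI[OF o(1,3) E' h[OF module_smult[OF F.Hom_module[OF o(3,4)] r a]]
              mod_hom_pointwise_smult[OF E' h[OF a] r] _ K])
          (simp add: g[OF a] g[OF module_smult[OF F.Hom_module[OF o(3,4)] r a]] mod_hom_smult[OF lin r a])
      fix a' assume a': "a' \<in> arr C Y Y'"
      show "bmap ?E c (a \<oplus>\<^bsub>Hom C Y Y'\<^esub> a') K = bmap ?E c a K \<oplus>\<^bsub>bval ?E X' Y'\<^esub> bmap ?E c a' K"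
        by (rule coend_comp_eqI[OF o(1,3) E' h[OF module_add[OF F.Hom_module[OF o(3,4)] a a']]
              mod_hom_pointwise_add[OF E' h[OF a] h[OF a']] _ K])
          (simp add: g[OF a] g[OF a'] g[OF module_add[OF F.Hom_module[OF o(3,4)] a a']] mod_hom_add[OF lin a a'])
    qed
  qed
qed

end

section \<open>Presentations by projectives\<close>

text \<open>What the triangles \<open>\<Omega>X \<rightarrow> P X \<rightarrow> X\<close> say about the functor \<open>\<E>(X, -)\<close> as a quotient of \<open>Hom(\<Omega>X, -)\<close>, with
  the realization of extensions forgotten. In this form it applies to the opposite category as well.\<close>

locale projective_presentation = bilinear_bifunctor R C E
  for R :: "('r, 'k) ring_scheme" and C :: "('r, 'o, 'a, 'z) lin_cat_scheme" (structure)
    and E :: "('r, 'o, 'a, 'e) bifunctor" +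
  fixes \<Omega> P :: "'o \<Rightarrow> 'o" and u :: "'o \<Rightarrow> 'a" and \<omega> :: "'o \<Rightarrow> 'e"
  assumes \<Omega>_obj: "X \<in> Obj C \<Longrightarrow> \<Omega> X \<in> Obj C" and P_obj: "X \<in> Obj C \<Longrightarrow> P X \<in> Obj C"
    and u_arr: "X \<in> Obj C \<Longrightarrow> u X \<in> arr C (\<Omega> X) (P X)"
    and \<omega>_closed: "X \<in> Obj C \<Longrightarrow> \<omega> X \<in> carrier (bval E X (\<Omega> X))"
    and P_zero: "X \<in> Obj C \<Longrightarrow> Y \<in> Obj C \<Longrightarrow> carrier (bval E (P X) Y) = {\<zero>\<^bsub>bval E (P X) Y\<^esub>}"
    and classify: "X \<in> Obj C \<Longrightarrow> M \<in> Obj C \<Longrightarrow> \<delta> \<in> carrier (bval E X M) \<Longrightarrow>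
      \<exists>a\<in>arr C (\<Omega> X) M. bmap E (Id C X) a (\<omega> X) = \<delta>"
    and factor: "X \<in> Obj C \<Longrightarrow> M \<in> Obj C \<Longrightarrow> a \<in> arr C (\<Omega> X) M \<Longrightarrow>
      bmap E (Id C X) a (\<omega> X) = \<zero>\<^bsub>bval E X M\<^esub> \<Longrightarrow> \<exists>b\<in>arr C (P X) M. a = b \<circledcirc> u X"
begin

text \<open>The difference of \<open>a\<close> and \<open>a'\<close> factors through \<open>P X\<close>, where \<open>F\<close> vanishes. So the action of \<open>a\<close> on
  \<open>F\<close> depends only on the extension \<open>a\<^sub>* (\<omega> X)\<close> that \<open>a\<close> classifies.\<close>

lemma bmap_eq_of_classifying_eq:
  assumes "bilinear_bifunctor R C F"
    and F0: "\<And>Y. Y \<in> Obj C \<Longrightarrow> carrier (bval F (P X) Y) = {\<zero>\<^bsub>bval F (P X) Y\<^esub>}"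
    and X: "X \<in> Obj C" and M: "M \<in> Obj C" and Y: "Y \<in> Obj C"
    and a: "a \<in> arr C (\<Omega> X) M" and a': "a' \<in> arr C (\<Omega> X) M"
    and eq: "bmap E (Id C X) a (\<omega> X) = bmap E (Id C X) a' (\<omega> X)"
    and \<xi>: "\<xi> \<in> carrier (bval F M Y)"
  shows "bmap F a (Id C Y) \<xi> = bmap F a' (Id C Y) \<xi>"
proof -
  interpret F: bilinear_bifunctor R C F by fact
  note H = Hom_module[OF \<Omega>_obj[OF X] M]
  let ?d = "a \<ominus>\<^bsub>Hom C (\<Omega> X) M\<^esub> a'"
  have d: "?d \<in> arr C (\<Omega> X) M" by (rule module_minus[OF H a a'])
  have "bmap E (Id C X) ?d (\<omega> X) = \<zero>\<^bsub>bval E X M\<^esub>"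
    unfolding mod_hom_minus[OF H bval_module[OF X M]
        bmap_linear_right[OF X X \<Omega>_obj[OF X] M Id_closed[OF X] \<omega>_closed[OF X]] a a'] eq
    by (rule module_minus_self[OF bval_module[OF X M]
          bmap_closed[OF X X \<Omega>_obj[OF X] M Id_closed[OF X] a' \<omega>_closed[OF X]]])
  then obtain b where b: "b \<in> arr C (P X) M" "?d = b \<circledcirc> u X" using factor[OF X M d] by blast
  have "bmap F b (Id C Y) \<xi> = \<zero>\<^bsub>bval F (P X) Y\<^esub>"
    using F.bmap_closed[OF M P_obj[OF X] Y Y b(1) Id_closed[OF Y] \<xi>] F0[OF Y] by blast
  then have "bmap F ?d (Id C Y) \<xi> = \<zero>\<^bsub>bval F (\<Omega> X) Y\<^esub>"
    unfolding b(2) F.bmap_cmp_left[OF M P_obj[OF X] \<Omega>_obj[OF X] Y b(1) u_arr[OF X] \<xi>]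
    by (simp add: F.bmap_zero[OF P_obj[OF X] \<Omega>_obj[OF X] Y Y u_arr[OF X] Id_closed[OF Y]])
  then have "bmap F a (Id C Y) \<xi> \<ominus>\<^bsub>bval F (\<Omega> X) Y\<^esub> bmap F a' (Id C Y) \<xi> = \<zero>\<^bsub>bval F (\<Omega> X) Y\<^esub>"
    unfolding mod_hom_minus[OF H F.bval_module[OF \<Omega>_obj[OF X] Y]
        F.bmap_linear_left[OF M \<Omega>_obj[OF X] Y Y Id_closed[OF Y] \<xi>] a a'] .
  then show ?thesis
    using module_minus_eq_zero[OF F.bval_module[OF \<Omega>_obj[OF X] Y]
        F.bmap_closed[OF M \<Omega>_obj[OF X] Y Y a Id_closed[OF Y] \<xi>]
        F.bmap_closed[OF M \<Omega>_obj[OF X] Y Y a' Id_closed[OF Y] \<xi>]] by blast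
qed

text \<open>\<open>k\<close> lies over \<open>c\<close>: the pair \<open>(k, c)\<close> is a morphism of extensions \<open>\<omega> X' \<rightarrow> \<omega> X\<close>.\<close>

definition lies_over :: "'o \<Rightarrow> 'o \<Rightarrow> 'a \<Rightarrow> 'a \<Rightarrow> bool"
  where "lies_over X' X c k \<longleftrightarrow> k \<in> arr C (\<Omega> X') (\<Omega> X) \<and>
    bmap E (Id C X') k (\<omega> X') = bmap E c (Id C (\<Omega> X)) (\<omega> X)"

lemma lies_over_exists:
  assumes "X \<in> Obj C" "X' \<in> Obj C" "c \<in> arr C X' X"
  obtains k where "lies_over X' X c k"
  using classify[OF assms(2) \<Omega>_obj[OF assms(1)]
      bmap_closed[OF assms(1,2) \<Omega>_obj[OF assms(1)] \<Omega>_obj[OF assms(1)] assms(3) Id_closed[OF \<Omega>_obj[OF assms(1)]]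
        \<omega>_closed[OF assms(1)]]] that
  unfolding lies_over_def by blast

text \<open>\<open>c\<^sup>* a\<^sub>* (\<omega> X) = a\<^sub>* c\<^sup>* (\<omega> X) = a\<^sub>* k\<^sub>* (\<omega> X')\<close>.\<close>

lemma pull_of_classified:
  assumes X: "X \<in> Obj C" and X': "X' \<in> Obj C" and M: "M \<in> Obj C" and c: "c \<in> arr C X' X"
    and k: "lies_over X' X c k" and a: "a \<in> arr C (\<Omega> X) M"
  shows "bmap E c (Id C M) (bmap E (Id C X) a (\<omega> X)) = bmap E (Id C X') (a \<circledcirc> k) (\<omega> X')"
proof -
  note k' = k[unfolded lies_over_def]
  have "bmap E c (Id C M) (bmap E (Id C X) a (\<omega> X)) = bmap E c a (\<omega> X)"
    by (rule bmap_split_left[OF X X' \<Omega>_obj[OF X] M c a \<omega>_closed[OF X], symmetric])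
  also have "\<dots> = bmap E (Id C X') a (bmap E c (Id C (\<Omega> X)) (\<omega> X))"
    by (rule bmap_split_right[OF X X' \<Omega>_obj[OF X] M c a \<omega>_closed[OF X]])
  also have "\<dots> = bmap E (Id C X') (a \<circledcirc> k) (\<omega> X')"
    unfolding conjunct2[OF k', symmetric]
    by (rule bmap_cmp_right[OF X' \<Omega>_obj[OF X'] \<Omega>_obj[OF X] M conjunct1[OF k'] a \<omega>_closed[OF X'], symmetric])
  finally show ?thesis .
qed

end


locale presented_pair = projective_presentation R C E \<Omega> P u \<omega> + F: bilinear_bifunctor R C F
  for R :: "('r, 'k) ring_scheme" and C :: "('r, 'o, 'a, 'z) lin_cat_scheme" (structure)
    and E :: "('r, 'o, 'a, 'e) bifunctor" and \<Omega> P u \<omega>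
    and F :: "('r, 'o, 'a, 'f) bifunctor" +
  assumes F_zero: "X \<in> Obj C \<Longrightarrow> Y \<in> Obj C \<Longrightarrow> carrier (bval F (P X) Y) = {\<zero>\<^bsub>bval F (P X) Y\<^esub>}"
begin

sublocale pair: bifunctor_pair R C F E ..

lemma F_bmap_eq:
  assumes "X \<in> Obj C" "M \<in> Obj C" "Y \<in> Obj C" "a \<in> arr C (\<Omega> X) M" "a' \<in> arr C (\<Omega> X) M"
    "bmap E (Id C X) a (\<omega> X) = bmap E (Id C X) a' (\<omega> X)" "\<xi> \<in> carrier (bval F M Y)"
  shows "bmap F a (Id C Y) \<xi> = bmap F a' (Id C Y) \<xi>"
  by (rule bmap_eq_of_classifying_eq[OF F.bilinear_bifunctor_axioms F_zero[OF assms(1)] assms])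

text \<open>By right exactness and the co-Yoneda lemma, the coend of \<open>F(M, Y) \<otimes> \<E>(X, M)\<close> is the cokernel of
  \<open>F(P X, Y) \<rightarrow> F(\<Omega>X, Y)\<close>, whose source is zero. Explicitly, \<open>\<xi> \<otimes> a\<^sub>* (\<omega> X) \<mapsto> F(a, Y) \<xi>\<close> has the inverse
  \<open>\<xi> \<mapsto> \<xi> \<otimes> \<omega> X\<close>, since \<open>a\<close> can be moved across the tensor sign in \<open>\<xi> \<otimes> a\<^sub>* (\<omega> X)\<close>.\<close>

lemma coend_eval:
  assumes X: "X \<in> Obj C" and Y: "Y \<in> Obj C"
  shows "\<exists>\<theta>\<in>mod_iso R (bval (coend_comp R C F E) X Y) (bval F (\<Omega> X) Y).
    \<forall>M\<in>Obj C. \<forall>\<xi>\<in>carrier (bval F M Y). \<forall>a\<in>arr C (\<Omega> X) M.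
      \<theta> (pair.cotensor X Y M \<xi> (bmap E (Id C X) a (\<omega> X))) = bmap F a (Id C Y) \<xi>"
proof -
  note \<Omega> = \<Omega>_obj[OF X] and w = \<omega>_closed[OF X] and I = Id_closed
  \<comment> \<open>a classifying map for \<open>\<delta>\<close>; by \<open>F_bmap_eq\<close> its action on \<open>F\<close> does not depend on the choice\<close>
  define s where "s M \<delta> = (SOME a. a \<in> arr C (\<Omega> X) M \<and> bmap E (Id C X) a (\<omega> X) = \<delta>)" for M \<delta>
  have s: "s M \<delta> \<in> arr C (\<Omega> X) M" "bmap E (Id C X) (s M \<delta>) (\<omega> X) = \<delta>"
    if "M \<in> Obj C" "\<delta> \<in> carrier (bval E X M)" for M \<delta>
  proof -
    have "s M \<delta> \<in> arr C (\<Omega> X) M \<and> bmap E (Id C X) (s M \<delta>) (\<omega> X) = \<delta>"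
      unfolding s_def by (rule someI_ex) (use classify[OF X that] in blast)
    then show "s M \<delta> \<in> arr C (\<Omega> X) M" "bmap E (Id C X) (s M \<delta>) (\<omega> X) = \<delta>" by auto
  qed
  define \<beta> where "\<beta> M \<xi> \<delta> = bmap F (s M \<delta>) (Id C Y) \<xi>" for M \<xi> \<delta>
  have \<beta>: "\<beta> M \<xi> \<delta> = bmap F a (Id C Y) \<xi>"
    if M: "M \<in> Obj C" and \<xi>: "\<xi> \<in> carrier (bval F M Y)" and a: "a \<in> arr C (\<Omega> X) M" "bmap E (Id C X) a (\<omega> X) = \<delta>"
    for M \<xi> \<delta> a
  proof -
    have \<delta>: "\<delta> \<in> carrier (bval E X M)" unfolding a(2)[symmetric] by (rule bmap_closed[OF X X \<Omega> M I[OF X] a(1) w])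
    show ?thesis unfolding \<beta>_def by (rule F_bmap_eq[OF X M Y s(1)[OF M \<delta>] a(1) _ \<xi>]) (simp add: s(2)[OF M \<delta>] a(2))
  qed
  have bil: "bilinear R (bval F M Y) (bval E X M) (bval F (\<Omega> X) Y) (\<beta> M)" if M: "M \<in> Obj C" for M
    unfolding bilinear_def
  proof (intro conjI ballI)
    fix \<delta> assume \<delta>: "\<delta> \<in> carrier (bval E X M)"
    show "(\<lambda>\<xi>. \<beta> M \<xi> \<delta>) \<in> mod_hom R (bval F M Y) (bval F (\<Omega> X) Y)"
      unfolding \<beta>_def by (rule F.bmap_hom[OF M \<Omega> Y Y s(1)[OF M \<delta>] I[OF Y]])
  next
    fix \<xi> assume \<xi>: "\<xi> \<in> carrier (bval F M Y)"
    note H = Hom_module[OF \<Omega> M]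
    note lE = bmap_linear_right[OF X X \<Omega> M I[OF X] w] and lF = F.bmap_linear_left[OF M \<Omega> Y Y I[OF Y] \<xi>]
    show "\<beta> M \<xi> \<in> mod_hom R (bval E X M) (bval F (\<Omega> X) Y)"
    proof (rule mod_homI)
      fix \<delta> assume \<delta>: "\<delta> \<in> carrier (bval E X M)"
      note sd = s[OF M \<delta>]
      show "\<beta> M \<xi> \<delta> \<in> carrier (bval F (\<Omega> X) Y)"
        unfolding \<beta>_def by (rule F.bmap_closed[OF M \<Omega> Y Y sd(1) I[OF Y] \<xi>])
      show "\<beta> M \<xi> (r \<odot>\<^bsub>bval E X M\<^esub> \<delta>) = r \<odot>\<^bsub>bval F (\<Omega> X) Y\<^esub> \<beta> M \<xi> \<delta>" if r: "r \<in> carrier R" for r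
      proof -
        have "\<beta> M \<xi> (r \<odot>\<^bsub>bval E X M\<^esub> \<delta>) = bmap F (r \<odot>\<^bsub>Hom C (\<Omega> X) M\<^esub> s M \<delta>) (Id C Y) \<xi>"
          by (rule \<beta>[OF M \<xi> module_smult[OF H r sd(1)]]) (simp add: mod_hom_smult[OF lE r sd(1)] sd(2))
        then show ?thesis by (simp add: mod_hom_smult[OF lF r sd(1)] \<beta>_def)
      qed
      fix \<delta>' assume \<delta>': "\<delta>' \<in> carrier (bval E X M)"
      note sd' = s[OF M \<delta>']
      have "\<beta> M \<xi> (\<delta> \<oplus>\<^bsub>bval E X M\<^esub> \<delta>') = bmap F (s M \<delta> \<oplus>\<^bsub>Hom C (\<Omega> X) M\<^esub> s M \<delta>') (Id C Y) \<xi>"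
        by (rule \<beta>[OF M \<xi> module_add[OF H sd(1) sd'(1)]]) (simp add: mod_hom_add[OF lE sd(1) sd'(1)] sd(2) sd'(2))
      then show "\<beta> M \<xi> (\<delta> \<oplus>\<^bsub>bval E X M\<^esub> \<delta>') = \<beta> M \<xi> \<delta> \<oplus>\<^bsub>bval F (\<Omega> X) Y\<^esub> \<beta> M \<xi> \<delta>'"
        by (simp add: mod_hom_add[OF lF sd(1) sd'(1)] \<beta>_def)
    qed
  qed
  have slide: "\<beta> M (bmap F f (Id C Y) \<xi>) \<delta> = \<beta> N \<xi> (bmap E (Id C X) f \<delta>)"
    if M: "M \<in> Obj C" and N: "N \<in> Obj C" and f: "f \<in> arr C M N"
      and \<xi>: "\<xi> \<in> carrier (bval F N Y)" and \<delta>: "\<delta> \<in> carrier (bval E X M)" for M N f \<xi> \<delta>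
  proof -
    note sd = s[OF M \<delta>]
    have "\<beta> N \<xi> (bmap E (Id C X) f \<delta>) = bmap F (f \<circledcirc> s M \<delta>) (Id C Y) \<xi>"
      by (rule \<beta>[OF N \<xi> cmp_closed[OF \<Omega> M N sd(1) f]])
        (simp add: bmap_cmp_right[OF X \<Omega> M N sd(1) f w] sd(2))
    then show ?thesis by (simp add: \<beta>_def F.bmap_cmp_left[OF N M \<Omega> Y f sd(1) \<xi>])
  qed
  obtain \<theta> where \<theta>: "\<theta> \<in> mod_hom R (bval (coend_comp R C F E) X Y) (bval F (\<Omega> X) Y)"
    and \<theta>c: "\<And>M \<xi> \<delta>. M \<in> Obj C \<Longrightarrow> \<xi> \<in> carrier (bval F M Y) \<Longrightarrow> \<delta> \<in> carrier (bval E X M) \<Longrightarrow>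
      \<theta> (pair.cotensor X Y M \<xi> \<delta>) = \<beta> M \<xi> \<delta>"
    by (rule pair.cotensor_lift[OF X Y F.bval_module[OF \<Omega> Y] bil slide]) (assumption | rule that)+
  have \<theta>a: "\<theta> (pair.cotensor X Y M \<xi> (bmap E (Id C X) a (\<omega> X))) = bmap F a (Id C Y) \<xi>"
    if M: "M \<in> Obj C" and \<xi>: "\<xi> \<in> carrier (bval F M Y)" and a: "a \<in> arr C (\<Omega> X) M" for M \<xi> a
    using \<theta>c[OF M \<xi> bmap_closed[OF X X \<Omega> M I[OF X] a w]] \<beta>[OF M \<xi> a refl] by simp
  define \<psi> where "\<psi> \<xi> = pair.cotensor X Y (\<Omega> X) \<xi> (\<omega> X)" for \<xi>
  have \<psi>: "\<psi> \<in> mod_hom R (bval F (\<Omega> X) Y) (bval (coend_comp R C F E) X Y)"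
    unfolding \<psi>_def[abs_def] by (rule bilinearD(1)[OF pair.cotensor_bilinear[OF X Y \<Omega>] w])
  have "\<theta> \<in> mod_iso R (bval (coend_comp R C F E) X Y) (bval F (\<Omega> X) Y)"
  proof (rule mod_isoI[OF \<theta>])
    show "\<psi> \<in> carrier (bval F (\<Omega> X) Y) \<rightarrow> carrier (bval (coend_comp R C F E) X Y)"
      using mod_hom_closed[OF \<psi>] by blast
    show "\<theta> (\<psi> \<xi>) = \<xi>" if \<xi>: "\<xi> \<in> carrier (bval F (\<Omega> X) Y)" for \<xi>
      using \<theta>a[OF \<Omega> \<xi> I[OF \<Omega>]] by (simp add: \<psi>_def bmap_Id[OF X \<Omega> w] F.bmap_Id[OF \<Omega> Y \<xi>])
    show "\<psi> (\<theta> K) = K" if K: "K \<in> carrier (bval (coend_comp R C F E) X Y)" for K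
    proof (rule pair.coend_comp_eqI[OF X Y pair.coend_comp_module[OF X Y] mod_hom_comp[OF \<theta> \<psi>] mod_hom_id _ K])
      fix M \<xi> \<delta> assume M: "M \<in> Obj C" and \<xi>: "\<xi> \<in> carrier (bval F M Y)" and \<delta>: "\<delta> \<in> carrier (bval E X M)"
      show "\<psi> (\<theta> (pair.cotensor X Y M \<xi> \<delta>)) = pair.cotensor X Y M \<xi> \<delta>"
        using pair.cotensor_slide[OF X Y \<Omega> M s(1)[OF M \<delta>] \<xi> w]
        by (simp add: \<theta>c[OF M \<xi> \<delta>] \<psi>_def \<beta>_def s(2)[OF M \<delta>])
    qed
  qed
  then show ?thesis using \<theta>a by blast
qed

text \<open>At \<open>\<xi> \<otimes> a\<^sub>* (\<omega> X)\<close> both sides are \<open>F(a \<circledcirc> k, b) \<xi>\<close>, because \<open>c\<^sup>* a\<^sub>* (\<omega> X) = (a \<circledcirc> k)\<^sub>* (\<omega> X')\<close>.\<close>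

lemma coend_eval_natural:
  assumes o: "X \<in> Obj C" "X' \<in> Obj C" "Y \<in> Obj C" "Y' \<in> Obj C"
    and c: "c \<in> arr C X' X" and b: "b \<in> arr C Y Y'" and k: "lies_over X' X c k"
    and \<theta>: "\<theta> \<in> mod_hom R (bval (coend_comp R C F E) X Y) (bval F (\<Omega> X) Y)"
      "\<And>M \<xi> a. M \<in> Obj C \<Longrightarrow> \<xi> \<in> carrier (bval F M Y) \<Longrightarrow> a \<in> arr C (\<Omega> X) M \<Longrightarrow>
        \<theta> (pair.cotensor X Y M \<xi> (bmap E (Id C X) a (\<omega> X))) = bmap F a (Id C Y) \<xi>"
    and \<theta>': "\<theta>' \<in> mod_hom R (bval (coend_comp R C F E) X' Y') (bval F (\<Omega> X') Y')"
      "\<And>M \<xi> a. M \<in> Obj C \<Longrightarrow> \<xi> \<in> carrier (bval F M Y') \<Longrightarrow> a \<in> arr C (\<Omega> X') M \<Longrightarrow>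
        \<theta>' (pair.cotensor X' Y' M \<xi> (bmap E (Id C X') a (\<omega> X'))) = bmap F a (Id C Y') \<xi>"
    and K: "K \<in> carrier (bval (coend_comp R C F E) X Y)"
  shows "\<theta>' (bmap (coend_comp R C F E) c b K) = bmap F k b (\<theta> K)"
proof -
  note k' = conjunct1[OF k[unfolded lies_over_def]] and I = Id_closed
  note \<Omega> = \<Omega>_obj[OF o(1)] and \<Omega>' = \<Omega>_obj[OF o(2)]
  show ?thesis
  proof (rule pair.coend_comp_eqI[OF o(1,3) F.bval_module[OF \<Omega>' o(4)]
        mod_hom_comp[OF pair.coend_comp_bmap(1)[OF o c b] \<theta>'(1)]
        mod_hom_comp[OF \<theta>(1) F.bmap_hom[OF \<Omega> \<Omega>' o(3,4) k' b]] _ K])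
    fix M \<xi> \<delta> assume M: "M \<in> Obj C" and \<xi>: "\<xi> \<in> carrier (bval F M Y)" and \<delta>: "\<delta> \<in> carrier (bval E X M)"
    obtain a where a: "a \<in> arr C (\<Omega> X) M" "\<delta> = bmap E (Id C X) a (\<omega> X)" using classify[OF o(1) M \<delta>] by blast
    note ak = cmp_closed[OF \<Omega>' \<Omega> M k' a(1)]
    have "\<theta>' (bmap (coend_comp R C F E) c b (pair.cotensor X Y M \<xi> \<delta>)) =
        \<theta>' (pair.cotensor X' Y' M (bmap F (Id C M) b \<xi>) (bmap E (Id C X') (a \<circledcirc> k) (\<omega> X')))"
      unfolding pair.coend_comp_bmap(2)[OF o c b M \<xi> \<delta>] unfolding a(2) pull_of_classified[OF o(1,2) M c k a(1)] ..
    also have "\<dots> = bmap F (a \<circledcirc> k) (Id C Y') (bmap F (Id C M) b \<xi>)"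
      by (rule \<theta>'(2)[OF M F.bmap_closed[OF M M o(3,4) I[OF M] b \<xi>] ak])
    also have "\<dots> = bmap F (a \<circledcirc> k) b \<xi>"
      by (rule F.bmap_split_left[OF M \<Omega>' o(3,4) ak b \<xi>, symmetric])
    also have "\<dots> = bmap F k b (bmap F a (Id C Y) \<xi>)"
      using F.bmap_cmp[OF M \<Omega> \<Omega>' o(3,3,4) a(1) k' I[OF o(3)] b \<xi>] Id_right[OF o(3,4) b] by simp
    also have "bmap F a (Id C Y) \<xi> = \<theta> (pair.cotensor X Y M \<xi> \<delta>)"
      unfolding a(2) by (rule \<theta>(2)[OF M \<xi> a(1), symmetric])
    finally show "\<theta>' (bmap (coend_comp R C F E) c b (pair.cotensor X Y M \<xi> \<delta>)) =
        bmap F k b (\<theta> (pair.cotensor X Y M \<xi> \<delta>))" .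
  qed
qed

end


section \<open>Syzygies as functors\<close>

lemma mem_coset_self:
  assumes "module R M" "\<zero>\<^bsub>M\<^esub> \<in> S" "x \<in> carrier M"
  shows "x \<in> S +>\<^bsub>M\<^esub> x"
proof -
  interpret module R M by fact
  show ?thesis unfolding a_r_coset_def' using assms(2,3) by force
qed

locale ext_presentation = projective_presentation R C "EE C" \<Omega> P u \<omega>
  for R :: "('r, 'k) ring_scheme" and C :: "('r, 'o, 'a, 'e, 'z) ext_cat_scheme" (structure) and \<Omega> P u \<omega> +
  assumes P_projective: "X \<in> Obj C \<Longrightarrow> projective C (P X)"
begin

text \<open>Morphisms in the same coset of the projective ideal are related in this sense. The relation
  records what \<open>\<E>\<close> sees of a coset, and it is transitive by definition.\<close>

definition ext_equal :: "'o \<Rightarrow> 'o \<Rightarrow> 'a \<Rightarrow> 'a \<Rightarrow> bool"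
  where "ext_equal A B f f' \<longleftrightarrow> (\<forall>Y\<in>Obj C. \<forall>\<delta>\<in>carrier (Ext C B Y).
    bmap (EE C) f (Id C Y) \<delta> = bmap (EE C) f' (Id C Y) \<delta>)"

lemma ext_equalD:
  assumes "ext_equal A B f f'" "A \<in> Obj C" "B \<in> Obj C" "f \<in> arr C A B" "f' \<in> arr C A B"
    "Y \<in> Obj C" "Y' \<in> Obj C" "a \<in> arr C Y Y'" "\<delta> \<in> carrier (Ext C B Y)"
  shows "bmap (EE C) f a \<delta> = bmap (EE C) f' a \<delta>"
  using bmap_split_right[OF assms(3,2,6,7,4,8,9)] bmap_split_right[OF assms(3,2,6,7,5,8,9)] assms(1,6,9)
  unfolding ext_equal_def by simp

lemma proj_class_members:
  assumes A: "A \<in> Obj C" and B: "B \<in> Obj C" and f: "f \<in> arr C A B" and k: "k \<in> proj_class C A B f"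
  shows "k \<in> arr C A B" and "ext_equal A B k f"
proof -
  interpret H: module R "Hom C A B" by (rule Hom_module[OF A B])
  obtain Q g h where Q: "projective C Q" and g: "g \<in> arr C A Q" and h: "h \<in> arr C Q B"
    and k: "k = (h \<circledcirc> g) \<oplus>\<^bsub>Hom C A B\<^esub> f"
    using k unfolding proj_class_def proj_ideal_def a_r_coset_def' by blast
  have Qo: "Q \<in> Obj C" using Q by (simp add: projective_def)
  have hg: "h \<circledcirc> g \<in> arr C A B" by (rule cmp_closed[OF A Qo B g h])
  show "k \<in> arr C A B" using hg f by (simp add: k)
  show "ext_equal A B k f"
    unfolding ext_equal_def
  proof (intro ballI)
    fix Y \<delta> assume Y: "Y \<in> Obj C" and \<delta>: "\<delta> \<in> carrier (Ext C B Y)"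
    interpret V: module R "Ext C A Y" by (rule bval_module[OF A Y])
    have "bmap (EE C) h (Id C Y) \<delta> = \<zero>\<^bsub>Ext C Q Y\<^esub>"
      using bmap_closed[OF B Qo Y Y h Id_closed[OF Y] \<delta>] Q Y unfolding projective_def by blast
    then have "bmap (EE C) (h \<circledcirc> g) (Id C Y) \<delta> = \<zero>\<^bsub>Ext C A Y\<^esub>"
      unfolding bmap_cmp_left[OF B Qo A Y h g \<delta>] by (simp add: bmap_zero[OF Qo A Y Y g Id_closed[OF Y]])
    then show "bmap (EE C) k (Id C Y) \<delta> = bmap (EE C) f (Id C Y) \<delta>"
      unfolding k mod_hom_add[OF bmap_linear_left[OF B A Y Y Id_closed[OF Y] \<delta>] hg f]
      by (simp add: bmap_closed[OF B A Y Y f Id_closed[OF Y] \<delta>])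
  qed
qed

text \<open>The zero morphism factors through \<open>P A\<close>.\<close>

lemma proj_class_self:
  assumes A: "A \<in> Obj C" and B: "B \<in> Obj C" and f: "f \<in> arr C A B"
  shows "f \<in> proj_class C A B f"
proof -
  note P = P_obj[OF A]
  have z: "\<zero>\<^bsub>Hom C A (P A)\<^esub> \<in> arr C A (P A)" "\<zero>\<^bsub>Hom C (P A) B\<^esub> \<in> arr C (P A) B"
    by (rule module_zero[OF Hom_module[OF A P]] module_zero[OF Hom_module[OF P B]])+
  have "\<zero>\<^bsub>Hom C A B\<^esub> = \<zero>\<^bsub>Hom C (P A) B\<^esub> \<circledcirc> \<zero>\<^bsub>Hom C A (P A)\<^esub>"
    by (rule mod_hom_zero[OF Hom_module[OF A P] Hom_module[OF A B] cmp_linear_right[OF A P B z(2)], symmetric])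
  then have "\<zero>\<^bsub>Hom C A B\<^esub> \<in> proj_ideal C A B"
    unfolding proj_ideal_def using P_projective[OF A] z by blast
  then show ?thesis
    unfolding proj_class_def by (rule mem_coset_self[OF Hom_module[OF A B] _ f])
qed

lemma syzygy_map_eq:
  "syzygy_map C \<Omega> \<omega> A B S = (\<Union>f\<in>S. \<Union>a\<in>{a. lies_over A B f a}. proj_class C (\<Omega> A) (\<Omega> B) a)"
  by (simp add: syzygy_map_def push_def pull_def lies_over_def)

text \<open>\<open>a\<^sub>* (\<omega> A) = f\<^sup>* (\<omega> B) = f'\<^sup>* (\<omega> B) = a'\<^sub>* (\<omega> A)\<close>.\<close>

lemma lies_over_ext_equal:
  assumes A: "A \<in> Obj C" and B: "B \<in> Obj C" and eq: "ext_equal A B f f'"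
    and a: "lies_over A B f a" and a': "lies_over A B f' a'"
  shows "ext_equal (\<Omega> A) (\<Omega> B) a a'"
  unfolding ext_equal_def
proof (intro ballI)
  fix Y \<delta> assume Y: "Y \<in> Obj C" and \<delta>: "\<delta> \<in> carrier (Ext C (\<Omega> B) Y)"
  show "bmap (EE C) a (Id C Y) \<delta> = bmap (EE C) a' (Id C Y) \<delta>"
  proof (rule bmap_eq_of_classifying_eq[OF bilinear_bifunctor_axioms P_zero[OF A] A \<Omega>_obj[OF B] Y _ _ _ \<delta>])
    show "a \<in> arr C (\<Omega> A) (\<Omega> B)" "a' \<in> arr C (\<Omega> A) (\<Omega> B)"
      using a a' by (auto simp: lies_over_def)
    show "bmap (EE C) (Id C A) a (\<omega> A) = bmap (EE C) (Id C A) a' (\<omega> A)"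
      using a a' eq \<omega>_closed[OF B] \<Omega>_obj[OF B] by (simp add: lies_over_def ext_equal_def)
  qed
qed

lemma \<Omega>_pow_obj: "X \<in> Obj C \<Longrightarrow> (\<Omega> ^^ n) X \<in> Obj C"
  by (induction n) (auto simp: \<Omega>_obj)

text \<open>The functor \<open>\<Omega>\<^sup>n\<close> sends the class of \<open>c\<close> to a set of morphisms. All of them act alike on \<open>\<E>\<close>, so
  that \<open>\<E>(\<Omega>\<^sup>n -, Y)\<close> can be evaluated at any one of them.\<close>

lemma syzygy_map_pow_members:
  assumes A: "A \<in> Obj C" and B: "B \<in> Obj C" and c: "c \<in> arr C A B"
  defines "S \<equiv> \<lambda>n. syzygy_map_pow C \<Omega> \<omega> n A B (proj_class C A B c)"
  shows "S n \<noteq> {}" and "k \<in> S n \<Longrightarrow> k \<in> arr C ((\<Omega> ^^ n) A) ((\<Omega> ^^ n) B)"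
    and "k \<in> S n \<Longrightarrow> k' \<in> S n \<Longrightarrow> ext_equal ((\<Omega> ^^ n) A) ((\<Omega> ^^ n) B) k k'"
proof -
  have "S n \<noteq> {} \<and> (\<forall>k\<in>S n. k \<in> arr C ((\<Omega> ^^ n) A) ((\<Omega> ^^ n) B)) \<and>
    (\<forall>k\<in>S n. \<forall>k'\<in>S n. ext_equal ((\<Omega> ^^ n) A) ((\<Omega> ^^ n) B) k k')" for n
  proof (induction n)
    case 0
    have "S 0 = proj_class C A B c" by (simp add: S_def)
    moreover have "ext_equal A B k k'" if "k \<in> proj_class C A B c" "k' \<in> proj_class C A B c" for k k'
      using proj_class_members(2)[OF A B c that(1)] proj_class_members(2)[OF A B c that(2)]
      by (simp add: ext_equal_def)
    ultimately show ?case
      using proj_class_self[OF A B c] proj_class_members(1)[OF A B c] by auto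
  next
    case (Suc n)
    let ?A = "(\<Omega> ^^ n) A" and ?B = "(\<Omega> ^^ n) B"
    note A' = \<Omega>_pow_obj[OF A, of n] and B' = \<Omega>_pow_obj[OF B, of n]
    have S: "S (Suc n) = (\<Union>f\<in>S n. \<Union>a\<in>{a. lies_over ?A ?B f a}. proj_class C (\<Omega> ?A) (\<Omega> ?B) a)"
      by (simp add: S_def syzygy_map_eq)
    have members: "\<exists>f\<in>S n. \<exists>a. lies_over ?A ?B f a \<and> k \<in> arr C (\<Omega> ?A) (\<Omega> ?B) \<and> ext_equal (\<Omega> ?A) (\<Omega> ?B) k a"
      if kS: "k \<in> S (Suc n)" for k
    proof -
      obtain f a where fa: "f \<in> S n" "lies_over ?A ?B f a" "k \<in> proj_class C (\<Omega> ?A) (\<Omega> ?B) a"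
        using kS unfolding S by blast
      then have "a \<in> arr C (\<Omega> ?A) (\<Omega> ?B)" by (simp add: lies_over_def)
      note pm = proj_class_members[OF \<Omega>_obj[OF A'] \<Omega>_obj[OF B'] this fa(3)]
      show ?thesis by (intro bexI[OF _ fa(1)] exI[of _ a] conjI fa(2) pm)
    qed
    obtain f where f: "f \<in> S n" using Suc by blast
    have "f \<in> arr C ?A ?B" using Suc f by blast
    from lies_over_exists[OF B' A' this] obtain a where a: "lies_over ?A ?B f a" .
    then have "a \<in> arr C (\<Omega> ?A) (\<Omega> ?B)" by (simp add: lies_over_def)
    then have "a \<in> S (Suc n)"
      unfolding S using f a proj_class_self[OF \<Omega>_obj[OF A'] \<Omega>_obj[OF B']] by (intro UN_I CollectI)
    moreover have "ext_equal (\<Omega> ?A) (\<Omega> ?B) k k'" if k: "k \<in> S (Suc n)" and k': "k' \<in> S (Suc n)" for k k'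
    proof -
      obtain f a where 1: "f \<in> S n" "lies_over ?A ?B f a" "ext_equal (\<Omega> ?A) (\<Omega> ?B) k a"
        using members[OF k] by blast
      obtain f' a' where 2: "f' \<in> S n" "lies_over ?A ?B f' a'" "ext_equal (\<Omega> ?A) (\<Omega> ?B) k' a'"
        using members[OF k'] by blast
      have "ext_equal (\<Omega> ?A) (\<Omega> ?B) a a'"
        by (rule lies_over_ext_equal[OF A' B' _ 1(2) 2(2)]) (use Suc 1(1) 2(1) in blast)
      then show ?thesis using 1(3) 2(3) by (simp add: ext_equal_def)
    qed
    moreover have "k \<in> arr C ((\<Omega> ^^ Suc n) A) ((\<Omega> ^^ Suc n) B)" if "k \<in> S (Suc n)" for k
      using members[OF that] by auto
    ultimately show ?case by auto
  qed
  then show "S n \<noteq> {}" "k \<in> S n \<Longrightarrow> k \<in> arr C ((\<Omega> ^^ n) A) ((\<Omega> ^^ n) B)"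
    "k \<in> S n \<Longrightarrow> k' \<in> S n \<Longrightarrow> ext_equal ((\<Omega> ^^ n) A) ((\<Omega> ^^ n) B) k k'" by blast+
qed

lemma syzygy_ext_bmap:
  assumes A: "A \<in> Obj C" and B: "B \<in> Obj C" and Y: "Y \<in> Obj C" and Y': "Y' \<in> Obj C"
    and c: "c \<in> arr C A B" and a: "a \<in> arr C Y Y'"
    and k: "k \<in> syzygy_map_pow C \<Omega> \<omega> n A B (proj_class C A B c)"
    and \<delta>: "\<delta> \<in> carrier (Ext C ((\<Omega> ^^ n) B) Y)"
  shows "bmap (syzygy_ext C \<Omega> \<omega> n) c a \<delta> = bmap (EE C) k a \<delta>"
proof -
  let ?S = "syzygy_map_pow C \<Omega> \<omega> n A B (proj_class C A B c)"
  have st: "src C c = A" "tgt C c = B" using src_tgt[OF A B c] by auto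
  note m = syzygy_map_pow_members[OF A B c]
  have "bmap (EE C) k' a \<delta> = bmap (EE C) k a \<delta>" if k': "k' \<in> ?S" for k'
    by (rule ext_equalD[OF m(3)[OF k' k] \<Omega>_pow_obj[OF A] \<Omega>_pow_obj[OF B] m(2)[OF k'] m(2)[OF k] Y Y' a \<delta>])
  then have "(\<lambda>k. bmap (EE C) k a \<delta>) ` ?S \<subseteq> {bmap (EE C) k a \<delta>}"
    by (intro image_subsetI) simp
  moreover have "bmap (EE C) k a \<delta> \<in> (\<lambda>k. bmap (EE C) k a \<delta>) ` ?S"
    by (rule imageI[OF k])
  ultimately have "(\<lambda>k. bmap (EE C) k a \<delta>) ` ?S = {bmap (EE C) k a \<delta>}"
    by blast
  then show ?thesis by (simp add: syzygy_ext_def st)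
qed

lemma lies_over_in_syzygy_map:
  assumes f: "f \<in> S" and k: "lies_over A B f k"
  shows "proj_class C (\<Omega> A) (\<Omega> B) k \<subseteq> syzygy_map C \<Omega> \<omega> A B S"
  unfolding syzygy_map_eq using f k by blast

lemma syzygy_map_mono: "S \<subseteq> S' \<Longrightarrow> syzygy_map C \<Omega> \<omega> A B S \<subseteq> syzygy_map C \<Omega> \<omega> A B S'"
  unfolding syzygy_map_eq by blast

text \<open>In \<open>syzygy_map_pow\<close> each further \<open>\<Omega>\<close> is applied last, whereas the induction on the coends replaces
  \<open>X\<close> by \<open>\<Omega>X\<close> and so applies it first.\<close>

lemma syzygy_map_pow_shift:
  assumes A: "A \<in> Obj C" and B: "B \<in> Obj C" and c: "c \<in> arr C A B" and k: "lies_over A B c k"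
  shows "syzygy_map_pow C \<Omega> \<omega> n (\<Omega> A) (\<Omega> B) (proj_class C (\<Omega> A) (\<Omega> B) k) \<subseteq>
    syzygy_map_pow C \<Omega> \<omega> (Suc n) A B (proj_class C A B c)"
proof (induction n)
  case 0
  then show ?case using lies_over_in_syzygy_map[OF proj_class_self[OF A B c] k] by simp
next
  case (Suc n)
  show ?case
    using syzygy_map_mono[OF Suc.IH, of "(\<Omega> ^^ n) (\<Omega> A)" "(\<Omega> ^^ n) (\<Omega> B)"] by (simp add: funpow_swap1)
qed

end

section \<open>Presentations in extriangulated categories\<close>

context extriangulated_category
begin

lemma realize:
  assumes "X \<in> Obj C" "A \<in> Obj C" "\<delta> \<in> carrier (Ext C X A)"
  obtains x y B where "B \<in> Obj C" "x \<in> arr C A B" "y \<in> arr C B X" "triangle C X A \<delta> x y"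
proof -
  obtain s where s: "s \<in> seqs C A X" "realn C X A \<delta> = seq_equiv C A X `` {s}"
    using realn_class[OF assms] by (rule quotientE)
  obtain x y where "s = (x, y)" by (cases s)
  then have "triangle C X A \<delta> x y" using s assms by (simp add: triangle_def)
  moreover obtain B where "B \<in> Obj C" "x \<in> arr C A B" "y \<in> arr C B X"
    using s(1) \<open>s = (x, y)\<close> by (auto simp: seqs_def)
  ultimately show thesis using that by blast
qed

lemma biproductD:
  assumes "biproduct C A B S i j p q"
  shows "A \<in> Obj C" "B \<in> Obj C" "S \<in> Obj C" "i \<in> arr C A S" "j \<in> arr C B S" "p \<in> arr C S A" "q \<in> arr C S B"
    "p \<circledcirc> i = Id C A" "q \<circledcirc> j = Id C B"
  using assms by (auto simp: biproduct_def)

lemma triangle_objs: "triangle C X A \<delta> x y \<Longrightarrow> X \<in> Obj C \<and> A \<in> Obj C \<and> \<delta> \<in> carrier (Ext C X A)"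
  by (simp add: triangle_def)

context
  fixes X \<Omega>X PX u p \<omega>
  assumes tri: "triangle C X \<Omega>X \<omega> u p" and proj: "projective C PX"
    and u: "u \<in> arr C \<Omega>X PX" and p: "p \<in> arr C PX X"
begin

text \<open>As \<open>p\<^sup>* \<delta> = 0\<close>, comparing the split triangle on \<open>M\<close> and \<open>P\<close> with the triangle of \<open>\<delta>\<close> lifts \<open>p\<close> along the
  deflation of \<open>\<delta>\<close>. (ET3)\<open>\<^sup>o\<^sup>p\<close> completes the lift and the identity of \<open>X\<close> to a morphism
  \<open>\<omega> \<rightarrow> \<delta>\<close>, whose first component is the required \<open>a\<close>.\<close>

lemma classifying_map_exists:
  assumes M: "M \<in> Obj C" and \<delta>: "\<delta> \<in> carrier (Ext C X M)"
  shows "\<exists>a\<in>arr C \<Omega>X M. bmap (EE C) (Id C X) a \<omega> = \<delta>"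
proof -
  have X: "X \<in> Obj C" and \<Omega>: "\<Omega>X \<in> Obj C" using triangle_objs[OF tri] by auto
  have P: "PX \<in> Obj C" using proj by (simp add: projective_def)
  obtain x y B where B: "B \<in> Obj C" and x: "x \<in> arr C M B" and y: "y \<in> arr C B X" and t: "triangle C X M \<delta> x y"
    by (rule realize[OF X M \<delta>])
  obtain S i j pp q where bi: "biproduct C M PX S i j pp q" using ex_biproduct[OF M P] by blast
  note b = biproductD[OF bi]
  have "pull C M p \<delta> \<in> carrier (Ext C PX M)"
    unfolding pull_def by (rule bmap_closed[OF X P M M p Id_closed[OF M] \<delta>])
  then have "pull C M p \<delta> = \<zero>\<^bsub>Ext C PX M\<^esub>" using proj M unfolding projective_def by blast
  then have "push C PX (Id C M) \<zero>\<^bsub>Ext C PX M\<^esub> = pull C M p \<delta>"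
    unfolding push_def by (simp add: bmap_Id[OF P M module_zero[OF bval_module[OF P M]]])
  from realn_morphism[OF realn_zero[OF bi] t Id_closed[OF M] p this]
  obtain f where f: "f \<in> arr C S B" and yf: "y \<circledcirc> f = p \<circledcirc> q"
    using src_tgt[OF M b(3,4)] src_tgt[OF M B x] by auto
  have fj: "f \<circledcirc> j \<in> arr C PX B" by (rule cmp_closed[OF P b(3) B b(5) f])
  have "y \<circledcirc> (f \<circledcirc> j) = p"
    using cmp_assoc[OF P b(3) B X b(5) f y] cmp_assoc[OF P b(3) P X b(5,7) p] yf b(9) Id_right[OF P X p] by simp
  then have "Id C X \<circledcirc> p = y \<circledcirc> (f \<circledcirc> j)" using Id_left[OF P X p] by simp
  from ET3_op[OF tri t Id_closed[OF X] _ this]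
  obtain a where "a \<in> arr C \<Omega>X M" "push C X a \<omega> = pull C M (Id C X) \<delta>"
    using fj src_tgt[OF \<Omega> P u] src_tgt[OF M B x] by auto
  then show ?thesis using bmap_Id[OF X M \<delta>] by (auto simp: push_def pull_def)
qed

text \<open>The zero extension is realized by \<open>M \<rightarrow> M \<oplus> X \<rightarrow> X\<close>. A map from the triangle of \<open>\<omega>\<close> to this one,
  projected to \<open>M\<close>, extends \<open>a\<close> to \<open>P\<close>.\<close>

lemma classifying_zero_factors:
  assumes M: "M \<in> Obj C" and a: "a \<in> arr C \<Omega>X M" and z: "bmap (EE C) (Id C X) a \<omega> = \<zero>\<^bsub>Ext C X M\<^esub>"
  shows "\<exists>b\<in>arr C PX M. a = b \<circledcirc> u"
proof -
  have X: "X \<in> Obj C" and \<Omega>: "\<Omega>X \<in> Obj C" using triangle_objs[OF tri] by auto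
  have P: "PX \<in> Obj C" using proj by (simp add: projective_def)
  obtain S i j pp q where bi: "biproduct C M X S i j pp q" using ex_biproduct[OF M X] by blast
  note b = biproductD[OF bi]
  have "push C X a \<omega> = pull C M (Id C X) \<zero>\<^bsub>Ext C X M\<^esub>"
    unfolding push_def pull_def z by (simp add: bmap_Id[OF X M module_zero[OF bval_module[OF X M]]])
  from realn_morphism[OF tri realn_zero[OF bi] a Id_closed[OF X] this]
  obtain f where f: "f \<in> arr C PX S" and fu: "f \<circledcirc> u = i \<circledcirc> a"
    using src_tgt[OF \<Omega> P u] src_tgt[OF M b(3,4)] by auto
  have "a = (pp \<circledcirc> f) \<circledcirc> u"
    using cmp_assoc[OF \<Omega> P b(3) M u f b(6)] cmp_assoc[OF \<Omega> M b(3) M a b(4,6)] fu b(8) Id_left[OF \<Omega> M a] by simp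
  then show ?thesis using cmp_closed[OF P b(3) M f b(6)] by blast
qed

end

context
  fixes Y \<Sigma>Y IY v q \<sigma>
  assumes tri: "triangle C \<Sigma>Y Y \<sigma> v q" and inj: "injective C IY"
    and v: "v \<in> arr C Y IY" and q: "q \<in> arr C IY \<Sigma>Y"
begin

text \<open>The dual argument: \<open>v\<^sub>* \<delta> = 0\<close>, so \<open>v\<close> extends along the inflation of \<open>\<delta>\<close>, and (ET3) gives \<open>c\<close>.\<close>

lemma coclassifying_map_exists:
  assumes A: "A \<in> Obj C" and \<delta>: "\<delta> \<in> carrier (Ext C A Y)"
  shows "\<exists>c\<in>arr C A \<Sigma>Y. bmap (EE C) c (Id C Y) \<sigma> = \<delta>"
proof -
  have Y: "Y \<in> Obj C" and \<Sigma>: "\<Sigma>Y \<in> Obj C" using triangle_objs[OF tri] by auto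
  have I: "IY \<in> Obj C" using inj by (simp add: injective_def)
  obtain x y B where B: "B \<in> Obj C" and x: "x \<in> arr C Y B" and y: "y \<in> arr C B A" and t: "triangle C A Y \<delta> x y"
    by (rule realize[OF A Y \<delta>])
  obtain S i j pp qq where bi: "biproduct C IY A S i j pp qq" using ex_biproduct[OF I A] by blast
  note b = biproductD[OF bi]
  have "push C A v \<delta> \<in> carrier (Ext C A IY)"
    unfolding push_def by (rule bmap_closed[OF A A Y I Id_closed[OF A] v \<delta>])
  then have "push C A v \<delta> = \<zero>\<^bsub>Ext C A IY\<^esub>" using inj A unfolding injective_def by blast
  then have "push C A v \<delta> = pull C IY (Id C A) \<zero>\<^bsub>Ext C A IY\<^esub>"
    unfolding pull_def by (simp add: bmap_Id[OF A I module_zero[OF bval_module[OF A I]]])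
  from realn_morphism[OF t realn_zero[OF bi] v Id_closed[OF A] this]
  obtain f where f: "f \<in> arr C B S" and fx: "f \<circledcirc> x = i \<circledcirc> v"
    using src_tgt[OF Y B x] src_tgt[OF I b(3,4)] by auto
  have pf: "pp \<circledcirc> f \<in> arr C B IY" by (rule cmp_closed[OF B b(3) I f b(6)])
  have "(pp \<circledcirc> f) \<circledcirc> x = v"
    using cmp_assoc[OF Y B b(3) I x f b(6)] cmp_assoc[OF Y I b(3) I v b(4,6)] fx b(8) Id_left[OF Y I v] by simp
  then have "(pp \<circledcirc> f) \<circledcirc> x = v \<circledcirc> Id C Y" using Id_right[OF Y I v] by simp
  from ET3[OF t tri Id_closed[OF Y] _ this]
  obtain c where "c \<in> arr C A \<Sigma>Y" "push C A (Id C Y) \<delta> = pull C Y c \<sigma>"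
    using pf src_tgt[OF Y I v] src_tgt[OF Y B x] by auto
  then show ?thesis using bmap_Id[OF A Y \<delta>] by (auto simp: push_def pull_def)
qed

text \<open>Dually, a map from the split triangle on \<open>Y\<close> and \<open>A\<close> to the triangle of \<open>\<sigma>\<close> lifts \<open>c\<close> to \<open>I\<close>.\<close>

lemma coclassifying_zero_factors:
  assumes A: "A \<in> Obj C" and c: "c \<in> arr C A \<Sigma>Y" and z: "bmap (EE C) c (Id C Y) \<sigma> = \<zero>\<^bsub>Ext C A Y\<^esub>"
  shows "\<exists>b\<in>arr C A IY. c = q \<circledcirc> b"
proof -
  have Y: "Y \<in> Obj C" and \<Sigma>: "\<Sigma>Y \<in> Obj C" using triangle_objs[OF tri] by auto
  have I: "IY \<in> Obj C" using inj by (simp add: injective_def)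
  obtain S i j pp qq where bi: "biproduct C Y A S i j pp qq" using ex_biproduct[OF Y A] by blast
  note b = biproductD[OF bi]
  have "push C A (Id C Y) \<zero>\<^bsub>Ext C A Y\<^esub> = pull C Y c \<sigma>"
    unfolding push_def pull_def z by (simp add: bmap_Id[OF A Y module_zero[OF bval_module[OF A Y]]])
  from realn_morphism[OF realn_zero[OF bi] tri Id_closed[OF Y] c this]
  obtain f where f: "f \<in> arr C S IY" and qf: "q \<circledcirc> f = c \<circledcirc> qq"
    using src_tgt[OF Y I v] src_tgt[OF Y b(3,4)] by auto
  have "c = q \<circledcirc> (f \<circledcirc> j)"
    using cmp_assoc[OF A b(3) I \<Sigma> b(5) f q] cmp_assoc[OF A b(3) A \<Sigma> b(5,7) c] qf b(9) Id_right[OF A \<Sigma> c] by simp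
  then show ?thesis using cmp_closed[OF A b(3) I b(5) f] by blast
qed

end

end

section \<open>The opposite category\<close>

text \<open>The dual of all of the data, including \<open>\<E>\<close>: the syzygies of the opposite category are then the
  cosyzygies of \<open>C\<close>, and statements about \<open>\<Omega>\<close> apply to \<open>\<Sigma>\<close>.\<close>

definition op_cat :: "('r, 'o, 'a, 'e, 'z) ext_cat_scheme \<Rightarrow> ('r, 'o, 'a, 'e) ext_cat"
  where "op_cat C = \<lparr>Obj = Obj C, Hom = (\<lambda>A B. Hom C B A), src = tgt C, tgt = src C, Id = Id C,
    cmp = (\<lambda>g f. cmp C f g), EE = \<lparr>bval = (\<lambda>X Y. Ext C Y X), bmap = (\<lambda>c a. bmap (EE C) a c)\<rparr>,
    realn = (\<lambda>X A \<delta>. prod.swap ` realn C A X \<delta>)\<rparr>"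

lemma op_cat_simps [simp]:
  "Obj (op_cat C) = Obj C" "Hom (op_cat C) A B = Hom C B A" "src (op_cat C) = tgt C" "tgt (op_cat C) = src C"
  "Id (op_cat C) = Id C" "cmp (op_cat C) g f = cmp C f g" "Ext (op_cat C) X Y = Ext C Y X"
  "bmap (EE (op_cat C)) c a = bmap (EE C) a c"
  by (simp_all add: op_cat_def)

lemma op_linear_category:
  assumes "linear_category R C" shows "linear_category R (op_cat C)"
proof -
  interpret linear_category R C by fact
  show ?thesis
    by (intro linear_category.intro linear_category_axioms.intro)
      (simp_all add: cring_axioms Hom_module src_tgt Id_closed cmp_closed cmp_assoc Id_left Id_right
        cmp_linear_left cmp_linear_right)
qed

lemma op_bilinear_bifunctor:
  assumes "bilinear_bifunctor R C (EE C)" shows "bilinear_bifunctor R (op_cat C) (EE (op_cat C))"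
proof -
  interpret bilinear_bifunctor R C "EE C" by fact
  show ?thesis
  proof (intro bilinear_bifunctor.intro bilinear_bifunctor_axioms.intro, unfold op_cat_simps)
    show "linear_category R (op_cat C)" by (rule op_linear_category[OF linear_category_axioms])
  qed (rule bval_module bmap_hom bmap_Id bmap_cmp bmap_linear_left bmap_linear_right; assumption)+
qed

lemma op_projective [simp]: "projective (op_cat C) = injective C"
  by (auto simp: projective_def injective_def fun_eq_iff)

lemma op_proj_class: "proj_class (op_cat C) A B f = inj_class C B A f"
proof -
  have "proj_ideal (op_cat C) A B = inj_ideal C B A"
    unfolding proj_ideal_def inj_ideal_def op_cat_simps op_projective by blast
  then show ?thesis by (simp add: proj_class_def inj_class_def)
qed

lemma op_syzygy_map: "syzygy_map (op_cat C) \<Sigma> \<sigma> A B S = cosyzygy_map C \<Sigma> \<sigma> B A S"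
  by (simp add: syzygy_map_def cosyzygy_map_def op_proj_class push_def pull_def eq_commute)

lemma op_syzygy_map_pow: "syzygy_map_pow (op_cat C) \<Sigma> \<sigma> n A B S = cosyzygy_map_pow C \<Sigma> \<sigma> n B A S"
  by (induction n) (simp_all add: op_syzygy_map)

lemma op_syzygy_ext: "bmap (syzygy_ext (op_cat C) \<Sigma> \<sigma> n) a c = bmap (cosyzygy_ext C \<Sigma> \<sigma> n) c a"
  by (simp add: syzygy_ext_def cosyzygy_ext_def op_syzygy_map_pow op_proj_class)

section \<open>Higher extensions\<close>

text \<open>The code of \<open>K\<close> is a list from which \<open>K\<close> is recovered as a sum.\<close>

lemma hext_code_inj:
  fixes C :: "('r, 'o, 'a, 'e, 'z) ext_cat_scheme"
  assumes E: "bilinear_bifunctor R C (EE C)"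
    and F: "bilinear_bifunctor R C (F :: ('r, 'o, 'a, ('o, 'e) hext) bifunctor)"
    and X: "X \<in> Obj C" and Y: "Y \<in> Obj C"
  shows "inj_on (hext_code R C F X Y) (carrier (bval (coend_comp R C F (EE C)) X Y))"
proof -
  interpret bifunctor_pair R C F "EE C" by (rule bifunctor_pair.intro[OF F E])
  let ?ok = "\<lambda>l K. (\<forall>(M, \<xi>, \<delta>)\<in>set l. M \<in> Obj C \<and> \<xi> \<in> carrier (bval F M Y) \<and> \<delta> \<in> carrier (Ext C X M)) \<and>
    coend_sum_list R C F (EE C) X Y l = K"
  have ok: "?ok (SOME l. ?ok l K) K" if "K \<in> carrier (bval (coend_comp R C F (EE C)) X Y)" for K
    by (rule someI_ex[OF coend_sum_list_surj[OF X Y that]])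
  show ?thesis
  proof (rule inj_onI)
    fix K L assume K: "K \<in> carrier (bval (coend_comp R C F (EE C)) X Y)"
      and L: "L \<in> carrier (bval (coend_comp R C F (EE C)) X Y)"
      and eq: "hext_code R C F X Y K = hext_code R C F X Y L"
    have "(SOME l. ?ok l K) = (SOME l. ?ok l L)" using eq by (simp add: hext_code_def)
    then show "K = L" using conjunct2[OF ok[OF K]] conjunct2[OF ok[OF L]] by simp
  qed
qed

lemma higher_ext_Suc_bilinear:
  assumes E: "bilinear_bifunctor R C (EE C)"
  shows "bilinear_bifunctor R C (higher_ext_Suc R C k)"
proof (induction k)
  case 0
  show ?case by (simp, rule transport_bifunctor_iso(1)[OF E]) (auto intro: inj_onI)
next
  case (Suc k)
  interpret bifunctor_pair R C "higher_ext_Suc R C k" "EE C" by (rule bifunctor_pair.intro[OF Suc E])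
  show ?case
    by (simp add: Let_def, rule transport_bifunctor_iso(1)[OF coend_comp_bilinear hext_code_inj[OF E Suc]])
qed

lemma iso_carrier_zero:
  assumes "module R M" "module R N" "h \<in> mod_iso R M N" "carrier M = {\<zero>\<^bsub>M\<^esub>}"
  shows "carrier N = {\<zero>\<^bsub>N\<^esub>}"
proof -
  have "carrier N = h ` carrier M" using assms(3) by (simp add: mod_iso_def bij_betw_def)
  then show ?thesis using assms(4) mod_hom_zero[OF assms(1,2) mod_iso_hom[OF assms(3)]] by simp
qed

text \<open>In a generator \<open>\<xi> \<otimes> \<delta>\<close> the factor \<open>\<delta> \<in> \<E>(P, M)\<close> is zero.\<close>

lemma higher_ext_Suc_projective:
  assumes E: "bilinear_bifunctor R C (EE C)" and P: "projective C P" and Y: "Y \<in> Obj C"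
  shows "carrier (bval (higher_ext_Suc R C k) P Y) = {\<zero>\<^bsub>bval (higher_ext_Suc R C k) P Y\<^esub>}"
proof -
  interpret E: bilinear_bifunctor R C "EE C" by (rule E)
  have Po: "P \<in> Obj C" and P0: "\<And>M. M \<in> Obj C \<Longrightarrow> carrier (Ext C P M) = {\<zero>\<^bsub>Ext C P M\<^esub>}"
    using P by (auto simp: projective_def)
  have mod: "module R (bval (higher_ext_Suc R C k) P Y)" for k
    by (rule bilinear_bifunctor.bval_module[OF higher_ext_Suc_bilinear[OF E] Po Y])
  show ?thesis
  proof (cases k)
    case 0
    have "inj_on Base (carrier (Ext C X Y))" for X Y by (auto intro: inj_onI)
    from transport_bifunctor_iso(2)[OF E, of "\<lambda>_ _. Base", OF this Po Y]
    have "Base \<in> mod_iso R (Ext C P Y) (bval (higher_ext_Suc R C 0) P Y)" by simp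
    from iso_carrier_zero[OF E.bval_module[OF Po Y] mod this P0[OF Y]] show ?thesis by (simp add: 0)
  next
    case (Suc j)
    let ?F = "higher_ext_Suc R C j"
    note F = higher_ext_Suc_bilinear[OF E, of j]
    interpret bifunctor_pair R C ?F "EE C" by (rule bifunctor_pair.intro[OF F E])
    let ?E = "bval (coend_comp R C ?F (EE C)) P Y"
    note m = coend_comp_module[OF Po Y]
    have "cotensor P Y M \<xi> \<delta> = \<zero>\<^bsub>?E\<^esub>"
      if M: "M \<in> Obj C" and \<xi>: "\<xi> \<in> carrier (bval ?F M Y)" and \<delta>: "\<delta> \<in> carrier (Ext C P M)" for M \<xi> \<delta>
    proof -
      have "\<delta> = \<zero>\<^bsub>Ext C P M\<^esub>" using P0[OF M] \<delta> by blast
      then show ?thesis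
        using mod_hom_zero[OF E.bval_module[OF Po M] m bilinearD(2)[OF cotensor_bilinear[OF Po Y M] \<xi>]] by simp
    qed
    then have "carrier ?E \<subseteq> {\<zero>\<^bsub>?E\<^esub>}"
      by (intro subset_trans[OF cotensor_generated[OF Po Y]] mod_span_least submodule_singleton_zero[OF m]) blast
    then have "carrier ?E = {\<zero>\<^bsub>?E\<^esub>}" using module_zero[OF m] by blast
    moreover have "hext_code R C ?F P Y \<in> mod_iso R ?E (bval (higher_ext_Suc R C (Suc j)) P Y)"
      using transport_bifunctor_iso(2)[OF coend_comp_bilinear hext_code_inj[OF E F] Po Y] by (simp add: Let_def)
    ultimately show ?thesis
      using iso_carrier_zero[OF m mod, of "hext_code R C ?F P Y" "Suc j"] by (simp add: Suc)
  qed
qed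

context ext_presentation
begin

lemma higher_ext_Suc_zero: "bifunctor_iso R C (higher_ext_Suc R C 0) (syzygy_ext C \<Omega> \<omega> 0)"
proof -
  let ?B = "Base :: 'e \<Rightarrow> ('o, 'e) hext"
  have inj: "inj_on ?B (carrier (Ext C X Y))" for X Y by (auto intro: inj_onI)
  note T = transport_bifunctor_iso[OF bilinear_bifunctor_axioms, of "\<lambda>_ _. ?B", OF inj]
  define \<eta> where "\<eta> X Y = inv_into (carrier (Ext C X Y)) ?B" for X Y
  show ?thesis
    unfolding bifunctor_iso_def
  proof (intro exI[of _ \<eta>] conjI ballI)
    fix X Y assume XY: "X \<in> Obj C" "Y \<in> Obj C"
    show "\<eta> X Y \<in> mod_iso R (bval (higher_ext_Suc R C 0) X Y) (bval (syzygy_ext C \<Omega> \<omega> 0) X Y)"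
      using mod_iso_inv[OF bval_module[OF XY] T(2)[OF XY]] by (simp add: \<eta>_def syzygy_ext_def)
  next
    fix X X' Y Y' c a \<xi>
    assume o: "X \<in> Obj C" "X' \<in> Obj C" "Y \<in> Obj C" "Y' \<in> Obj C" and c: "c \<in> arr C X' X" and a: "a \<in> arr C Y Y'"
      and "\<xi> \<in> carrier (bval (higher_ext_Suc R C 0) X Y)"
    then obtain \<delta> where \<delta>: "\<delta> \<in> carrier (Ext C X Y)" "\<xi> = Base \<delta>"
      by (auto simp: transport_bifunctor_def transport_module_def Let_def)
    have "bmap (syzygy_ext C \<Omega> \<omega> 0) c a \<delta> = bmap (EE C) c a \<delta>"
      by (rule syzygy_ext_bmap[OF o(2,1,3,4) c a]) (simp_all add: \<delta> proj_class_self[OF o(2,1) c])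
    then show "\<eta> X' Y' (bmap (higher_ext_Suc R C 0) c a \<xi>) = bmap (syzygy_ext C \<Omega> \<omega> 0) c a (\<eta> X Y \<xi>)"
      using T(3)[OF o c a \<delta>(1)] bmap_closed[OF o c a \<delta>(1)]
      by (simp add: \<eta>_def \<delta> inv_into_f_f[OF inj])
  qed
qed

text \<open>\<open>\<E>\<^sup>k\<^sup>+\<^sup>2(X, Y) \<cong> \<E>\<^sup>k\<^sup>+\<^sup>1(\<Omega>X, Y) \<cong> \<E>(\<Omega>\<^sup>k\<Omega>X, Y)\<close>, where the first isomorphism is \<open>coend_eval\<close> for \<open>F = \<E>\<^sup>k\<^sup>+\<^sup>1\<close>.\<close>

lemma higher_ext_Suc_step:
  assumes IH: "bifunctor_iso R C (higher_ext_Suc R C k) (syzygy_ext C \<Omega> \<omega> k)"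
  shows "bifunctor_iso R C (higher_ext_Suc R C (Suc k)) (syzygy_ext C \<Omega> \<omega> (Suc k))"
proof -
  note E = bilinear_bifunctor_axioms
  let ?F = "higher_ext_Suc R C k"
  let ?K = "coend_comp R C ?F (EE C)"
  let ?S = "syzygy_ext C \<Omega> \<omega> k" and ?S' = "syzygy_ext C \<Omega> \<omega> (Suc k)"
  note F = higher_ext_Suc_bilinear[OF E, of k]
  interpret presented_pair R C "EE C" \<Omega> P u \<omega> ?F
    by (intro presented_pair.intro presented_pair_axioms.intro projective_presentation_axioms F
        higher_ext_Suc_projective[OF E P_projective])
  have T_iso: "hext_code R C ?F X Y \<in> mod_iso R (bval ?K X Y) (bval (transport_bifunctor C (hext_code R C ?F) ?K) X Y)"
    if "X \<in> Obj C" "Y \<in> Obj C" for X Y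
    by (rule transport_bifunctor_iso(2)[OF pair.coend_comp_bilinear hext_code_inj[OF E F] that])
  have T_bmap: "bmap (transport_bifunctor C (hext_code R C ?F) ?K) c a (hext_code R C ?F X Y \<xi>) =
      hext_code R C ?F X' Y' (bmap ?K c a \<xi>)"
    if "X \<in> Obj C" "X' \<in> Obj C" "Y \<in> Obj C" "Y' \<in> Obj C" "c \<in> arr C X' X" "a \<in> arr C Y Y'"
      "\<xi> \<in> carrier (bval ?K X Y)" for X X' Y Y' c a \<xi>
    by (rule transport_bifunctor_iso(3)[OF pair.coend_comp_bilinear hext_code_inj[OF E F] that])
  have Suc_eq: "higher_ext_Suc R C (Suc k) = transport_bifunctor C (hext_code R C ?F) ?K"
    by (simp add: Let_def)
  obtain \<eta> where \<eta>: "\<And>X Y. X \<in> Obj C \<Longrightarrow> Y \<in> Obj C \<Longrightarrow> \<eta> X Y \<in> mod_iso R (bval ?F X Y) (bval ?S X Y)"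
    and \<eta>nat: "\<And>X X' Y Y' c a \<xi>. X \<in> Obj C \<Longrightarrow> X' \<in> Obj C \<Longrightarrow> Y \<in> Obj C \<Longrightarrow> Y' \<in> Obj C \<Longrightarrow> c \<in> arr C X' X \<Longrightarrow>
      a \<in> arr C Y Y' \<Longrightarrow> \<xi> \<in> carrier (bval ?F X Y) \<Longrightarrow> \<eta> X' Y' (bmap ?F c a \<xi>) = bmap ?S c a (\<eta> X Y \<xi>)"
    using IH unfolding bifunctor_iso_def by blast
  define good where "good X Y \<theta> \<longleftrightarrow> \<theta> \<in> mod_iso R (bval ?K X Y) (bval ?F (\<Omega> X) Y) \<and>
    (\<forall>M\<in>Obj C. \<forall>\<xi>\<in>carrier (bval ?F M Y). \<forall>a\<in>arr C (\<Omega> X) M.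
      \<theta> (pair.cotensor X Y M \<xi> (bmap (EE C) (Id C X) a (\<omega> X))) = bmap ?F a (Id C Y) \<xi>)" for X Y \<theta>
  define \<theta> where "\<theta> X Y = (SOME \<theta>. good X Y \<theta>)" for X Y
  have good: "good X Y (\<theta> X Y)" if "X \<in> Obj C" "Y \<in> Obj C" for X Y
    unfolding \<theta>_def by (rule someI_ex[where P = "good X Y"]) (use coend_eval[OF that] in \<open>unfold good_def, blast\<close>)
  have \<theta>: "\<theta> X Y \<in> mod_iso R (bval ?K X Y) (bval ?F (\<Omega> X) Y)" if "X \<in> Obj C" "Y \<in> Obj C" for X Y
    using good[OF that] by (simp add: good_def)
  have \<theta>c: "\<theta> X Y (pair.cotensor X Y M \<xi> (bmap (EE C) (Id C X) a (\<omega> X))) = bmap ?F a (Id C Y) \<xi>"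
    if "X \<in> Obj C" "Y \<in> Obj C" "M \<in> Obj C" "\<xi> \<in> carrier (bval ?F M Y)" "a \<in> arr C (\<Omega> X) M" for X Y M \<xi> a
    using good[OF that(1,2)] that(3-5) by (simp add: good_def)
  define \<zeta> where "\<zeta> X Y \<xi> = \<eta> (\<Omega> X) Y (\<theta> X Y (inv_into (carrier (bval ?K X Y)) (hext_code R C ?F X Y) \<xi>))" for X Y \<xi>
  have S': "bval ?S' X Y = bval ?S (\<Omega> X) Y" for X Y
    by (simp add: syzygy_ext_def funpow_swap1)
  show ?thesis
    unfolding bifunctor_iso_def
  proof (intro exI[of _ \<zeta>] conjI ballI)
    fix X Y assume XY: "X \<in> Obj C" "Y \<in> Obj C"
    show "\<zeta> X Y \<in> mod_iso R (bval (higher_ext_Suc R C (Suc k)) X Y) (bval ?S' X Y)"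
      unfolding \<zeta>_def[abs_def] S' Suc_eq
      by (rule mod_iso_comp[OF mod_iso_comp[OF mod_iso_inv[OF pair.coend_comp_module[OF XY] T_iso[OF XY]] \<theta>[OF XY]]
            \<eta>[OF \<Omega>_obj[OF XY(1)] XY(2)]])
  next
    fix X X' Y Y' c a \<xi>
    assume o: "X \<in> Obj C" "X' \<in> Obj C" "Y \<in> Obj C" "Y' \<in> Obj C" and c: "c \<in> arr C X' X" and a: "a \<in> arr C Y Y'"
      and \<xi>: "\<xi> \<in> carrier (bval (higher_ext_Suc R C (Suc k)) X Y)"
    note \<Omega> = \<Omega>_obj[OF o(1)] and \<Omega>' = \<Omega>_obj[OF o(2)]
    let ?h = "hext_code R C ?F"
    obtain K where K: "K \<in> carrier (bval ?K X Y)" "\<xi> = ?h X Y K"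
      using \<xi> unfolding Suc_eq by (auto simp: transport_bifunctor_def transport_module_def Let_def)
    have inv: "inv_into (carrier (bval ?K X Y)) (?h X Y) (?h X Y K) = K"
      if "X \<in> Obj C" "Y \<in> Obj C" "K \<in> carrier (bval ?K X Y)" for X Y K
      using hext_code_inj[OF E F that(1,2)] that(3) by simp
    obtain l where l: "lies_over X' X c l" by (rule lies_over_exists[OF o(1,2) c])
    have l': "l \<in> arr C (\<Omega> X') (\<Omega> X)" using l by (simp add: lies_over_def)
    obtain m where m: "m \<in> syzygy_map_pow C \<Omega> \<omega> k (\<Omega> X') (\<Omega> X) (proj_class C (\<Omega> X') (\<Omega> X) l)"
      using syzygy_map_pow_members(1)[OF \<Omega>' \<Omega> l'] by blast
    have m': "m \<in> syzygy_map_pow C \<Omega> \<omega> (Suc k) X' X (proj_class C X' X c)"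
      using syzygy_map_pow_shift[OF o(2,1) c l] m by blast
    have \<theta>K: "\<theta> X Y K \<in> carrier (bval ?F (\<Omega> X) Y)"
      by (rule mod_hom_closed[OF mod_iso_hom[OF \<theta>[OF o(1,3)]] K(1)])
    have \<eta>K: "\<eta> (\<Omega> X) Y (\<theta> X Y K) \<in> carrier (bval ?S (\<Omega> X) Y)"
      by (rule mod_hom_closed[OF mod_iso_hom[OF \<eta>[OF \<Omega> o(3)]] \<theta>K])
    have \<eta>K': "\<eta> (\<Omega> X) Y (\<theta> X Y K) \<in> carrier (Ext C ((\<Omega> ^^ k) (\<Omega> X)) Y)"
      using \<eta>K by (simp add: syzygy_ext_def)
    have "\<zeta> X' Y' (bmap (higher_ext_Suc R C (Suc k)) c a \<xi>) = \<eta> (\<Omega> X') Y' (\<theta> X' Y' (bmap ?K c a K))"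
      unfolding Suc_eq K(2) T_bmap[OF o c a K(1)] \<zeta>_def
      using inv[OF o(2,4) mod_hom_closed[OF pair.coend_comp_bmap(1)[OF o c a] K(1)]] by simp
    also have "\<theta> X' Y' (bmap ?K c a K) = bmap ?F l a (\<theta> X Y K)"
      by (rule coend_eval_natural[OF o c a l mod_iso_hom[OF \<theta>[OF o(1,3)]] \<theta>c[OF o(1,3)]
            mod_iso_hom[OF \<theta>[OF o(2,4)]] \<theta>c[OF o(2,4)] K(1)])
    also have "\<eta> (\<Omega> X') Y' (bmap ?F l a (\<theta> X Y K)) = bmap ?S l a (\<eta> (\<Omega> X) Y (\<theta> X Y K))"
      by (rule \<eta>nat[OF \<Omega> \<Omega>' o(3,4) l' a \<theta>K])
    also have "\<dots> = bmap (EE C) m a (\<eta> (\<Omega> X) Y (\<theta> X Y K))"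
      by (rule syzygy_ext_bmap[OF \<Omega>' \<Omega> o(3,4) l' a m \<eta>K'])
    also have "\<dots> = bmap ?S' c a (\<eta> (\<Omega> X) Y (\<theta> X Y K))"
      by (rule syzygy_ext_bmap[OF o(2,1,3,4) c a m', symmetric])
        (use \<eta>K' in \<open>simp add: funpow_swap1\<close>)
    also have "\<eta> (\<Omega> X) Y (\<theta> X Y K) = \<zeta> X Y \<xi>"
      unfolding \<zeta>_def K(2) inv[OF o(1,3) K(1)] ..
    finally show "\<zeta> X' Y' (bmap (higher_ext_Suc R C (Suc k)) c a \<xi>) = bmap ?S' c a (\<zeta> X Y \<xi>)" .
  qed
qed

lemma higher_ext_Suc_iso: "bifunctor_iso R C (higher_ext_Suc R C k) (syzygy_ext C \<Omega> \<omega> k)"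
  by (induction k) (use higher_ext_Suc_zero higher_ext_Suc_step in blast)+

end

section \<open>Balancing\<close>

text \<open>In the opposite category the triangle \<open>Y \<rightarrow> I Y \<rightarrow> \<Sigma>Y\<close> reads \<open>\<Sigma>Y \<rightarrow> I Y \<rightarrow> Y\<close>, so it is the deflation \<open>q\<close>
  that takes the place of \<open>u\<close>.\<close>

locale balanced_presentation = proj: ext_presentation R C \<Omega> P u \<omega> +
    inj: ext_presentation R "op_cat C" \<Sigma> I q \<sigma>
  for R :: "('r, 'k) ring_scheme" and C :: "('r, 'o, 'a, 'e, 'z) ext_cat_scheme" (structure)
    and \<Omega> P u \<omega> \<Sigma> I q \<sigma>
begin

lemma I_zero: "X \<in> Obj C \<Longrightarrow> Y \<in> Obj C \<Longrightarrow> carrier (Ext C X (I Y)) = {\<zero>\<^bsub>Ext C X (I Y)\<^esub>}"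
  using inj.P_zero[of Y X] by simp

lemma syzygy_objs: "X \<in> Obj C \<Longrightarrow> \<Omega> X \<in> Obj C" "X \<in> Obj C \<Longrightarrow> P X \<in> Obj C"
    "Y \<in> Obj C \<Longrightarrow> \<Sigma> Y \<in> Obj C" "Y \<in> Obj C \<Longrightarrow> I Y \<in> Obj C"
  using proj.\<Omega>_obj proj.P_obj inj.\<Omega>_obj inj.P_obj by simp_all

text \<open>Morphisms \<open>a : \<Omega>X \<rightarrow> \<Sigma>Y\<close> map onto both modules. If \<open>a\<^sup>* (\<sigma> Y) = 0\<close>, then \<open>a\<close> factors through \<open>I Y\<close> and
  \<open>a\<^sub>* (\<omega> X) = 0\<close> because \<open>\<E>(X, I Y) = 0\<close>. If \<open>a\<^sub>* (\<omega> X) = 0\<close>, then \<open>a\<close> factors through \<open>P X\<close> and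
  \<open>a\<^sup>* (\<sigma> Y) = 0\<close> because \<open>\<E>(P X, Y) = 0\<close>. So the two maps have the same kernel.\<close>

lemma dimension_shift:
  assumes X: "X \<in> Obj C" and Y: "Y \<in> Obj C"
  shows "\<exists>\<phi>\<in>mod_iso R (Ext C (\<Omega> X) Y) (Ext C X (\<Sigma> Y)). \<forall>a\<in>arr C (\<Omega> X) (\<Sigma> Y).
    \<phi> (bmap (EE C) a (Id C Y) (\<sigma> Y)) = bmap (EE C) (Id C X) a (\<omega> X)"
proof -
  note o = syzygy_objs(1,2)[OF X] syzygy_objs(3,4)[OF Y] and Ic = proj.Id_closed
  have w: "\<omega> X \<in> carrier (Ext C X (\<Omega> X))" and s: "\<sigma> Y \<in> carrier (Ext C (\<Sigma> Y) Y)"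
    using proj.\<omega>_closed[OF X] inj.\<omega>_closed[of Y] Y by simp_all
  have u: "u X \<in> arr C (\<Omega> X) (P X)" and q: "q Y \<in> arr C (I Y) (\<Sigma> Y)"
    using proj.u_arr[OF X] inj.u_arr[of Y] Y by simp_all
  let ?\<alpha> = "\<lambda>a. bmap (EE C) a (Id C Y) (\<sigma> Y)" and ?\<beta> = "\<lambda>a. bmap (EE C) (Id C X) a (\<omega> X)"
  have surj\<alpha>: "carrier (Ext C (\<Omega> X) Y) \<subseteq> ?\<alpha> ` arr C (\<Omega> X) (\<Sigma> Y)"
    using inj.classify[of Y "\<Omega> X"] Y o(1) by force
  have surj\<beta>: "carrier (Ext C X (\<Sigma> Y)) \<subseteq> ?\<beta> ` arr C (\<Omega> X) (\<Sigma> Y)"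
    using proj.classify[OF X o(3)] by force
  have ker: "?\<alpha> a = \<zero>\<^bsub>Ext C (\<Omega> X) Y\<^esub> \<longleftrightarrow> ?\<beta> a = \<zero>\<^bsub>Ext C X (\<Sigma> Y)\<^esub>" if a: "a \<in> arr C (\<Omega> X) (\<Sigma> Y)" for a
  proof
    assume "?\<alpha> a = \<zero>\<^bsub>Ext C (\<Omega> X) Y\<^esub>"
    then obtain b where b: "b \<in> arr C (\<Omega> X) (I Y)" "a = q Y \<circledcirc> b"
      using inj.factor[of Y "\<Omega> X" a] Y o(1) a by auto
    have "bmap (EE C) (Id C X) b (\<omega> X) = \<zero>\<^bsub>Ext C X (I Y)\<^esub>"
      using proj.bmap_closed[OF X X o(1,4) Ic[OF X] b(1) w] I_zero[OF X Y] by blast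
    then show "?\<beta> a = \<zero>\<^bsub>Ext C X (\<Sigma> Y)\<^esub>"
      unfolding b(2) proj.bmap_cmp_right[OF X o(1,4,3) b(1) q w]
      by (simp add: proj.bmap_zero[OF X X o(4,3) Ic[OF X] q])
  next
    assume "?\<beta> a = \<zero>\<^bsub>Ext C X (\<Sigma> Y)\<^esub>"
    then obtain b where b: "b \<in> arr C (P X) (\<Sigma> Y)" "a = b \<circledcirc> u X"
      using proj.factor[OF X o(3) a] by blast
    have "bmap (EE C) b (Id C Y) (\<sigma> Y) = \<zero>\<^bsub>Ext C (P X) Y\<^esub>"
      using proj.bmap_closed[OF o(3,2) Y Y b(1) Ic[OF Y] s] proj.P_zero[OF X Y] by blast
    then show "?\<alpha> a = \<zero>\<^bsub>Ext C (\<Omega> X) Y\<^esub>"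
      unfolding b(2) proj.bmap_cmp_left[OF o(3,2,1) Y b(1) u s]
      by (simp add: proj.bmap_zero[OF o(2,1) Y Y u Ic[OF Y]])
  qed
  obtain \<phi> where "\<phi> \<in> mod_iso R (Ext C (\<Omega> X) Y) (Ext C X (\<Sigma> Y))"
      "\<And>a. a \<in> arr C (\<Omega> X) (\<Sigma> Y) \<Longrightarrow> \<phi> (?\<alpha> a) = ?\<beta> a"
    using iso_of_same_kernel[OF proj.Hom_module[OF o(1,3)] proj.bval_module[OF o(1) Y] proj.bval_module[OF X o(3)]
        proj.bmap_linear_left[OF o(3,1) Y Y Ic[OF Y] s] proj.bmap_linear_right[OF X X o(1,3) Ic[OF X] w]
        surj\<alpha> surj\<beta> ker] by blast
  then show ?thesis by blast
qed

text \<open>For \<open>\<delta> = a\<^sup>* (\<sigma> Y)\<close> both sides are \<open>(l \<circledcirc> a \<circledcirc> k)\<^sub>* (\<omega> X')\<close>.\<close>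

lemma dimension_shift_natural:
  assumes o: "X \<in> Obj C" "X' \<in> Obj C" "Y \<in> Obj C" "Y' \<in> Obj C"
    and c: "c \<in> arr C X' X" and b: "b \<in> arr C Y Y'"
    and k: "proj.lies_over X' X c k" and l: "inj.lies_over Y' Y b l"
    and \<phi>: "\<And>a. a \<in> arr C (\<Omega> X) (\<Sigma> Y) \<Longrightarrow>
      \<phi> (bmap (EE C) a (Id C Y) (\<sigma> Y)) = bmap (EE C) (Id C X) a (\<omega> X)"
    and \<phi>': "\<And>a. a \<in> arr C (\<Omega> X') (\<Sigma> Y') \<Longrightarrow>
      \<phi>' (bmap (EE C) a (Id C Y') (\<sigma> Y')) = bmap (EE C) (Id C X') a (\<omega> X')"
    and \<delta>: "\<delta> \<in> carrier (Ext C (\<Omega> X) Y)"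
  shows "\<phi>' (bmap (EE C) k b \<delta>) = bmap (EE C) c l (\<phi> \<delta>)"
proof -
  note \<Omega> = syzygy_objs(1)[OF o(1)] and \<Omega>' = syzygy_objs(1)[OF o(2)] and \<Sigma> = syzygy_objs(3)[OF o(3)] and \<Sigma>' = syzygy_objs(3)[OF o(4)]
  have w: "\<omega> X \<in> carrier (Ext C X (\<Omega> X))" and s: "\<sigma> Y \<in> carrier (Ext C (\<Sigma> Y) Y)"
    and s': "\<sigma> Y' \<in> carrier (Ext C (\<Sigma> Y') Y')"
    using proj.\<omega>_closed[OF o(1)] inj.\<omega>_closed o(3,4) by simp_all
  have k': "k \<in> arr C (\<Omega> X') (\<Omega> X)" using k by (simp add: proj.lies_over_def)
  have l': "l \<in> arr C (\<Sigma> Y) (\<Sigma> Y')" using l by (simp add: inj.lies_over_def)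
  obtain a where a: "a \<in> arr C (\<Omega> X) (\<Sigma> Y)" "\<delta> = bmap (EE C) a (Id C Y) (\<sigma> Y)"
    using inj.classify[of Y "\<Omega> X" \<delta>] o \<Omega> \<delta> by auto
  note ak = proj.cmp_closed[OF \<Omega>' \<Omega> \<Sigma> k' a(1)] and la = proj.cmp_closed[OF \<Omega> \<Sigma> \<Sigma>' a(1) l']
  have lak: "l \<circledcirc> a \<circledcirc> k \<in> arr C (\<Omega> X') (\<Sigma> Y')" by (rule proj.cmp_closed[OF \<Omega>' \<Omega> \<Sigma>' k' la])
  have "bmap (EE C) (Id C (\<Omega> X)) b \<delta> = bmap (EE C) (l \<circledcirc> a) (Id C Y') (\<sigma> Y')"
    using inj.pull_of_classified[of Y Y' "\<Omega> X" b l a] o \<Omega> b l a by simp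
  then have "bmap (EE C) k b \<delta> = bmap (EE C) k (Id C Y') (bmap (EE C) (l \<circledcirc> a) (Id C Y') (\<sigma> Y'))"
    using proj.bmap_split_left[OF \<Omega> \<Omega>' o(3,4) k' b \<delta>] by simp
  also have "\<dots> = bmap (EE C) (l \<circledcirc> a \<circledcirc> k) (Id C Y') (\<sigma> Y')"
    by (rule proj.bmap_cmp_left[OF \<Sigma>' \<Omega> \<Omega>' o(4) la k' s', symmetric])
  finally have "\<phi>' (bmap (EE C) k b \<delta>) = bmap (EE C) (Id C X') (l \<circledcirc> a \<circledcirc> k) (\<omega> X')"
    using \<phi>'[OF lak] by simp
  also have "\<dots> = bmap (EE C) c (Id C (\<Sigma> Y')) (bmap (EE C) (Id C X) (l \<circledcirc> a) (\<omega> X))"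
    by (rule proj.pull_of_classified[OF o(1,2) \<Sigma>' c k la, symmetric])
  also have "\<dots> = bmap (EE C) c (Id C (\<Sigma> Y')) (bmap (EE C) (Id C X) l (\<phi> \<delta>))"
    unfolding proj.bmap_cmp_right[OF o(1) \<Omega> \<Sigma> \<Sigma>' a(1) l' w] a(2) \<phi>[OF a(1)] ..
  also have "\<dots> = bmap (EE C) c l (\<phi> \<delta>)"
    unfolding a(2) \<phi>[OF a(1)]
    by (rule proj.bmap_split_left[OF o(1,2) \<Sigma> \<Sigma>' c l' proj.bmap_closed[OF o(1,1) \<Omega> \<Sigma> proj.Id_closed[OF o(1)] a(1) w], symmetric])
  finally show ?thesis .
qed

lemma syzygy_cosyzygy_zero: "bifunctor_iso R C (syzygy_ext C \<Omega> \<omega> 0) (cosyzygy_ext C \<Sigma> \<sigma> 0)"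
  unfolding bifunctor_iso_def
proof (intro exI[of _ "\<lambda>X Y \<delta>. \<delta>"] conjI ballI)
  fix X Y assume "X \<in> Obj C" "Y \<in> Obj C"
  show "(\<lambda>\<delta>. \<delta>) \<in> mod_iso R (bval (syzygy_ext C \<Omega> \<omega> 0) X Y) (bval (cosyzygy_ext C \<Sigma> \<sigma> 0) X Y)"
    by (simp add: syzygy_ext_def cosyzygy_ext_def mod_iso_def mod_hom_def bij_betw_def)
next
  fix X X' Y Y' c a \<delta>
  assume o: "X \<in> Obj C" "X' \<in> Obj C" "Y \<in> Obj C" "Y' \<in> Obj C" and c: "c \<in> arr C X' X" and a: "a \<in> arr C Y Y'"
    and \<delta>: "\<delta> \<in> carrier (bval (syzygy_ext C \<Omega> \<omega> 0) X Y)"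
  have "bmap (syzygy_ext C \<Omega> \<omega> 0) c a \<delta> = bmap (EE C) c a \<delta>"
    by (rule proj.syzygy_ext_bmap[OF o(2,1,3,4) c a])
      (use \<delta> proj.proj_class_self[OF o(2,1) c] in \<open>simp_all add: syzygy_ext_def\<close>)
  moreover have "bmap (syzygy_ext (op_cat C) \<Sigma> \<sigma> 0) a c \<delta> = bmap (EE (op_cat C)) a c \<delta>"
    by (rule inj.syzygy_ext_bmap[of Y' Y X X'])
      (use \<delta> o a c inj.proj_class_self[of Y' Y a] in \<open>simp_all add: syzygy_ext_def\<close>)
  ultimately show "bmap (syzygy_ext C \<Omega> \<omega> 0) c a \<delta> = bmap (cosyzygy_ext C \<Sigma> \<sigma> 0) c a \<delta>"
    by (simp add: op_syzygy_ext)
qed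

text \<open>\<open>\<E>(\<Omega>\<^sup>n\<^sup>+\<^sup>1X, Y) \<cong> \<E>(\<Omega>\<^sup>nX, \<Sigma>Y) \<cong> \<E>(X, \<Sigma>\<^sup>n\<Sigma>Y)\<close>.\<close>

lemma syzygy_cosyzygy_step:
  assumes IH: "bifunctor_iso R C (syzygy_ext C \<Omega> \<omega> n) (cosyzygy_ext C \<Sigma> \<sigma> n)"
  shows "bifunctor_iso R C (syzygy_ext C \<Omega> \<omega> (Suc n)) (cosyzygy_ext C \<Sigma> \<sigma> (Suc n))"
proof -
  let ?S = "syzygy_ext C \<Omega> \<omega>" and ?T = "cosyzygy_ext C \<Sigma> \<sigma>"
  obtain \<eta> where \<eta>: "\<And>X Y. X \<in> Obj C \<Longrightarrow> Y \<in> Obj C \<Longrightarrow> \<eta> X Y \<in> mod_iso R (bval (?S n) X Y) (bval (?T n) X Y)"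
    and \<eta>nat: "\<And>X X' Y Y' c a \<xi>. X \<in> Obj C \<Longrightarrow> X' \<in> Obj C \<Longrightarrow> Y \<in> Obj C \<Longrightarrow> Y' \<in> Obj C \<Longrightarrow> c \<in> arr C X' X \<Longrightarrow>
      a \<in> arr C Y Y' \<Longrightarrow> \<xi> \<in> carrier (bval (?S n) X Y) \<Longrightarrow>
      \<eta> X' Y' (bmap (?S n) c a \<xi>) = bmap (?T n) c a (\<eta> X Y \<xi>)"
    using IH unfolding bifunctor_iso_def by blast
  define good where "good X Y \<phi> \<longleftrightarrow> \<phi> \<in> mod_iso R (Ext C (\<Omega> X) Y) (Ext C X (\<Sigma> Y)) \<and>
    (\<forall>a\<in>arr C (\<Omega> X) (\<Sigma> Y). \<phi> (bmap (EE C) a (Id C Y) (\<sigma> Y)) = bmap (EE C) (Id C X) a (\<omega> X))" for X Y \<phi>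
  define \<phi> where "\<phi> X Y = (SOME \<phi>. good X Y \<phi>)" for X Y
  have good: "good X Y (\<phi> X Y)" if "X \<in> Obj C" "Y \<in> Obj C" for X Y
    unfolding \<phi>_def by (rule someI_ex[where P = "good X Y"]) (use dimension_shift[OF that] in \<open>unfold good_def, blast\<close>)
  have \<phi>: "\<phi> X Y \<in> mod_iso R (Ext C (\<Omega> X) Y) (Ext C X (\<Sigma> Y))" if "X \<in> Obj C" "Y \<in> Obj C" for X Y
    using good[OF that] by (simp add: good_def)
  have \<phi>a: "\<phi> X Y (bmap (EE C) a (Id C Y) (\<sigma> Y)) = bmap (EE C) (Id C X) a (\<omega> X)"
    if "X \<in> Obj C" "Y \<in> Obj C" "a \<in> arr C (\<Omega> X) (\<Sigma> Y)" for X Y a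
    using good[OF that(1,2)] that(3) by (simp add: good_def)
  define \<zeta> where "\<zeta> X Y \<delta> = \<eta> X (\<Sigma> Y) (\<phi> ((\<Omega> ^^ n) X) Y \<delta>)" for X Y \<delta>
  have S: "bval (?S n) X Y = Ext C ((\<Omega> ^^ n) X) Y" and S': "bval (?S (Suc n)) X Y = Ext C (\<Omega> ((\<Omega> ^^ n) X)) Y"
    and T: "bval (?T n) X Y = Ext C X ((\<Sigma> ^^ n) Y)" and T': "bval (?T (Suc n)) X Y = bval (?T n) X (\<Sigma> Y)" for X Y
    by (simp_all add: syzygy_ext_def cosyzygy_ext_def funpow_swap1)
  show ?thesis
    unfolding bifunctor_iso_def
  proof (intro exI[of _ \<zeta>] conjI ballI)
    fix X Y assume X: "X \<in> Obj C" and Y: "Y \<in> Obj C"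
    show "\<zeta> X Y \<in> mod_iso R (bval (?S (Suc n)) X Y) (bval (?T (Suc n)) X Y)"
      unfolding \<zeta>_def[abs_def] S' T'
      by (rule mod_iso_comp[OF \<phi>[OF proj.\<Omega>_pow_obj[OF X] Y] \<eta>[OF X syzygy_objs(3)[OF Y], unfolded S]])
  next
    fix X X' Y Y' c a \<delta>
    assume o: "X \<in> Obj C" "X' \<in> Obj C" "Y \<in> Obj C" "Y' \<in> Obj C" and c: "c \<in> arr C X' X" and a: "a \<in> arr C Y Y'"
      and \<delta>: "\<delta> \<in> carrier (bval (?S (Suc n)) X Y)"
    let ?X = "(\<Omega> ^^ n) X" and ?X' = "(\<Omega> ^^ n) X'"
    note oX = proj.\<Omega>_pow_obj[OF o(1), of n] and oX' = proj.\<Omega>_pow_obj[OF o(2), of n]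
    note \<Sigma> = syzygy_objs(3)[OF o(3)] and \<Sigma>' = syzygy_objs(3)[OF o(4)]
    have \<delta>': "\<delta> \<in> carrier (Ext C (\<Omega> ?X) Y)" using \<delta> by (simp add: S')
    obtain f where f: "f \<in> syzygy_map_pow C \<Omega> \<omega> n X' X (proj_class C X' X c)"
      using proj.syzygy_map_pow_members(1)[OF o(2,1) c] by blast
    have f': "f \<in> arr C ?X' ?X" by (rule proj.syzygy_map_pow_members(2)[OF o(2,1) c f])
    obtain k where k: "proj.lies_over ?X' ?X f k" by (rule proj.lies_over_exists[OF oX oX' f'])
    have k': "k \<in> arr C (\<Omega> ?X') (\<Omega> ?X)" using k by (simp add: proj.lies_over_def)
    have kS: "k \<in> syzygy_map_pow C \<Omega> \<omega> (Suc n) X' X (proj_class C X' X c)"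
      using proj.lies_over_in_syzygy_map[OF f k] proj.proj_class_self[OF syzygy_objs(1)[OF oX'] syzygy_objs(1)[OF oX] k']
      by auto
    obtain l where l: "inj.lies_over Y' Y a l" by (rule inj.lies_over_exists[of Y Y' a]) (use o a in simp_all)
    have l': "l \<in> arr C (\<Sigma> Y) (\<Sigma> Y')" using l by (simp add: inj.lies_over_def)
    obtain m where m: "m \<in> syzygy_map_pow (op_cat C) \<Sigma> \<sigma> n (\<Sigma> Y') (\<Sigma> Y) (proj_class (op_cat C) (\<Sigma> Y') (\<Sigma> Y) l)"
      using inj.syzygy_map_pow_members(1)[of "\<Sigma> Y'" "\<Sigma> Y" l n] \<Sigma> \<Sigma>' l' by auto
    have m': "m \<in> syzygy_map_pow (op_cat C) \<Sigma> \<sigma> (Suc n) Y' Y (proj_class (op_cat C) Y' Y a)"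
      using inj.syzygy_map_pow_shift[of Y' Y a l n] o a l m by (simp only: op_cat_simps) blast
    have \<phi>\<delta>: "\<phi> ?X Y \<delta> \<in> carrier (bval (?S n) X (\<Sigma> Y))"
      unfolding S by (rule mod_hom_closed[OF mod_iso_hom[OF \<phi>[OF oX o(3)]] \<delta>'])
    have \<eta>\<delta>: "\<zeta> X Y \<delta> \<in> carrier (Ext C X ((\<Sigma> ^^ n) (\<Sigma> Y)))"
      unfolding \<zeta>_def T[symmetric] by (rule mod_hom_closed[OF mod_iso_hom[OF \<eta>[OF o(1) \<Sigma>]] \<phi>\<delta>])
    have "bmap (?S (Suc n)) c a \<delta> = bmap (EE C) k a \<delta>"
      by (rule proj.syzygy_ext_bmap[OF o(2,1,3,4) c a kS]) (use \<delta>' in simp)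
    then have "\<zeta> X' Y' (bmap (?S (Suc n)) c a \<delta>) = \<eta> X' (\<Sigma> Y') (\<phi> ?X' Y' (bmap (EE C) k a \<delta>))"
      by (simp add: \<zeta>_def)
    also have "\<phi> ?X' Y' (bmap (EE C) k a \<delta>) = bmap (EE C) f l (\<phi> ?X Y \<delta>)"
      by (rule dimension_shift_natural[OF oX oX' o(3,4) f' a k l \<phi>a[OF oX o(3)] \<phi>a[OF oX' o(4)] \<delta>'])
    also have "\<dots> = bmap (?S n) c l (\<phi> ?X Y \<delta>)"
      by (rule proj.syzygy_ext_bmap[OF o(2,1) \<Sigma> \<Sigma>' c l' f \<phi>\<delta>[unfolded S], symmetric])
    also have "\<eta> X' (\<Sigma> Y') \<dots> = bmap (?T n) c l (\<zeta> X Y \<delta>)"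
      unfolding \<zeta>_def by (rule \<eta>nat[OF o(1,2) \<Sigma> \<Sigma>' c l' \<phi>\<delta>])
    also have "\<dots> = bmap (syzygy_ext (op_cat C) \<Sigma> \<sigma> n) l c (\<zeta> X Y \<delta>)"
      by (simp add: op_syzygy_ext)
    also have "\<dots> = bmap (EE (op_cat C)) m c (\<zeta> X Y \<delta>)"
      by (rule inj.syzygy_ext_bmap[of "\<Sigma> Y'" "\<Sigma> Y" X X', OF _ _ _ _ _ _ m]) (use o \<Sigma> \<Sigma>' l' c \<eta>\<delta> in simp_all)
    also have "\<dots> = bmap (syzygy_ext (op_cat C) \<Sigma> \<sigma> (Suc n)) a c (\<zeta> X Y \<delta>)"
      by (rule inj.syzygy_ext_bmap[of Y' Y X X', OF _ _ _ _ _ _ m', symmetric])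
        (use o a c \<eta>\<delta> in \<open>simp_all add: funpow_swap1\<close>)
    also have "\<dots> = bmap (?T (Suc n)) c a (\<zeta> X Y \<delta>)"
      by (simp only: op_syzygy_ext)
    finally show "\<zeta> X' Y' (bmap (?S (Suc n)) c a \<delta>) = bmap (?T (Suc n)) c a (\<zeta> X Y \<delta>)" .
  qed
qed

lemma syzygy_cosyzygy_iso: "bifunctor_iso R C (syzygy_ext C \<Omega> \<omega> n) (cosyzygy_ext C \<Sigma> \<sigma> n)"
  by (induction n) (use syzygy_cosyzygy_zero syzygy_cosyzygy_step in blast)+

end

lemma (in extriangulated_category) balanced_presentation:
  assumes \<Omega>: "syzygy_choice C \<Omega> P u p \<omega>" and \<Sigma>: "cosyzygy_choice C \<Sigma> I v q \<sigma>"
  shows "balanced_presentation R C \<Omega> P u \<omega> \<Sigma> I q \<sigma>"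
proof -
  have w: "projective C (P X)" "u X \<in> arr C (\<Omega> X) (P X)" "p X \<in> arr C (P X) X"
    "triangle C X (\<Omega> X) (\<omega> X) (u X) (p X)" if "X \<in> Obj C" for X
    using \<Omega> that by (auto simp: syzygy_choice_def)
  have s: "injective C (I Y)" "v Y \<in> arr C Y (I Y)" "q Y \<in> arr C (I Y) (\<Sigma> Y)"
    "triangle C (\<Sigma> Y) Y (\<sigma> Y) (v Y) (q Y)" if "Y \<in> Obj C" for Y
    using \<Sigma> that by (auto simp: cosyzygy_choice_def)
  have proj: "ext_presentation R C \<Omega> P u \<omega>"
  proof (intro ext_presentation.intro ext_presentation_axioms.intro projective_presentation.intro
      projective_presentation_axioms.intro)
    show "bilinear_bifunctor R C (EE C)" by (rule bilinear_bifunctor_axioms)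
    fix X assume X: "X \<in> Obj C"
    note wX = w[OF X]
    show "\<Omega> X \<in> Obj C" "\<omega> X \<in> carrier (Ext C X (\<Omega> X))" using triangle_objs[OF wX(4)] by auto
    show "P X \<in> Obj C" "projective C (P X)" using wX(1) by (auto simp: projective_def)
    show "u X \<in> arr C (\<Omega> X) (P X)" by (rule wX)
    show "carrier (Ext C (P X) Y) = {\<zero>\<^bsub>Ext C (P X) Y\<^esub>}" if "Y \<in> Obj C" for Y
      using wX(1) that by (simp add: projective_def)
    fix M assume M: "M \<in> Obj C"
    show "\<exists>a\<in>arr C (\<Omega> X) M. bmap (EE C) (Id C X) a (\<omega> X) = \<delta>" if "\<delta> \<in> carrier (Ext C X M)" for \<delta>
      by (rule classifying_map_exists[OF wX(4,1,2,3) M that])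
    show "\<exists>b\<in>arr C (P X) M. a = b \<circledcirc> u X"
      if "a \<in> arr C (\<Omega> X) M" "bmap (EE C) (Id C X) a (\<omega> X) = \<zero>\<^bsub>Ext C X M\<^esub>" for a
      by (rule classifying_zero_factors[OF wX(4,1,2,3) M that])
  qed
  have inj: "ext_presentation R (op_cat C) \<Sigma> I q \<sigma>"
  proof (intro ext_presentation.intro ext_presentation_axioms.intro projective_presentation.intro
      projective_presentation_axioms.intro; (unfold op_cat_simps op_projective)?)
    show "bilinear_bifunctor R (op_cat C) (EE (op_cat C))"
      by (rule op_bilinear_bifunctor[OF bilinear_bifunctor_axioms])
    fix Y assume Y: "Y \<in> Obj C"
    note sY = s[OF Y]
    show "\<Sigma> Y \<in> Obj C" "\<sigma> Y \<in> carrier (Ext C (\<Sigma> Y) Y)" using triangle_objs[OF sY(4)] by auto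
    show "I Y \<in> Obj C" "injective C (I Y)" using sY(1) by (auto simp: injective_def)
    show "q Y \<in> arr C (I Y) (\<Sigma> Y)" by (rule sY)
    show "carrier (Ext C X (I Y)) = {\<zero>\<^bsub>Ext C X (I Y)\<^esub>}" if "X \<in> Obj C" for X
      using sY(1) that by (simp add: injective_def)
    fix A assume A: "A \<in> Obj C"
    show "\<exists>c\<in>arr C A (\<Sigma> Y). bmap (EE C) c (Id C Y) (\<sigma> Y) = \<delta>" if "\<delta> \<in> carrier (Ext C A Y)" for \<delta>
      by (rule coclassifying_map_exists[OF sY(4,1,2,3) A that])
    show "\<exists>b\<in>arr C A (I Y). c = q Y \<circledcirc> b"
      if "c \<in> arr C A (\<Sigma> Y)" "bmap (EE C) c (Id C Y) (\<sigma> Y) = \<zero>\<^bsub>Ext C A Y\<^esub>" for c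
      by (rule coclassifying_zero_factors[OF sY(4,1,2,3) A that])
  qed
  show ?thesis by (rule balanced_presentation.intro[OF proj inj])
qed

theorem corollary3p21:
  fixes R :: "('r, 'k) ring_scheme"
    and C :: "('r, 'o, 'a, 'e, 'z) ext_cat_scheme"
    and \<Omega> P \<Sigma> I :: "'o \<Rightarrow> 'o"
    and u p v q :: "'o \<Rightarrow> 'a"
    and \<omega> \<sigma> :: "'o \<Rightarrow> 'e"
    and n :: nat
  assumes "extriangulated_category R C"
    and "enough_projectives C"
    and "enough_injectives C"
    and "syzygy_choice C \<Omega> P u p \<omega>"
    and "cosyzygy_choice C \<Sigma> I v q \<sigma>"
    and "n > 0"
  shows "bifunctor_iso R C (higher_ext R C n) (syzygy_ext C \<Omega> \<omega> (n - 1)) \<and>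
         bifunctor_iso R C (syzygy_ext C \<Omega> \<omega> (n - 1)) (cosyzygy_ext C \<Sigma> \<sigma> (n - 1))"
proof -
  interpret balanced_presentation R C \<Omega> P u \<omega> \<Sigma> I q \<sigma>
    by (rule extriangulated_category.balanced_presentation[OF assms(1,4,5)])
  show ?thesis
    unfolding higher_ext_def using proj.higher_ext_Suc_iso syzygy_cosyzygy_iso by blast
qed

end
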